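(* Let $d\ge1$, $0<\alpha<2$, let $\psi$ be a Bernstein function regularly varying at zero of index $\alpha/2$ with $\psi(0)=0$ and $\psi(1)=1$, and let $p$ be the one-step probability of a random walk $S$ on $\mathbb{Z}^d$ in the class $\mathscr{S}$ having period $r$. Let $p_\psi(x,n)$ be the transition function of the subordinate random walk $S^\psi$. As $n$ and $\|x\|$ tend to infinity in such a way that $n\,\psi(\|x\|^{-2})$ tends to zero, we have $$\big(\delta_0+p+p^{(2)}+\dots+p^{(r-1)}\big)*p_\psi(x,n)\sim r\,C_{d,\alpha}\,n\,\|x\|^{-d}\,\psi\big(\|x\|^{-2}\big),$$ where the convolution is in the variable $x$ and $$C_{d,\alpha}=\alpha\,2^{\alpha/2-1}\,\pi^{-d/2-1}\,(\det Q)^{-1/2}\,\Gamma\Big(\frac{\alpha}{2}\Big)\Gamma\Big(\frac{d+\alpha}{2}\Big)\sin\Big(\frac{\pi\alpha}{2}\Big).$$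
   Context: Class $\mathscr{S}$: $p$ is a probability measure on $\mathbb{Z}^d$ with finite support, $\sum_vp(v)v=0$, and for each $x\in\mathbb{Z}^d$ there is $n\in\mathbb{N}$ with $p(x,n)>0$, where $p(\cdot,n)=p^{(n)}$ is the $n$-fold convolution of $p$; $S$ is the random walk started at $0$ with step law $p$. The period is $r=\gcd\{n\ge1:p(0,n)>0\}$. $\delta_0$ is the Dirac mass at the origin. $Q$ is the (positive definite) matrix defined by $\langle Qu,u\rangle=\sum_vp(v)\langle v,u\rangle^2$, and $\|x\|^2=\langle Q^{-1}x,x\rangle$. A Bernstein function is a function $\psi:[0,\infty)\to[0,\infty)$, continuous on $[0,\infty)$ and smooth on $(0,\infty)$, with $(-1)^n\psi^{(n)}(x)\le0$ for all integers $n\ge1$ and $x>0$. It has a representation $\psi(x)=a+bx+\int_{[0,\infty)}(1-e^{-xs})\,d\nu(s)$ with $a,b\ge0$ and $\int\min\{1,s\}\,d\nu(s)<\infty$. It is regularly varying at zero of index $\beta$ if $\psi(x)=x^{\beta}\ell(1/x)$ near $0$, where $\ell(\lambda x)/\ell(x)\to1$ as $x\to\infty$ for every $\lambda>0$. For $k\ge1$ put $c(\psi,k)=\frac1{k!}\int_{[0,\infty)}t^ke^{-t}\,d\nu(t)+b\,\mathbf 1_{\{k=1\}}$. Let $\tau_n=R_1+\dots+R_n$ with $R_i$ i.i.d., independent of $S$, $\mathbb{P}(R_i=k)=c(\psi,k)$. The subordinate random walk is $S^\psi_n=S_{\tau_n}$ and $p_\psi(x,n)=\mathbb{P}(S^\psi_n=x)=\sum_{k\ge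 n}p(x,k)\mathbb{P}(\tau_n=k)$. $f\sim g$ in the stated regime means $f/g\to1$ along every sequence $(x_k,n_k)$ in that regime. *)

theory Defs
  imports "HOL-Probability.Probability"
begin

text \<open>
  The lattice of dimension d = CARD('d) is the type \<open>int ^ 'd\<close>; since \<open>'d\<close> is nonempty, d is
  at least 1.
\<close>

definition lat_vec :: "int ^ 'd \<Rightarrow> real ^ 'd::finite" where
  "lat_vec v = (\<chi> i. real_of_int (v $ i))"

definition dirac0 :: "int ^ 'd::finite \<Rightarrow> real" where
  "dirac0 = indicator {0}"

definition lat_conv ::
  "(int ^ 'd \<Rightarrow> real) \<Rightarrow> (int ^ 'd \<Rightarrow> real) \<Rightarrow> int ^ 'd \<Rightarrow> real" where
  "lat_conv f g x = (\<Sum>\<^sub>\<infinity>y. f y * g (x - y))"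

primrec conv_power :: "(int ^ 'd::finite \<Rightarrow> real) \<Rightarrow> nat \<Rightarrow> int ^ 'd \<Rightarrow> real" where
  "conv_power f 0 = dirac0"
| "conv_power f (Suc n) = lat_conv f (conv_power f n)"

definition class_S :: "(int ^ 'd::finite) pmf \<Rightarrow> bool" where
  "class_S p \<longleftrightarrow>
     finite (set_pmf p) \<and>
     (\<Sum>v\<in>set_pmf p. pmf p v *\<^sub>R lat_vec v) = 0 \<and>
     (\<forall>x. \<exists>n. conv_power (pmf p) n x > 0)"

definition period :: "(int ^ 'd::finite) pmf \<Rightarrow> nat" where
  "period p = Gcd {n. 1 \<le> n \<and> conv_power (pmf p) n 0 > 0}"

definition cov_matrix :: "(int ^ 'd::finite) pmf \<Rightarrow> real ^ 'd ^ 'd" where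
  "cov_matrix p =
     (\<chi> i j. \<Sum>v\<in>set_pmf p. pmf p v * (lat_vec v $ i * lat_vec v $ j))"

text \<open>
  The matrix Q is given in terms of its quadratic form, which determines it among symmetric
  matrices; the following two facts identify \<open>cov_matrix p\<close> as this Q.
\<close>

lemma transpose_cov_matrix: "transpose (cov_matrix p) = cov_matrix p"
  by (simp add: cov_matrix_def transpose_def mult.commute)

lemma cov_matrix_quadratic_form:
  "(cov_matrix p *v u) \<bullet> u = (\<Sum>v\<in>set_pmf p. pmf p v * (lat_vec v \<bullet> u)\<^sup>2)"
proof -
  have "(cov_matrix p *v u) \<bullet> u =
      (\<Sum>i\<in>UNIV. \<Sum>j\<in>UNIV. \<Sum>v\<in>set_pmf p.
         pmf p v * ((lat_vec v $ i * u $ i) * (lat_vec v $ j * u $ j)))"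
    by (simp add: cov_matrix_def matrix_vector_mult_def inner_vec_def sum_distrib_right
        sum_distrib_left mult_ac)
  also have "\<dots> = (\<Sum>i\<in>UNIV. \<Sum>v\<in>set_pmf p. \<Sum>j\<in>UNIV.
         pmf p v * ((lat_vec v $ i * u $ i) * (lat_vec v $ j * u $ j)))"
    by (intro sum.cong refl sum.swap)
  also have "\<dots> = (\<Sum>v\<in>set_pmf p. \<Sum>i\<in>UNIV. \<Sum>j\<in>UNIV.
         pmf p v * ((lat_vec v $ i * u $ i) * (lat_vec v $ j * u $ j)))"
    by (rule sum.swap)
  also have "\<dots> = (\<Sum>v\<in>set_pmf p. pmf p v * (lat_vec v \<bullet> u)\<^sup>2)"
    unfolding inner_vec_def power2_eq_square sum_product by (simp add: sum_distrib_left)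
  finally show ?thesis .
qed

definition cov_norm :: "(int ^ 'd::finite) pmf \<Rightarrow> int ^ 'd \<Rightarrow> real" where
  "cov_norm p x = sqrt ((matrix_inv (cov_matrix p) *v lat_vec x) \<bullet> lat_vec x)"

text \<open>Only the values of \<open>\<psi>\<close> on the half-line \<open>{0..}\<close> matter.\<close>

definition bernstein_function :: "(real \<Rightarrow> real) \<Rightarrow> bool" where
  "bernstein_function \<psi> \<longleftrightarrow>
     (\<forall>x\<ge>0. \<psi> x \<ge> 0) \<and>
     continuous_on {0..} \<psi> \<and>
     (\<forall>n. \<forall>x>0. (deriv ^^ n) \<psi> field_differentiable (at x)) \<and>
     (\<forall>n\<ge>1. \<forall>x>0. (- 1) ^ n * (deriv ^^ n) \<psi> x \<le> 0)"

text \<open>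
  The triplet (a, b, \<nu>) represents \<open>\<psi>\<close>; \<nu> is a Borel measure of which only the part on
  \<open>{0..}\<close> is used.  Every Bernstein function has such a triplet, unique up to the (irrelevant)
  mass of \<nu> at 0.
\<close>

definition bernstein_representation ::
  "(real \<Rightarrow> real) \<Rightarrow> real \<Rightarrow> real \<Rightarrow> real measure \<Rightarrow> bool" where
  "bernstein_representation \<psi> a b \<nu> \<longleftrightarrow>
     a \<ge> 0 \<and> b \<ge> 0 \<and> sets \<nu> = sets borel \<and>
     set_integrable \<nu> {0..} (\<lambda>s. min 1 s) \<and>
     (\<forall>x\<ge>0. \<psi> x = a + b * x + (LINT s:{0..}|\<nu>. 1 - exp (- (x * s))))"

definition slowly_varying :: "(real \<Rightarrow> real) \<Rightarrow> bool" where
  "slowly_varying l \<longleftrightarrow> (\<forall>c>0. ((\<lambda>x. l (c * x) / l x) \<longlongrightarrow> 1) at_top)"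

definition regularly_varying_at_zero :: "(real \<Rightarrow> real) \<Rightarrow> real \<Rightarrow> bool" where
  "regularly_varying_at_zero \<psi> \<beta> \<longleftrightarrow>
     (\<exists>l. slowly_varying l \<and> (\<forall>\<^sub>F x in at_right 0. \<psi> x = x powr \<beta> * l (1 / x)))"

definition bernstein_coeff :: "real \<Rightarrow> real measure \<Rightarrow> nat \<Rightarrow> real" where
  "bernstein_coeff b \<nu> k =
     1 / fact k * (LINT t:{0..}|\<nu>. t ^ k * exp (- t)) + (if k = 1 then b else 0)"

definition partial_sum :: "(nat \<Rightarrow> 'w \<Rightarrow> 'a::comm_monoid_add) \<Rightarrow> nat \<Rightarrow> 'w \<Rightarrow> 'a" where
  "partial_sum X n \<omega> = (\<Sum>i<n. X i \<omega>)"

definition iid_steps :: "'w measure \<Rightarrow> 'a pmf \<Rightarrow> (nat \<Rightarrow> 'w \<Rightarrow> 'a) \<Rightarrow> bool" where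
  "iid_steps M p X \<longleftrightarrow>
     prob_space.indep_vars M (\<lambda>_. count_space UNIV) X UNIV \<and>
     (\<forall>i. distr M (count_space UNIV) (X i) = measure_pmf p)"

text \<open>
  The weights \<open>bernstein_coeff b \<nu> k\<close> with \<open>k \<ge> 1\<close> sum to \<open>\<psi> 1 - \<psi> 0\<close>; for \<open>\<psi> 0 = 0\<close> and
  \<open>\<psi> 1 = 1\<close> they thus leave no mass for \<open>k = 0\<close>.
\<close>

definition iid_subordinator_steps ::
  "'w measure \<Rightarrow> real \<Rightarrow> real measure \<Rightarrow> (nat \<Rightarrow> 'w \<Rightarrow> nat) \<Rightarrow> bool" where
  "iid_subordinator_steps M b \<nu> R \<longleftrightarrow>
     prob_space.indep_vars M (\<lambda>_. count_space UNIV) R UNIV \<and>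
     (\<forall>i. \<forall>k\<ge>1. measure M {\<omega> \<in> space M. R i \<omega> = k} = bernstein_coeff b \<nu> k)"

text \<open>
  Independence of the \<sigma>-algebras generated by the two processes; \<open>prob_space.indep_var\<close> would
  force both to have the same state type.
\<close>

definition generated_events :: "'w measure \<Rightarrow> (nat \<Rightarrow> 'w \<Rightarrow> 'a) \<Rightarrow> 'w set set" where
  "generated_events M Y =
     sets (vimage_algebra (space M) (\<lambda>\<omega> i. Y i \<omega>) (PiM UNIV (\<lambda>_. count_space UNIV)))"

definition independent_processes ::
  "'w measure \<Rightarrow> (nat \<Rightarrow> 'w \<Rightarrow> 'a) \<Rightarrow> (nat \<Rightarrow> 'w \<Rightarrow> 'b) \<Rightarrow> bool" where
  "independent_processes M Y Z \<longleftrightarrow>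
     prob_space.indep_set M (generated_events M Y) (generated_events M Z)"

definition subordinate_walk ::
  "(nat \<Rightarrow> 'w \<Rightarrow> int ^ 'd::finite) \<Rightarrow> (nat \<Rightarrow> 'w \<Rightarrow> nat) \<Rightarrow> nat \<Rightarrow> 'w \<Rightarrow> int ^ 'd" where
  "subordinate_walk X R n \<omega> = partial_sum X (partial_sum R n \<omega>) \<omega>"

definition subordinate_transition ::
  "'w measure \<Rightarrow> (nat \<Rightarrow> 'w \<Rightarrow> int ^ 'd::finite) \<Rightarrow> (nat \<Rightarrow> 'w \<Rightarrow> nat) \<Rightarrow> int ^ 'd \<Rightarrow> nat \<Rightarrow> real"
  where
  "subordinate_transition M X R x n =
     measure M {\<omega> \<in> space M. subordinate_walk X R n \<omega> = x}"

definition C_const :: "(int ^ 'd::finite) pmf \<Rightarrow> real \<Rightarrow> real" where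
  "C_const p \<alpha> =
     \<alpha> * 2 powr (\<alpha> / 2 - 1) * pi powr (- real CARD('d) / 2 - 1)
       * det (cov_matrix p) powr (- 1 / 2)
       * Gamma (\<alpha> / 2) * Gamma ((real CARD('d) + \<alpha>) / 2) * sin (pi * \<alpha> / 2)"

end

theory Submission
  imports Defs "HOL-Real_Asymp.Real_Asymp"
begin

text \<open>
  Write \<open>\<tau>\<close> for the subordinator at time \<open>n\<close>, \<open>\<rho>\<close> for the norm of \<open>x\<close>, \<open>\<beta> = \<alpha> / 2\<close>, and
  \<open>u(x, k) = p(x, k) + \<dots> + p(x, k + r - 1)\<close>.  The left-hand side of the theorem is the
  expectation of \<open>u(x, \<tau>)\<close>.  By Fourier inversion, \<open>u(x, k)\<close> is uniformly close to \<open>r\<close> times the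
  Gaussian density: at the other points where the characteristic function has modulus 1 it equals
  a nontrivial \<open>r\<close>-th root of unity, so averaging over a period kills their contribution.
  Together with a Gaussian upper bound for small \<open>k\<close> the error is
  \<open>o(\<rho>\<^sup>-\<^sup>d (1 - exp (- k / \<rho>\<^sup>2)))\<close> uniformly in \<open>k\<close>, and the expectation of
  \<open>1 - exp (- \<tau> / \<rho>\<^sup>2)\<close> is at most \<open>n \<psi>(\<rho>\<^sup>-\<^sup>2)\<close>.

  For the main term, the Laplace transform of \<open>\<tau>\<close> is explicit and gives
  \<open>E (1 - exp (- m \<tau> / \<rho>\<^sup>2)) \<sim> m\<^sup>\<beta> n \<psi>(\<rho>\<^sup>-\<^sup>2)\<close> for every integer \<open>m\<close>.  The Gaussian density
  divided by \<open>1 - exp (- k / \<rho>\<^sup>2)\<close> is \<open>\<rho>\<^sup>-\<^sup>d\<close> times a continuous function of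
  \<open>exp (- k / \<rho>\<^sup>2) \<in> [0, 1]\<close>; approximating it by polynomials yields the limit, an integral of
  the Gaussian kernel against the stable Levy measure, hence a Gamma integral.
\<close>

section \<open>Gamma integrals and the stable Levy measure\<close>

text \<open>Since \<open>n \<psi>(\<rho>^-2)\<close> tends to 0, \<open>\<tau> / \<rho>^2\<close>
  tends to 0 in probability, and the asymptotics come from the rare event, of probability of order
  \<open>n \<psi>(\<rho>^-2)\<close>, that \<open>\<tau>\<close> is comparable with
  \<open>\<rho>^2\<close>. Dividing the law of \<open>\<tau> / \<rho>^2\<close> by
  \<open>n \<psi>(\<rho>^-2)\<close> makes its mass explode near 0, just as the stable Levy measure
  is infinite there. The weight \<open>1 - exp (- s)\<close> repairs this: the weighted and rescaled
  laws have total mass tending to 1, and in the variable \<open>w = exp (- s)\<close> they live on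
  the compact interval \<open>[0, 1]\<close>, so that no mass can escape and convergence of all
  moments decides. Main term and error are both measured against this weight for that reason. The
  obstacle is the range of \<open>k\<close> far below \<open>\<rho>^2\<close>. There the weight is
  only about \<open>k / \<rho>^2\<close>, while the error \<open>o(k^(- d / 2))\<close> of a local
  limit theorem may be larger than \<open>\<rho>^(- d)\<close>. The Gaussian upper bound, which
  decays faster than any power of \<open>k / \<rho>^2\<close>, closes this gap; it is itself drawn
  from the local limit theorem by exponential tilting.\<close>

lemma Gamma_reflection_real:
  fixes x :: real
  assumes "0 < x" "x < 1"
  shows "Gamma x * Gamma (1 - x) = pi / sin (pi * x)"
proof -
  have "of_real (Gamma x * Gamma (1 - x)) = (of_real (pi / sin (pi * x)) :: complex)"
    using Gamma_reflection_complex[of "of_real x"]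
      sin_of_real[of "pi * x", where 'a=complex] Gamma_complex_of_real[of x] Gamma_complex_of_real[of "1 - x"]
    by simp
  thus ?thesis by (simp only: of_real_eq_iff)
qed

lemma nn_integral_Gamma:
  fixes x l :: real
  assumes x: "x > 0" and l: "l > 0"
  shows "(\<integral>\<^sup>+s. ennreal (indicator {0<..} s * (s powr (x - 1) * exp (- (l * s)))) \<partial>lborel) = ennreal (Gamma x * l powr (- x))"
proof -
  let ?I1 = "(\<integral>\<^sup>+s. ennreal (indicator {0<..} s * (s powr (x - 1) * exp (- s))) \<partial>lborel)"
  let ?I = "(\<integral>\<^sup>+s. ennreal (indicator {0<..} s * (s powr (x - 1) * exp (- (l * s)))) \<partial>lborel)"
  have "(\<integral>\<^sup>+s. ennreal (indicator {0..} s * (s powr (x - 1) / exp s)) \<partial>lborel) = ennreal (Gamma x)"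
    using nn_integral_has_integral_lebesgue[OF _ Gamma_integral_real[OF x]] by simp
  moreover have "indicator {0..} s * (s powr (x - 1) / exp s) = indicator {0<..} s * (s powr (x - 1) * exp (- s))" for s :: real
    by (auto simp: indicator_def exp_minus divide_inverse)
  ultimately have 1: "?I1 = ennreal (Gamma x)"
    by simp
  have "?I1
      = ennreal \<bar>l\<bar> * (\<integral>\<^sup>+s. ennreal (indicator {0<..} (0 + l * s) * ((0 + l * s) powr (x - 1) * exp (- (0 + l * s)))) \<partial>lborel)"
    using l by (intro nn_integral_real_affine) auto
  also have "\<dots> = ennreal l * (\<integral>\<^sup>+s. ennreal (l powr (x - 1)) * ennreal (indicator {0<..} s * (s powr (x - 1) * exp (- (l * s)))) \<partial>lborel)"
    using l by (auto simp: indicator_def powr_mult zero_less_mult_iff ennreal_mult[symmetric] mult_ac intro!: arg_cong2[where f="(*)"] nn_integral_cong)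
  also have "\<dots> = ennreal l * ennreal (l powr (x - 1)) * ?I"
    by (subst nn_integral_cmult) (auto simp: mult.assoc)
  also have "ennreal l * ennreal (l powr (x - 1)) = ennreal (l powr x)"
    using l by (simp add: ennreal_mult[symmetric] powr_mult_base)
  finally have "ennreal (l powr (- x)) * ennreal (Gamma x) = ennreal (l powr (- x)) * ennreal (l powr x) * ?I"
    unfolding 1 by (simp add: mult.assoc)
  also have "ennreal (l powr (- x)) * ennreal (l powr x) = 1"
    using l by (simp add: ennreal_mult[symmetric] powr_add[symmetric])
  finally show ?thesis using Gamma_real_pos[OF x] by (simp add: ennreal_mult[symmetric] mult.commute)
qed

text \<open>\<open>1 - exp (- l s)\<close> is the integral of \<open>s exp (- t s)\<close> over
  \<open>t\<close> in \<open>[0, l]\<close>. After exchanging the integrals, the inner one over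
  \<open>s\<close> is the Gamma integral \<open>Gamma (1 - \<beta>) t^(\<beta> - 1)\<close>, and
  integrating over \<open>t\<close> gives the power of \<open>l\<close>.\<close>

lemma nn_integral_one_minus_exp_powr:
  fixes \<beta> l :: real
  assumes \<beta>: "0 < \<beta>" "\<beta> < 1" and l: "l > 0"
  shows "(\<integral>\<^sup>+s. ennreal (indicator {0<..} s * ((1 - exp (- (l * s))) * s powr (- 1 - \<beta>))) \<partial>lborel) = ennreal (Gamma (1 - \<beta>) / \<beta> * l powr \<beta>)"
proof -
  let ?J = "\<lambda>s. \<integral>\<^sup>+t. ennreal (indicator {0..l} t * (s * exp (- (t * s)))) \<partial>lborel"
  let ?h = "\<lambda>s. ennreal (indicator {0<..} s * ((1 - exp (- (l * s))) * s powr (- 1 - \<beta>)))"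
  let ?f = "\<lambda>s t. indicator {0<..} s * (indicator {0<..l} t * (s powr (1 - \<beta> - 1) * exp (- (t * s)))) :: real"
  have inner: "?h s = (\<integral>\<^sup>+t. ennreal (?f s t) \<partial>lborel)" for s
  proof (cases "s > 0")
    case True
    have "((\<lambda>t. s * exp (- (t * s))) has_integral (- exp (- (l * s)) - (- exp (- (0 * s))))) {0..l}"
      using l by (intro fundamental_theorem_of_calculus)
        (auto intro!: derivative_eq_intros simp: has_real_derivative_iff_has_vector_derivative[symmetric])
    hence "?J s = ennreal (1 - exp (- (l * s)))"
      using True by (intro nn_integral_has_integral_lebesgue) auto
    hence "ennreal (s powr (- 1 - \<beta>)) * ?J s = ennreal (s powr (- 1 - \<beta>)) * ennreal (1 - exp (- (l * s)))"
      by simp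
    also have "\<dots> = ?h s"
      using True l by (simp add: ennreal_mult[symmetric] mult.commute)
    also have "ennreal (s powr (- 1 - \<beta>)) * ?J s
       = (\<integral>\<^sup>+t. ennreal (s powr (- 1 - \<beta>)) * (ennreal (indicator {0..l} t * (s * exp (- (t * s))))) \<partial>lborel)"
      by (intro nn_integral_cmult[symmetric]) auto
    also have "\<dots> = (\<integral>\<^sup>+t. ennreal (?f s t) \<partial>lborel)"
    proof (rule nn_integral_cong_AE)
      have "s powr (- 1 - \<beta>) * s = s powr (1 - \<beta> - 1)"
        using True powr_mult_base[of s "- 1 - \<beta>"] by (simp add: mult.commute)
      hence e: "s powr (- 1 - \<beta>) * (s * c) = s powr (1 - \<beta> - 1) * c" for c by (simp flip: mult.assoc)
      have "AE t in lborel. t \<noteq> (0::real)" by (rule AE_lborel_singleton)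
      thus "AE t in lborel. ennreal (s powr (- 1 - \<beta>)) * (ennreal (indicator {0..l} t * (s * exp (- (t * s))))) = ennreal (?f s t)"
      proof eventually_elim
        case (elim t)
        thus ?case using True e[of "exp (- (t * s))"] by (auto simp: indicator_def ennreal_mult[symmetric])
      qed
    qed
    finally show ?thesis ..
  qed simp
  have "(\<integral>\<^sup>+s. ?h s \<partial>lborel) = (\<integral>\<^sup>+s. \<integral>\<^sup>+t. ennreal (?f s t) \<partial>lborel \<partial>lborel)"
    unfolding inner ..
  also have "\<dots> = (\<integral>\<^sup>+t. \<integral>\<^sup>+s. ennreal (?f s t) \<partial>lborel \<partial>lborel)"
    by (rule lborel_pair.Fubini') measurable
  also have "\<dots> = (\<integral>\<^sup>+t. ennreal (indicator {0..l} t * (Gamma (1 - \<beta>) * t powr (\<beta> - 1))) \<partial>lborel)"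
  proof (rule nn_integral_cong_AE)
    have "AE t in lborel. t \<noteq> (0::real)" by (rule AE_lborel_singleton)
    thus "AE t in lborel. (\<integral>\<^sup>+s. ennreal (?f s t) \<partial>lborel) = ennreal (indicator {0..l} t * (Gamma (1 - \<beta>) * t powr (\<beta> - 1)))"
    proof eventually_elim
      case (elim t)
      show ?case
      proof (cases "t \<in> {0<..l}")
        case True
        thus ?thesis using nn_integral_Gamma[of "1 - \<beta>" t] \<beta> by simp
      next
        case False
        thus ?thesis using elim by (auto simp: indicator_def)
      qed
    qed
  qed
  also have "\<dots> = ennreal (Gamma (1 - \<beta>) * (l powr (\<beta> - 1 + 1) / (\<beta> - 1 + 1)))"
    using \<beta> l has_integral_powr_from_0[of "\<beta> - 1" l] Gamma_real_pos[of "1 - \<beta>"]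
    by (intro nn_integral_has_integral_lebesgue has_integral_mult_right) auto
  finally show ?thesis by simp
qed

text \<open>The substitution \<open>s = 1 / (2 u)\<close> maps the half-line onto itself and
  produces the Gamma integral. For \<open>\<kappa> = d / 2 + \<beta>\<close> the integrand is, up to
  a constant, the Gaussian factor \<open>exp (- 1 / (2 s)) s^(- d / 2)\<close> times the stable Levy
  density.\<close>

lemma inverse_gamma_integral:
  fixes \<kappa> :: real
  assumes \<kappa>: "\<kappa> > 0"
  shows "integrable lborel (\<lambda>s. indicator {0<..} s * (s powr (- \<kappa> - 1) * exp (- 1 / (2 * s))))"
    and "(LINT s|lborel. indicator {0<..} s * (s powr (- \<kappa> - 1) * exp (- 1 / (2 * s)))) = 2 powr \<kappa> * Gamma \<kappa>"
proof -
  let ?f = "\<lambda>s::real. s powr (- \<kappa> - 1) * exp (- 1 / (2 * s))"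
  let ?g = "\<lambda>u::real. 1 / (2 * u)"
  let ?g' = "\<lambda>u::real. - 1 / (2 * u\<^sup>2)"
  have img: "?g ` {0<..} = {0<..}"
    by (auto simp: image_iff intro!: bexI[of _ "1 / (2 * _)"])
  have eq: "\<bar>?g' u\<bar> * ?f (?g u) = 2 powr \<kappa> * (u powr (\<kappa> - 1) / exp u)" if "u > 0" for u
  proof -
    have "(1 / (2 * u)) powr (- \<kappa> - 1) = (2 * u) powr (\<kappa> + 1)"
      using that by (simp add: powr_divide powr_minus_divide powr_diff powr_add)
    also have "\<dots> = 2 powr \<kappa> * 2 * (u powr (\<kappa> - 1) * u\<^sup>2)"
      using that by (simp add: powr_mult powr_add powr_diff power2_eq_square)
    finally have e1: "(1 / (2 * u)) powr (- \<kappa> - 1) = 2 powr \<kappa> * 2 * (u powr (\<kappa> - 1) * u\<^sup>2)" .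
    have e2: "- 1 / (2 * (1 / (2 * u))) = - u" and e3: "\<bar>- 1 / (2 * u\<^sup>2)\<bar> = 1 / (2 * u\<^sup>2)"
      using that by simp_all
    have cancel: "1 / (2 * w) * (c * 2 * (A * w) * inverse B) = c * (A / B)" if "w \<noteq> 0" for w c A B :: real
    proof -
      have "1 / (2 * w) * (c * 2 * (A * w) * inverse B) = (w / w) * (c * (A / B))"
        unfolding divide_inverse by (simp only: inverse_mult_distrib mult_ac) simp
      thus ?thesis using that by simp
    qed
    show ?thesis unfolding e1 e2 e3 exp_minus by (rule cancel) (use that in simp)
  qed
  have "((\<lambda>t. t powr (\<kappa> - 1) / exp t) has_integral Gamma \<kappa>) {0<..}"
  proof -
    have n: "negligible {t \<in> {0..} - {0<..}. t powr (\<kappa> - 1) / exp t \<noteq> (0::real)}"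
      "negligible {t \<in> {0<..} - {0..}. t powr (\<kappa> - 1) / exp t \<noteq> (0::real)}"
      by (rule negligible_subset[of "{0}"], auto)+
    show ?thesis by (rule has_integral_spike_set_eq[OF n, THEN iffD1, OF Gamma_integral_real[OF \<kappa>]])
  qed
  hence hi: "((\<lambda>t. 2 powr \<kappa> * (t powr (\<kappa> - 1) / exp t)) has_integral 2 powr \<kappa> * Gamma \<kappa>) {0<..}"
    by (rule has_integral_mult_right)
  hence hi': "((\<lambda>u. \<bar>?g' u\<bar> * ?f (?g u)) has_integral 2 powr \<kappa> * Gamma \<kappa>) {0<..}"
    by (rule has_integral_eq[rotated]) (use eq in auto)
  have ai: "(\<lambda>u. \<bar>?g' u\<bar> * ?f (?g u)) absolutely_integrable_on {0<..}"
    by (rule nonnegative_absolutely_integrable_1[OF has_integral_integrable[OF hi']]) auto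
  have "?f absolutely_integrable_on (?g ` {0<..}) \<and> integral (?g ` {0<..}) ?f = 2 powr \<kappa> * Gamma \<kappa>"
  proof (rule has_absolute_integral_change_of_variables_1'[THEN iffD1])
    show "(?g has_field_derivative ?g' u) (at u within {0<..})" if "u \<in> {0<..}" for u
      using that by (auto intro!: derivative_eq_intros simp: power2_eq_square field_simps)
    show "inj_on ?g {0<..}" by (auto simp: inj_on_def)
    show "(\<lambda>u. \<bar>?g' u\<bar> * ?f (?g u)) absolutely_integrable_on {0<..} \<and> integral {0<..} (\<lambda>u. \<bar>?g' u\<bar> * ?f (?g u)) = 2 powr \<kappa> * Gamma \<kappa>"
      using ai hi' by (simp add: integral_unique)
  qed simp
  hence ab: "?f absolutely_integrable_on {0<..}" and val: "integral {0<..} ?f = 2 powr \<kappa> * Gamma \<kappa>"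
    unfolding img by auto
  have m: "(\<lambda>s. indicator {0<..} s *\<^sub>R ?f s) \<in> borel_measurable lborel" by measurable
  have sil: "integrable lebesgue (\<lambda>s. indicator {0<..} s *\<^sub>R ?f s)"
    using ab by (simp add: set_integrable_def)
  hence "integrable lborel (\<lambda>s. indicator {0<..} s *\<^sub>R ?f s)"
    using m by (simp add: integrable_completion)
  thus "integrable lborel (\<lambda>s. indicator {0<..} s * ?f s)" by simp
  have "(LINT s|lborel. indicator {0<..} s *\<^sub>R ?f s) = (LINT s|lebesgue. indicator {0<..} s *\<^sub>R ?f s)"
    using m by (simp add: integral_completion)
  also have "\<dots> = integral {0<..} ?f"
    using set_lebesgue_integral_eq_integral(2)[OF ab] by (simp add: set_lebesgue_integral_def)
  finally show "(LINT s|lborel. indicator {0<..} s * ?f s) = 2 powr \<kappa> * Gamma \<kappa>"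
    using val by simp
qed

text \<open>The measure may be infinite, as the stable Levy measure is; integrability comes from the
  factor \<open>1 - v s\<close>, and \<open>H\<close> only has to be bounded on
  \<open>[0, 1]\<close>.\<close>

lemma integral_unit_interval_bound:
  fixes v :: "'a \<Rightarrow> real" and H :: "real \<Rightarrow> real"
  assumes int: "integrable M (\<lambda>s. 1 - v s)" and v: "\<And>s. v s \<in> {0..1}"
    and [measurable]: "v \<in> borel_measurable M" "H \<in> borel_measurable borel"
    and B: "\<And>x. x \<in> {0..1} \<Longrightarrow> \<bar>H x\<bar> \<le> B"
  shows "integrable M (\<lambda>s. (1 - v s) * H (v s))"
    and "\<bar>LINT s|M. (1 - v s) * H (v s)\<bar> \<le> B * (LINT s|M. 1 - v s)"
proof -
  have bnd: "\<bar>(1 - v s) * H (v s)\<bar> \<le> B * (1 - v s)" for s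
    using B[OF v[of s]] v[of s] by (simp add: abs_mult mult.commute mult_right_mono)
  show i: "integrable M (\<lambda>s. (1 - v s) * H (v s))"
  proof (rule Bochner_Integration.integrable_bound)
    show "integrable M (\<lambda>s. B * (1 - v s))" by (intro integrable_mult_right int)
    show "AE s in M. norm ((1 - v s) * H (v s)) \<le> norm (B * (1 - v s))"
      using bnd by (intro AE_I2) (auto intro: order_trans[OF _ abs_ge_self])
  qed measurable
  have "\<bar>LINT s|M. (1 - v s) * H (v s)\<bar> \<le> (LINT s|M. B * (1 - v s))"
    using int bnd by (intro order_trans[OF integral_abs_bound] integral_mono integrable_abs i integrable_mult_right)
  thus "\<bar>LINT s|M. (1 - v s) * H (v s)\<bar> \<le> B * (LINT s|M. 1 - v s)" by simp
qed

text \<open>A continuous \<open>H\<close> on \<open>{0..1}\<close> is a uniform limit of polynomials.\<close>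

lemma weighted_moment_convergence:
  fixes w :: "nat \<Rightarrow> 'a \<Rightarrow> real" and W :: "'b \<Rightarrow> real" and H :: "real \<Rightarrow> real"
  assumes M: "\<And>k. integrable M (\<lambda>s. 1 - w k s)" "\<And>k s. w k s \<in> {0..1}" "\<And>k. w k \<in> borel_measurable M"
    and N: "integrable N (\<lambda>s. 1 - W s)" "\<And>s. W s \<in> {0..1}" "W \<in> borel_measurable N"
    and H: "continuous_on {0..1} H" "H \<in> borel_measurable borel"
    and A: "\<forall>\<^sub>F k in sequentially. A k > 0"
    and lim: "\<And>m. (\<lambda>k. (LINT s|M. (1 - w k s) * w k s ^ m) / A k) \<longlonglongrightarrow> (LINT s|N. (1 - W s) * W s ^ m)"
  shows "(\<lambda>k. (LINT s|M. (1 - w k s) * H (w k s)) / A k) \<longlonglongrightarrow> (LINT s|N. (1 - W s) * H (W s))"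
proof (rule tendstoI)
  let ?m = "\<lambda>k. LINT s|M. 1 - w k s"
  fix e :: real assume e: "e > 0"
  define c where "c = (LINT s|N. 1 - W s)"
  have c0: "c \<ge> 0" unfolding c_def using N(2) by (intro Bochner_Integration.integral_nonneg) auto
  \<comment> \<open>The masses of \<open>1 - w k\<close> divided by \<open>A k\<close> converge to
    \<open>c\<close>, hence are eventually below \<open>c + 1\<close>. The error \<open>e\<close> is
    shared equally by three steps: replacing \<open>H\<close> by \<open>P\<close> under
    \<open>M\<close>, the convergence for \<open>P\<close>, and replacing \<open>P\<close> by
    \<open>H\<close> under \<open>N\<close>.\<close>
  define \<epsilon> where "\<epsilon> = e / (3 * (c + 1))"
  have "e / (3 * z) * z = e / 3" if "z \<noteq> 0" for z :: real using that by simp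
  from this[of "c + 1"] have \<epsilon>_eq: "\<epsilon> * (c + 1) = e / 3" using c0 unfolding \<epsilon>_def by simp
  have \<epsilon>: "\<epsilon> > 0" using e c0 by (simp add: \<epsilon>_def)
  obtain P where P: "real_polynomial_function P" "\<And>x. x \<in> {0..1} \<Longrightarrow> \<bar>H x - P x\<bar> < \<epsilon>"
    using Stone_Weierstrass_real_polynomial_function[OF _ H(1) \<epsilon>] by auto
  obtain a n where Peq: "P = (\<lambda>x. \<Sum>i\<le>n. a i * x ^ i)"
    using P(1) by (auto simp: real_polynomial_function_iff_sum)
  have Pm: "P \<in> borel_measurable borel" unfolding Peq by measurable
  let ?P = "\<lambda>k. LINT s|M. (1 - w k s) * P (w k s)"
  have "\<exists>BH. \<forall>x\<in>{0..1}. \<bar>H x\<bar> \<le> BH"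
    using compact_imp_bounded[OF compact_continuous_image[OF H(1) compact_Icc]] by (auto simp: bounded_iff)
  then obtain BH where BH: "\<And>x. x \<in> {0..1} \<Longrightarrow> \<bar>H x\<bar> \<le> BH" by blast
  have BP: "\<bar>P x\<bar> \<le> BH + \<epsilon>" if "x \<in> {0..1}" for x
    using BH[OF that] P(2)[OF that] by linarith
  have HP: "\<bar>(LINT s|L. (1 - v s) * H (v s)) - (LINT s|L. (1 - v s) * P (v s))\<bar> \<le> \<epsilon> * (LINT s|L. 1 - v s)"
    if v: "integrable L (\<lambda>s. 1 - v s)" "\<And>s. v s \<in> {0..1}" "v \<in> borel_measurable L" for L :: "'c measure" and v
  proof -
    have "(LINT s|L. (1 - v s) * H (v s)) - (LINT s|L. (1 - v s) * P (v s)) = (LINT s|L. (1 - v s) * (\<lambda>x. H x - P x) (v s))"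
      using integral_unit_interval_bound(1)[OF v H(2) BH] integral_unit_interval_bound(1)[OF v Pm BP]
      by (subst Bochner_Integration.integral_diff[symmetric]) (auto simp: right_diff_distrib)
    also have "\<bar>\<dots>\<bar> \<le> \<epsilon> * (LINT s|L. 1 - v s)"
      by (rule integral_unit_interval_bound(2)[OF v]) (use H(2) Pm P(2) in \<open>auto intro: less_imp_le\<close>)
    finally show ?thesis .
  qed
  have polyint: "(LINT s|L. (1 - v s) * P (v s)) = (\<Sum>i\<le>n. a i * (LINT s|L. (1 - v s) * v s ^ i))"
    if v: "integrable L (\<lambda>s. 1 - v s)" "\<And>s. v s \<in> {0..1}" "v \<in> borel_measurable L" for L :: "'c measure" and v
  proof -
    have i: "integrable L (\<lambda>s. (1 - v s) * v s ^ i)" for i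
      by (rule integral_unit_interval_bound(1)[OF v, of "\<lambda>x. x ^ i" 1]) (auto intro: power_le_one)
    have "(LINT s|L. (1 - v s) * P (v s)) = (LINT s|L. (\<Sum>i\<le>n. a i * ((1 - v s) * v s ^ i)))"
      by (simp add: Peq sum_distrib_left mult_ac)
    thus ?thesis using i by (simp add: Bochner_Integration.integral_sum)
  qed
  have "(\<lambda>k. \<Sum>i\<le>n. a i * ((LINT s|M. (1 - w k s) * w k s ^ i) / A k)) \<longlonglongrightarrow> (\<Sum>i\<le>n. a i * (LINT s|N. (1 - W s) * W s ^ i))"
    by (intro tendsto_intros lim)
  hence limP: "(\<lambda>k. ?P k / A k) \<longlonglongrightarrow> (LINT s|N. (1 - W s) * P (W s))"
    unfolding polyint[OF N] polyint[OF M(1,2,3)] by (simp add: sum_divide_distrib)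
  have "(\<lambda>k. ?m k / A k) \<longlonglongrightarrow> c"
    using lim[of 0] by (simp add: c_def)
  hence ev1: "\<forall>\<^sub>F k in sequentially. ?m k / A k < c + 1"
    by (rule order_tendstoD) simp
  have ev2: "\<forall>\<^sub>F k in sequentially. dist (?P k / A k) (LINT s|N. (1 - W s) * P (W s)) < e / 3"
    using limP e by (intro tendstoD) auto
  show "\<forall>\<^sub>F k in sequentially. dist ((LINT s|M. (1 - w k s) * H (w k s)) / A k) (LINT s|N. (1 - W s) * H (W s)) < e"
    using A ev1 ev2
  proof eventually_elim
    case (elim k)
    let ?IH = "LINT s|M. (1 - w k s) * H (w k s)" and ?IP = "LINT s|M. (1 - w k s) * P (w k s)"
    have "\<bar>?IH / A k - ?IP / A k\<bar> = \<bar>?IH - ?IP\<bar> / A k"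
      using elim(1) by (simp add: abs_divide flip: diff_divide_distrib)
    also have "\<dots> \<le> \<epsilon> * ?m k / A k"
      using elim(1) HP[OF M(1,2,3)] by (intro divide_right_mono) auto
    also have "\<dots> = \<epsilon> * (?m k / A k)" by simp
    also have "\<dots> < \<epsilon> * (c + 1)" using elim(2) \<epsilon> by (intro mult_strict_left_mono)
    also note \<epsilon>_eq
    finally have 1: "\<bar>?IH / A k - ?IP / A k\<bar> < e / 3" .
    have "\<bar>(LINT s|N. (1 - W s) * H (W s)) - (LINT s|N. (1 - W s) * P (W s))\<bar> \<le> \<epsilon> * c"
      unfolding c_def by (rule HP[OF N])
    also have "\<dots> \<le> \<epsilon> * (c + 1)" using \<epsilon> by (intro mult_left_mono) auto
    also note \<epsilon>_eq
    finally show ?case using 1 elim(3) unfolding dist_real_def by linarith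
  qed
qed

text \<open>In terms of \<open>s = - ln w\<close> this is
  \<open>exp (- 1 / (2 s)) s^(- d / 2) / (1 - exp (- s))\<close>: the Gaussian density at distance 1
  and time \<open>s\<close>, without its constants, divided by the weight. The value 0 at
  \<open>w = 0\<close> (infinite \<open>s\<close>) and \<open>w = 1\<close> (\<open>s = 0\<close>)
  is the limit there when \<open>d\<close> is positive.\<close>

definition mix_kernel :: "nat \<Rightarrow> real \<Rightarrow> real" where
  "mix_kernel d w = (if 0 < w \<and> w < 1 then exp (- 1 / (2 * (- ln w))) / sqrt (- ln w) ^ d / (1 - w) else 0)"

lemma mix_kernel_borel [measurable]: "mix_kernel d \<in> borel_measurable borel"
  unfolding mix_kernel_def[abs_def] by measurable

text \<open>At \<open>w = 0\<close> the factor \<open>s^(- d / 2)\<close> with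
  \<open>d \<ge> 1\<close> forces the limit 0. At \<open>w = 1\<close> the factor
  \<open>exp (- 1 / (2 s))\<close> beats all powers of \<open>s\<close>, including the pole of
  \<open>1 / (1 - exp (- s))\<close>.\<close>

lemma continuous_mix_kernel:
  assumes d: "d \<ge> 1"
  shows "continuous_on {0..1} (mix_kernel d)"
proof -
  let ?f = "\<lambda>w::real. exp (- 1 / (2 * (- ln w))) / sqrt (- ln w) ^ d / (1 - w)"
  have "continuous (at w within {0..1}) (mix_kernel d)" if w: "w \<in> {0..1}" for w
  proof -
    consider "w = 0" | "w = 1" | "0 < w" "w < 1" using w by fastforce
    thus ?thesis
    proof cases
      case 3
      have "isCont ?f w" using 3 by (intro continuous_intros) auto
      moreover have "\<forall>\<^sub>F x in nhds w. ?f x = mix_kernel d x"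
      proof -
        have "\<forall>\<^sub>F x in nhds w. x \<in> {0<..<1}" using 3 by (intro eventually_nhds_in_open) auto
        thus ?thesis by eventually_elim (simp add: mix_kernel_def)
      qed
      ultimately have "isCont (mix_kernel d) w" by (simp add: isCont_cong)
      thus ?thesis by (rule continuous_at_imp_continuous_at_within)
    next
      case 1
      have g: "((\<lambda>s::real. exp (- 1 / (2 * s)) / sqrt s ^ d) \<longlongrightarrow> 0) at_top"
        using d by real_asymp
      have l: "filterlim (\<lambda>w::real. - ln w) at_top (at_right 0)" by real_asymp
      have "((\<lambda>w::real. 1 - w) \<longlongrightarrow> 1 - 0) (at_right 0)" by (intro tendsto_intros)
      from tendsto_divide[OF filterlim_compose[OF g l] this] have "(?f \<longlongrightarrow> 0) (at_right 0)" by simp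
      moreover have "\<forall>\<^sub>F x in at_right 0. ?f x = mix_kernel d x"
        using eventually_at_right_real[of 0 1] by (auto elim!: eventually_mono simp: mix_kernel_def)
      ultimately have "(mix_kernel d \<longlongrightarrow> 0) (at_right 0)" by (rule Lim_transform_eventually)
      hence "(mix_kernel d \<longlongrightarrow> mix_kernel d 0) (at 0 within {0..1})"
        by (simp add: mix_kernel_def[of d 0] at_within_Icc_at_right)
      thus ?thesis by (simp add: 1 continuous_within)
    next
      case 2
      have g: "((\<lambda>s::real. exp (- 1 / (2 * s)) / sqrt s ^ d / (1 - exp (- s))) \<longlongrightarrow> 0) (at_right 0)"
        by real_asymp
      have l: "filterlim (\<lambda>w::real. - ln w) (at_right 0) (at_left 1)" by real_asymp
      have "((\<lambda>w. exp (- 1 / (2 * (- ln w))) / sqrt (- ln w) ^ d / (1 - exp (- (- ln w)))) \<longlongrightarrow> 0) (at_left 1)"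
        by (rule filterlim_compose[OF g l])
      moreover have "\<forall>\<^sub>F x in at_left 1. exp (- 1 / (2 * (- ln x))) / sqrt (- ln x) ^ d / (1 - exp (- (- ln x))) = mix_kernel d x"
        using eventually_at_left_real[of 0 1] by (auto elim!: eventually_mono simp: mix_kernel_def)
      ultimately have "(mix_kernel d \<longlongrightarrow> 0) (at_left 1)" by (rule Lim_transform_eventually)
      hence "(mix_kernel d \<longlongrightarrow> mix_kernel d 1) (at 1 within {0..1})"
        by (simp add: mix_kernel_def[of d 1] at_within_Icc_at_left)
      thus ?thesis by (simp add: 2 continuous_within)
    qed
  qed
  thus ?thesis by (simp add: continuous_on_eq_continuous_within)
qed

lemma mix_kernel_exp:
  "s > 0 \<Longrightarrow> (1 - exp (- s)) * mix_kernel d (exp (- s)) = exp (- 1 / (2 * s)) / sqrt s ^ d"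
  by (simp add: mix_kernel_def)

text \<open>The Levy measure of the \<open>\<beta>\<close>-stable subordinator; the constant makes
  its Laplace exponent exactly \<open>l powr \<beta>\<close>.\<close>

definition stable_levy :: "real \<Rightarrow> real measure" where
  "stable_levy \<beta> = density lborel (\<lambda>s. ennreal (indicator {0<..} s * (\<beta> / Gamma (1 - \<beta>) * s powr (- 1 - \<beta>))))"

lemma sets_stable_levy [simp, measurable_cong]: "sets (stable_levy \<beta>) = sets borel"
  by (simp add: stable_levy_def)

context
  fixes \<beta> :: real
  assumes \<beta>: "0 < \<beta>" "\<beta> < 1"
begin

lemma Gamma_one_minus_pos: "Gamma (1 - \<beta>) > 0"
  using \<beta> by (intro Gamma_real_pos) auto

lemma stable_levy_exponent:
  assumes "l \<ge> 0"
  shows "has_bochner_integral (stable_levy \<beta>) (\<lambda>s. indicator {0<..} s * (1 - exp (- (l * s)))) (l powr \<beta>)"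
proof (cases "l = 0")
  case False
  hence l: "l > 0" using assms by simp
  have nn: "0 \<le> indicator {0<..} s * (1 - exp (- (l * s)))" for s using l by (auto simp: indicator_def)
  have "(\<integral>\<^sup>+s. ennreal (indicator {0<..} s * (1 - exp (- (l * s)))) \<partial>stable_levy \<beta>)
     = (\<integral>\<^sup>+s. ennreal (\<beta> / Gamma (1 - \<beta>)) * ennreal (indicator {0<..} s * ((1 - exp (- (l * s))) * s powr (- 1 - \<beta>))) \<partial>lborel)"
    unfolding stable_levy_def
    using \<beta> Gamma_one_minus_pos l
    by (subst nn_integral_density) (auto intro!: nn_integral_cong simp: indicator_def ennreal_mult[symmetric] mult_ac)
  also have "\<dots> = ennreal (\<beta> / Gamma (1 - \<beta>)) * ennreal (Gamma (1 - \<beta>) / \<beta> * l powr \<beta>)"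
    by (subst nn_integral_cmult) (use nn_integral_one_minus_exp_powr[OF \<beta> l] in auto)
  also have "\<dots> = ennreal (l powr \<beta>)"
    using \<beta> Gamma_one_minus_pos order.strict_implies_not_eq[OF Gamma_one_minus_pos]
    by (subst ennreal_mult[symmetric]) simp_all
  finally have E: "(\<integral>\<^sup>+s. ennreal (indicator {0<..} s * (1 - exp (- (l * s)))) \<partial>stable_levy \<beta>) = ennreal (l powr \<beta>)" .
  show ?thesis
    by (rule has_bochner_integral_nn_integral[OF _ _ _ E]) (use nn in auto)
qed (simp add: has_bochner_integral_zero)

lemma AE_stable_levy_pos: "AE s in stable_levy \<beta>. s > 0"
  unfolding stable_levy_def by (subst AE_density) (auto simp: indicator_def)

text \<open>The maximum keeps the value in \<open>[0, 1]\<close> for negative \<open>s\<close> too,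
  because \<open>weighted_moment_convergence\<close> asks for this range at every point and not only
  almost everywhere.\<close>

abbreviation "expneg s \<equiv> exp (- max 0 s)"

text \<open>\<open>(1 - exp (- s)) exp (- m s)\<close> is the difference of
  \<open>1 - exp (- (m + 1) s)\<close> and \<open>1 - exp (- m s)\<close>, so each moment is a
  difference of two Laplace exponents.\<close>

lemma stable_levy_moment:
  "integrable (stable_levy \<beta>) (\<lambda>s. 1 - expneg s)"
  "(LINT s|stable_levy \<beta>. (1 - expneg s) * expneg s ^ m) = real (m + 1) powr \<beta> - real m powr \<beta>"
proof -
  have e1: "AE s in stable_levy \<beta>. indicator {0<..} s * (1 - exp (- (1 * s))) = 1 - expneg s"
    using AE_stable_levy_pos by eventually_elim auto
  have i1: "integrable (stable_levy \<beta>) (\<lambda>s. indicator {0<..} s * (1 - exp (- (l * s))))" if "l \<ge> 0" for l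
    using stable_levy_exponent[OF that] by (rule integrable.intros)
  show "integrable (stable_levy \<beta>) (\<lambda>s. 1 - expneg s)"
    by (rule integrable_cong_AE_imp[OF i1[of 1]]) (use e1 in auto)
  have "(LINT s|stable_levy \<beta>. (1 - expneg s) * expneg s ^ m)
     = (LINT s|stable_levy \<beta>. indicator {0<..} s * (1 - exp (- (real (m + 1) * s))) - indicator {0<..} s * (1 - exp (- (real m * s))))"
  proof (rule integral_cong_AE)
    show "AE s in stable_levy \<beta>. (1 - expneg s) * expneg s ^ m = indicator {0<..} s * (1 - exp (- (real (m + 1) * s))) - indicator {0<..} s * (1 - exp (- (real m * s)))"
      using AE_stable_levy_pos
    proof eventually_elim
      case (elim s)
      have "exp (- s) ^ m = exp (- (real m * s))" using exp_of_nat_mult[of m "- s"] by simp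
      moreover have "exp (- (real (m + 1) * s)) = exp (- (real m * s)) * exp (- s)"
        by (simp add: algebra_simps flip: exp_add)
      ultimately show ?case using elim by (simp add: algebra_simps)
    qed
  qed auto
  also have "\<dots> = real (m + 1) powr \<beta> - real m powr \<beta>"
    using has_bochner_integral_integral_eq[OF stable_levy_exponent[of "real (m + 1)"]]
      has_bochner_integral_integral_eq[OF stable_levy_exponent[of "real m"]]
    by (subst Bochner_Integration.integral_diff[OF i1 i1]) (simp_all del: of_nat_add)
  finally show "(LINT s|stable_levy \<beta>. (1 - expneg s) * expneg s ^ m) = real (m + 1) powr \<beta> - real m powr \<beta>" .
qed

text \<open>The weight cancels the denominator of \<open>mix_kernel\<close>; what remains is
  \<open>inverse_gamma_integral\<close> at \<open>d / 2 + \<beta>\<close>. This is the limit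
  constant before the prefactor of the Gaussian density is included.\<close>

lemma stable_levy_mix_kernel:
  "(LINT s|stable_levy \<beta>. (1 - expneg s) * mix_kernel d (expneg s))
     = \<beta> / Gamma (1 - \<beta>) * 2 powr (real d / 2 + \<beta>) * Gamma (real d / 2 + \<beta>)"
proof -
  let ?\<kappa> = "real d / 2 + \<beta>"
  have "(LINT s|stable_levy \<beta>. (1 - expneg s) * mix_kernel d (expneg s))
      = (LINT s|lborel. (indicator {0<..} s * (\<beta> / Gamma (1 - \<beta>) * s powr (- 1 - \<beta>))) *\<^sub>R ((1 - expneg s) * mix_kernel d (expneg s)))"
    unfolding stable_levy_def using \<beta> Gamma_one_minus_pos
    by (subst integral_density) (auto simp: indicator_def)
  also have "\<dots> = (LINT s|lborel. (\<beta> / Gamma (1 - \<beta>)) * (indicator {0<..} s * (s powr (- ?\<kappa> - 1) * exp (- 1 / (2 * s)))))"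
  proof (rule Bochner_Integration.integral_cong[OF refl])
    fix s :: real
    show "(indicator {0<..} s * (\<beta> / Gamma (1 - \<beta>) * s powr (- 1 - \<beta>))) *\<^sub>R ((1 - expneg s) * mix_kernel d (expneg s))
       = (\<beta> / Gamma (1 - \<beta>)) * (indicator {0<..} s * (s powr (- ?\<kappa> - 1) * exp (- 1 / (2 * s))))"
    proof (cases "s > 0")
      case True
      have sq: "sqrt s ^ d = s powr (real d / 2)"
        using True by (simp add: powr_half_sqrt[symmetric] powr_realpow[symmetric] powr_powr)
      have ex: "- ?\<kappa> - 1 = - 1 - \<beta> - real d / 2" by simp
      have p: "s powr (- ?\<kappa> - 1) = s powr (- 1 - \<beta>) / sqrt s ^ d"
        unfolding sq ex by (rule powr_diff)
      have m: "(1 - expneg s) * mix_kernel d (expneg s) = exp (- 1 / (2 * s)) / sqrt s ^ d"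
        using mix_kernel_exp[OF True] True by simp
      have "(1 * (A * B)) *\<^sub>R (E / D) = A * (1 * (B / D * E))" for A B D E :: real by simp
      thus ?thesis unfolding p m using True by (simp only: indicator_simps greaterThan_iff)
    qed simp
  qed
  also have "\<dots> = \<beta> / Gamma (1 - \<beta>) * (2 powr ?\<kappa> * Gamma ?\<kappa>)"
    using \<beta> inverse_gamma_integral(2)[of ?\<kappa>] by simp
  finally show ?thesis by simp
qed

end

section \<open>Linear changes of variables and the Gaussian Fourier transform\<close>

lemma borel_measurable_vec_lambda:
  fixes f :: "'a \<Rightarrow> 'd::finite \<Rightarrow> real"
  assumes "\<And>i. (\<lambda>x. f x i) \<in> borel_measurable M"
  shows "(\<lambda>x. (\<chi> i. f x i)) \<in> borel_measurable M"
  using assms by (subst borel_measurable_euclidean_space) (auto simp: Basis_vec_def inner_axis)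

text \<open>Both measures agree on boxes. The product form opens the way to integrating coordinate
  by coordinate.\<close>

lemma lborel_vec_eq_PiM:
  "(lborel :: (real ^ 'd::finite) measure) = distr (\<Pi>\<^sub>M i\<in>UNIV. lborel) borel (\<lambda>f. \<chi> i. f i)"
proof (rule lborel_eqI)
  interpret product_sigma_finite "\<lambda>_::'d. lborel :: real measure" ..
  have meas[measurable]: "(\<lambda>f. (\<chi> i. f i) :: real^'d) \<in> borel_measurable (\<Pi>\<^sub>M i\<in>(UNIV::'d set). lborel)"
    by (rule borel_measurable_vec_lambda) simp
  fix l u :: "real ^ 'd"
  assume le: "\<And>b. b \<in> Basis \<Longrightarrow> l \<bullet> b \<le> u \<bullet> b"
  have lei: "l $ i \<le> u $ i" for i
    using le[of "axis i 1"] by (simp add: inner_axis axis_in_Basis_iff)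
  have "(\<lambda>f. \<chi> i. f i) -` box l u \<inter> space (\<Pi>\<^sub>M i\<in>UNIV. lborel) = (\<Pi>\<^sub>E i\<in>UNIV. {l $ i<..<u $ i})"
    by (auto simp: space_PiM mem_box_cart PiE_def Pi_iff)
  hence "emeasure (distr (\<Pi>\<^sub>M i\<in>UNIV. lborel) borel (\<lambda>f. \<chi> i. f i)) (box l u)
     = emeasure (\<Pi>\<^sub>M i\<in>UNIV. lborel) (\<Pi>\<^sub>E i\<in>UNIV. {l $ i<..<u $ i})"
    by (simp add: emeasure_distr)
  also have "\<dots> = (\<Prod>i\<in>UNIV. ennreal (u $ i - l $ i))"
    using lei by (subst emeasure_PiM) auto
  also have "\<dots> = ennreal (\<Prod>i\<in>UNIV. (u $ i - l $ i))"
    using lei by (simp add: prod_ennreal)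
  also have "(\<Prod>i\<in>UNIV. (u $ i - l $ i)) = (\<Prod>b\<in>Basis. (u - l) \<bullet> b)"
    by (simp add: Basis_vec_def UNION_singleton_eq_range prod.reindex inj_on_def axis_eq_axis inner_axis)
  finally show "emeasure (distr (\<Pi>\<^sub>M i\<in>UNIV. lborel) borel (\<lambda>f. \<chi> i. f i)) (box l u)
      = (\<Prod>b\<in>Basis. (u - l) \<bullet> b)" .
qed simp

lemma lborel_integral_vec_prod:
  fixes f :: "'d::finite \<Rightarrow> real \<Rightarrow> 'b::{real_normed_field,banach,second_countable_topology}"
  assumes "\<And>i. integrable lborel (f i)"
  shows "integral\<^sup>L lborel (\<lambda>x::real^'d. \<Prod>i\<in>UNIV. f i (x $ i)) = (\<Prod>i\<in>UNIV. integral\<^sup>L lborel (f i))"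
    and "integrable lborel (\<lambda>x::real^'d. \<Prod>i\<in>UNIV. f i (x $ i))"
proof -
  interpret product_sigma_finite "\<lambda>_::'d. lborel :: real measure" ..
  have meas[measurable]: "(\<lambda>f. (\<chi> i. f i) :: real^'d) \<in> borel_measurable (\<Pi>\<^sub>M i\<in>(UNIV::'d set). lborel)"
    by (rule borel_measurable_vec_lambda) simp
  have [measurable]: "f i \<in> borel_measurable borel" for i
    using borel_measurable_integrable[OF assms[of i]] by simp
  have vec_nth_meas[measurable]: "(\<lambda>x::real^'d. x $ i) \<in> borel_measurable borel" for i
    by (intro borel_measurable_continuous_onI continuous_intros)
  show "integral\<^sup>L lborel (\<lambda>x::real^'d. \<Prod>i\<in>UNIV. f i (x $ i)) = (\<Prod>i\<in>UNIV. integral\<^sup>L lborel (f i))"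
    by (subst lborel_vec_eq_PiM, subst integral_distr) (auto simp: product_integral_prod assms)
  show "integrable lborel (\<lambda>x::real^'d. \<Prod>i\<in>UNIV. f i (x $ i))"
    by (subst lborel_vec_eq_PiM, subst integrable_distr_eq) (auto simp: product_integrable_prod assms)
qed

text \<open>Induction over elementary maps: compositions, maps with a vanishing coordinate, diagonal
  maps, transpositions and shears. The condition on the determinant is carried inside the induction,
  so that singular maps are vacuous and a nonsingular composition has two nonsingular
  factors.\<close>

lemma nn_integral_lborel_linear:
  fixes f :: "real ^ 'd::finite \<Rightarrow> real ^ 'd"
  assumes "linear f" "det (matrix f) \<noteq> 0" "g \<in> borel_measurable borel"
  shows "(\<integral>\<^sup>+x. g x \<partial>lborel) = ennreal \<bar>det (matrix f)\<bar> * (\<integral>\<^sup>+x. g (f x) \<partial>lborel)"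
proof -
  interpret product_sigma_finite "\<lambda>_::'d. lborel :: real measure" ..
  have meas[measurable]: "(\<lambda>f. (\<chi> i. f i) :: real^'d) \<in> borel_measurable (\<Pi>\<^sub>M i\<in>(UNIV::'d set). lborel)"
    by (rule borel_measurable_vec_lambda) simp
  have mlin: "f \<in> borel_measurable borel" if "linear f" for f :: "real^'d \<Rightarrow> real^'d"
    using that by (intro borel_measurable_continuous_onI linear_continuous_on linear_linear[THEN iffD2])
  have "\<forall>g::real^'d \<Rightarrow> ennreal. g \<in> borel_measurable borel \<longrightarrow> det (matrix f) \<noteq> 0 \<longrightarrow>
     (\<integral>\<^sup>+x. g x \<partial>lborel) = ennreal \<bar>det (matrix f)\<bar> * (\<integral>\<^sup>+x. g (f x) \<partial>lborel)"
  proof (rule induct_linear_elementary[OF assms(1)], goal_cases)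
    case (1 f h)
    show ?case
    proof (intro allI impI)
      fix g :: "real^'d \<Rightarrow> ennreal" assume g[measurable]: "g \<in> borel_measurable borel"
      assume "det (matrix (f \<circ> h)) \<noteq> 0"
      have mc: "det (matrix (f \<circ> h)) = det (matrix f) * det (matrix h)"
        using matrix_compose[OF 1(2,1)] by (simp add: det_mul)
      have nz: "det (matrix f) \<noteq> 0" "det (matrix h) \<noteq> 0" using \<open>det (matrix (f \<circ> h)) \<noteq> 0\<close> unfolding mc by simp_all
      note mlin[OF 1(1), measurable]
      have "(\<integral>\<^sup>+x. g x \<partial>lborel) = ennreal \<bar>det (matrix f)\<bar> * (\<integral>\<^sup>+x. g (f x) \<partial>lborel)"
        using 1(3) nz(1) g by blast
      also have "(\<integral>\<^sup>+x. g (f x) \<partial>lborel) = ennreal \<bar>det (matrix h)\<bar> * (\<integral>\<^sup>+x. g (f (h x)) \<partial>lborel)"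
        by (rule 1(4)[rule_format]) (use nz in simp_all)
      finally show "(\<integral>\<^sup>+x. g x \<partial>lborel) = ennreal \<bar>det (matrix (f \<circ> h))\<bar> * (\<integral>\<^sup>+x. g ((f \<circ> h) x) \<partial>lborel)"
        by (simp add: mc abs_mult ennreal_mult mult.assoc)
    qed
  next
    case (2 f i)
    have "\<not> surj f"
    proof
      assume "surj f"
      then obtain x where "f x = axis i 1" by (metis surjD)
      with 2(2)[of x] show False by simp
    qed
    hence "det (matrix f) = 0"
      using det_nz_iff_inj[OF 2(1)] linear_injective_imp_surjective[OF 2(1)] by auto
    thus ?case by simp
  next
    case (3 c)
    let ?f = "\<lambda>x::real^'d. \<chi> i. c i * x $ i"
    have d: "det (matrix ?f) = (\<Prod>i\<in>UNIV. c i)"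
      by (simp add: matrix_def det_diagonal axis_def)
    show ?case
    proof (intro allI impI)
      fix g :: "real^'d \<Rightarrow> ennreal" assume g[measurable]: "g \<in> borel_measurable borel"
      assume nz: "det (matrix ?f) \<noteq> 0"
      have nzc: "c i \<noteq> 0" for i using nz unfolding d by auto
      \<comment> \<open>The scaling rule for \<open>lborel\<close> wants factors indexed by basis
        vectors; the description operator recovers the coordinate of a given axis.\<close>
      define c' where "c' = (\<lambda>b::real^'d. c (THE i. b = axis i 1))"
      have c': "c' (axis i 1) = c i" for i
        by (auto simp: c'_def axis_eq_axis)
      have feq: "0 + (\<Sum>j\<in>Basis. (c' j * (x \<bullet> j)) *\<^sub>R j) = ?f x" for x
      proof -
        have "(\<Sum>j\<in>Basis. (c' j * (x \<bullet> j)) *\<^sub>R j) = (\<Sum>i\<in>UNIV. (c i * x $ i) *\<^sub>R axis i 1)"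
          by (simp add: Basis_vec_def UNION_singleton_eq_range sum.reindex inj_on_def axis_eq_axis inner_axis c')
        also have "\<dots> = ?f x"
          by (simp add: vec_eq_iff axis_def if_distrib cong: if_cong)
        finally show ?thesis by simp
      qed
      have "lborel = density (distr lborel borel (\<lambda>x. 0 + (\<Sum>j\<in>Basis. (c' j * (x \<bullet> j)) *\<^sub>R j)))
             (\<lambda>_. (\<Prod>j\<in>Basis. \<bar>c' j\<bar>))"
        by (rule lborel_affine_euclidean) (auto simp: Basis_vec_def c' nzc)
      also have "(\<Prod>j\<in>Basis. \<bar>c' j\<bar>) = \<bar>det (matrix ?f)\<bar>"
        by (simp add: d Basis_vec_def UNION_singleton_eq_range prod.reindex inj_on_def axis_eq_axis c' abs_prod)
      finally have E: "lborel = density (distr lborel borel ?f) (\<lambda>_. ennreal \<bar>det (matrix ?f)\<bar>)"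
        unfolding feq .
      have [measurable]: "?f \<in> borel_measurable borel"
        by (rule mlin) (auto intro!: linearI simp: vec_eq_iff algebra_simps)
      show "(\<integral>\<^sup>+x. g x \<partial>lborel) = ennreal \<bar>det (matrix ?f)\<bar> * (\<integral>\<^sup>+x. g (?f x) \<partial>lborel)"
        by (subst E) (simp add: nn_integral_density nn_integral_distr nn_integral_cmult)
    qed
  next
    case (4 m n)
    let ?f = "\<lambda>x::real^'d. \<chi> i. x $ Transposition.transpose m n i"
    have lin: "linear ?f"
      by (rule linearI) (simp_all add: vec_eq_iff)
    have "matrix ?f = transpose(\<chi> i j. mat 1 $ i $ Transposition.transpose m n j)"
      by (auto simp: vec_eq_iff transpose_def axis_def mat_def matrix_def)
    then have d: "\<bar>det (matrix ?f)\<bar> = 1"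
      by (simp add: det_permute_columns permutes_swap_id sign_swap_id abs_mult)
    note mlin[OF lin, measurable]
    have E: "lborel = distr lborel borel ?f"
    proof (rule lborel_eqI)
      fix l u :: "real^'d" assume le: "\<And>b. b \<in> Basis \<Longrightarrow> l \<bullet> b \<le> u \<bullet> b"
      have lei: "l $ i \<le> u $ i" for i
        using le[of "axis i 1"] by (simp add: inner_axis axis_in_Basis_iff)
      have "?f -` box l u = box (?f l) (?f u)"
        by (auto simp: mem_box_cart) (metis transpose_involutory)+
      hence "emeasure (distr lborel borel ?f) (box l u) = emeasure lborel (box (?f l) (?f u))"
        by (simp add: emeasure_distr)
      also have "\<dots> = ennreal (\<Prod>b\<in>Basis. (?f u - ?f l) \<bullet> b)"
        by (rule emeasure_lborel_box) (auto simp: Basis_vec_def inner_axis lei)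
      also have "(\<Prod>b\<in>Basis. (?f u - ?f l) \<bullet> b) = (\<Prod>i\<in>UNIV. (u - l) $ (Transposition.transpose m n i))"
        by (simp add: Basis_vec_def UNION_singleton_eq_range prod.reindex inj_on_def axis_eq_axis inner_axis)
      also have "\<dots> = (\<Prod>i\<in>UNIV. (u - l) $ i)"
        using prod.permute[OF permutes_swap_id, where S=UNIV and g="\<lambda>i. (u - l)$i", of m n]
        by (simp add: o_def)
      also have "\<dots> = (\<Prod>b\<in>Basis. (u - l) \<bullet> b)"
        by (simp add: Basis_vec_def UNION_singleton_eq_range prod.reindex inj_on_def axis_eq_axis inner_axis)
      finally show "emeasure (distr lborel borel ?f) (box l u) = (\<Prod>b\<in>Basis. (u - l) \<bullet> b)" .
    qed simp
    show ?case
      unfolding d by (subst E) (auto simp: nn_integral_distr)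
  next
    case (5 m n)
    let ?f = "\<lambda>x::real^'d. \<chi> i. if i = m then x $ m + x $ n else x $ i"
    have lin: "linear ?f"
      by (rule linearI) (auto simp: vec_eq_iff algebra_simps)
    have "matrix ?f = (\<chi> k. if k = m then row m (mat 1) + 1 *s row n (mat 1) else row k (mat 1))"
      using 5 by (auto simp: vec_eq_iff axis_def mat_def matrix_def row_def)
    then have d: "det (matrix ?f) = 1"
      by (simp only: det_row_operation[OF 5] det_I)
    note mlin[OF lin, measurable]
    show ?case
    proof (intro allI impI)
      fix g :: "real^'d \<Rightarrow> ennreal" assume g[measurable]: "g \<in> borel_measurable borel"
      let ?I = "UNIV - {m}"
      have U: "UNIV = insert m ?I" by auto
      have meas': "(\<lambda>f. (\<chi> i. f i) :: real^'d) \<in> borel_measurable (\<Pi>\<^sub>M i\<in>insert m ?I. lborel)"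
        using meas U by simp
      have G: "(\<integral>\<^sup>+x. h x \<partial>lborel) = (\<integral>\<^sup>+ w. \<integral>\<^sup>+y. h (\<chi> i. (w(m := y)) i) \<partial>lborel \<partial>(\<Pi>\<^sub>M i\<in>?I. lborel))"
        if [measurable]: "h \<in> borel_measurable borel" for h :: "real^'d \<Rightarrow> ennreal"
      proof -
        have "(\<integral>\<^sup>+x. h x \<partial>lborel) = (\<integral>\<^sup>+w. h (\<chi> i. w i) \<partial>(\<Pi>\<^sub>M i\<in>UNIV. lborel))"
          by (subst lborel_vec_eq_PiM) (simp add: nn_integral_distr)
        also have "\<dots> = (\<integral>\<^sup>+w. h (\<chi> i. w i) \<partial>(\<Pi>\<^sub>M i\<in>insert m ?I. lborel))"
          using U by simp
        also have "\<dots> = (\<integral>\<^sup>+ w. \<integral>\<^sup>+y. h (\<chi> i. (w(m := y)) i) \<partial>lborel \<partial>(\<Pi>\<^sub>M i\<in>?I. lborel))"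
          using meas' by (intro product_nn_integral_insert) auto
        finally show ?thesis .
      qed
      \<comment> \<open>With all coordinates other than \<open>m\<close> frozen, the shear is a
        translation of the coordinate \<open>m\<close> by \<open>w n\<close>, under which
        one-dimensional Lebesgue measure is invariant.\<close>
      have inner: "(\<integral>\<^sup>+y. g (?f (\<chi> i. (w(m := y)) i)) \<partial>lborel) = (\<integral>\<^sup>+y. g (\<chi> i. (w(m := y)) i) \<partial>lborel)" for w
      proof -
        have mg: "(\<lambda>y. g (\<chi> i. (w(m := y)) i)) \<in> borel_measurable borel"
        proof -
          have "(\<lambda>y. (\<chi> i. (w(m := y)) i)) \<in> borel_measurable (borel :: real measure)"
            by (rule borel_measurable_vec_lambda) (simp add: fun_upd_def)
          thus ?thesis by measurable
        qed
        have "?f (\<chi> i. (w(m := y)) i) = (\<chi> i. (w(m := w n + 1 * y)) i)" for y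
          using 5 by (auto simp: vec_eq_iff)
        hence "(\<integral>\<^sup>+y. g (?f (\<chi> i. (w(m := y)) i)) \<partial>lborel) = (\<integral>\<^sup>+y. g (\<chi> i. (w(m := w n + 1 * y)) i) \<partial>lborel)"
          by (simp only:)
        also have "\<dots> = (\<integral>\<^sup>+y. g (\<chi> i. (w(m := y)) i) \<partial>lborel)"
          using nn_integral_real_affine[OF mg, of 1 "w n"] by (simp only: abs_one ennreal_1 mult_1_left)
        finally show ?thesis .
      qed
      have "(\<integral>\<^sup>+x. g (?f x) \<partial>lborel) = (\<integral>\<^sup>+x. g x \<partial>lborel)"
        unfolding G[OF g] G[of "\<lambda>x. g (?f x)", OF measurable_compose[OF mlin[OF lin] g]] inner ..
      thus "(\<integral>\<^sup>+x. g x \<partial>lborel) = ennreal \<bar>det (matrix ?f)\<bar> * (\<integral>\<^sup>+x. g (?f x) \<partial>lborel)"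
        by (simp add: d)
    qed
  qed
  thus ?thesis using assms by blast
qed

lemma lborel_linear:
  fixes f :: "real ^ 'd::finite \<Rightarrow> real ^ 'd"
  assumes "linear f" "det (matrix f) \<noteq> 0"
  shows "lborel = density (distr lborel borel f) (\<lambda>_. ennreal \<bar>det (matrix f)\<bar>)"
proof (rule measure_eqI)
  have [measurable]: "f \<in> borel_measurable borel"
    using assms(1) by (intro borel_measurable_continuous_onI linear_continuous_on linear_linear[THEN iffD2])
  fix A assume "A \<in> sets (lborel :: (real^'d) measure)"
  hence [measurable]: "A \<in> sets borel" by simp
  show "emeasure lborel A = emeasure (density (distr lborel borel f) (\<lambda>_. ennreal \<bar>det (matrix f)\<bar>)) A"
    using nn_integral_lborel_linear[OF assms, of "indicator A"]
      nn_integral_distr[of f lborel borel "indicator A"]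
    by (simp add: emeasure_density nn_integral_cmult)
qed simp

text \<open>The columns of \<open>V\<close> are an orthonormal basis for the inner product defined
  by \<open>Q\<close>. The basis grows one index at a time: fewer than \<open>CARD('d)\<close>
  vectors \<open>Q *v f i\<close> span a proper subspace, and a nonzero vector orthogonal to it can
  be normalised and added.\<close>

lemma orthonormalizing_matrix_exists:
  fixes Q :: "real ^ 'd::finite ^ 'd"
  assumes sym: "transpose Q = Q" and pos: "\<And>u. u \<noteq> 0 \<Longrightarrow> (Q *v u) \<bullet> u > 0"
  shows "\<exists>V::real^'d^'d. transpose V ** Q ** V = mat 1"
proof -
  have symB: "(Q *v u) \<bullet> v = (Q *v v) \<bullet> u" for u v
    by (metis dot_lmul_matrix inner_commute sym transpose_matrix_vector)
  have "\<exists>f::'d \<Rightarrow> real^'d. \<forall>i\<in>S. \<forall>j\<in>S. (Q *v f i) \<bullet> f j = (if i = j then 1 else 0)" for S :: "'d set"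
  proof (induction S rule: finite_induct[OF finite])
    case 1 show ?case by simp
  next
    case (2 k S)
    then obtain f :: "'d \<Rightarrow> real^'d" where f: "\<And>i j. i \<in> S \<Longrightarrow> j \<in> S \<Longrightarrow> (Q *v f i) \<bullet> f j = (if i = j then 1 else 0)"
      by blast
    let ?T = "(\<lambda>i. Q *v f i) ` S"
    have "dim ?T \<le> card ?T" by (rule dim_le_card') simp
    also have "\<dots> \<le> card S" by (rule card_image_le) simp
    also have "\<dots> < CARD('d)" using 2 by (metis UNIV_I finite psubset_card_mono top.not_eq_extremum)
    finally have "dim ?T < DIM(real^'d)" by simp
    then obtain x where x: "x \<noteq> 0" "\<And>y. y \<in> span ?T \<Longrightarrow> orthogonal x y"
      using orthogonal_to_subspace_exists by blast
    have xo: "(Q *v f i) \<bullet> x = 0" if "i \<in> S" for i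
      using x(2)[of "Q *v f i"] that by (simp add: span_base orthogonal_def inner_commute)
    define c where "c = (Q *v x) \<bullet> x"
    have c: "c > 0" using pos[OF x(1)] by (simp add: c_def)
    define g where "g = f(k := (1 / sqrt c) *\<^sub>R x)"
    have gk: "(Q *v g k) \<bullet> g k = 1"
      using c by (simp add: g_def matrix_vector_mult_scaleR flip: c_def)
    have "(Q *v g i) \<bullet> g k = 0" if "i \<in> S" for i
      using xo[OF that] that 2 by (auto simp: g_def)
    moreover have "(Q *v g k) \<bullet> g i = 0" if "i \<in> S" for i
      using calculation[OF that] symB by metis
    moreover have "(Q *v g i) \<bullet> g j = (if i = j then 1 else 0)" if "i \<in> S" "j \<in> S" for i j
      using f[OF that] that 2 by (auto simp: g_def)
    ultimately have "\<forall>i\<in>insert k S. \<forall>j\<in>insert k S. (Q *v g i) \<bullet> g j = (if i = j then 1 else 0)"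
      using gk 2 by auto
    thus ?case by blast
  qed
  from this[of UNIV] obtain f :: "'d \<Rightarrow> real^'d"
    where f: "\<And>i j. (Q *v f i) \<bullet> f j = (if i = j then 1 else 0)" by auto
  define V :: "real^'d^'d" where "V = (\<chi> i j. f j $ i)"
  have "(transpose V ** (Q ** V)) $ i $ j = (Q *v f j) \<bullet> f i" for i j
    by (simp add: V_def transpose_def matrix_matrix_mult_def matrix_vector_mult_def inner_vec_def mult.commute)
  hence "transpose V ** (Q ** V) = mat 1"
    by (auto simp: vec_eq_iff f mat_def)
  thus ?thesis by (auto simp: matrix_mul_assoc)
qed

section \<open>Fourier transform of Gaussian densities\<close>

lemma std_gaussian_fourier_real:
  fixes z :: real
  shows "integrable lborel (\<lambda>t. exp (- t\<^sup>2 / 2) *\<^sub>R cis (- (t * z)))"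
    and "(LINT t|lborel. exp (- t\<^sup>2 / 2) *\<^sub>R cis (- (t * z))) = of_real (sqrt (2 * pi) * exp (- z\<^sup>2 / 2))"
proof -
  have [measurable]: "cis \<in> borel_measurable borel"
    by (intro borel_measurable_continuous_onI continuous_intros)
  have eq: "exp (- t\<^sup>2 / 2) *\<^sub>R cis (- (t * z)) = sqrt (2 * pi) *\<^sub>R (std_normal_density t *\<^sub>R iexp (- z * t))" for t
    by (simp add: std_normal_density_def cis_conv_exp mult.commute)
  have "integrable lborel (\<lambda>t. std_normal_density t)"
    using integrable_normal_density[of 1 0] by simp
  hence int: "integrable lborel (\<lambda>t. std_normal_density t *\<^sub>R iexp (- z * t))"
    by (rule Bochner_Integration.integrable_bound) (auto simp: norm_mult)
  show "integrable lborel (\<lambda>t. exp (- t\<^sup>2 / 2) *\<^sub>R cis (- (t * z)))"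
    unfolding eq using int by (rule integrable_scaleR_right)
  have "(LINT t|lborel. std_normal_density t *\<^sub>R iexp (- z * t)) = char std_normal_distribution (- z)"
    unfolding char_def by (subst integral_density) auto
  also have "\<dots> = of_real (exp (- z\<^sup>2 / 2))"
    by (simp add: char_std_normal_distribution)
  finally show "(LINT t|lborel. exp (- t\<^sup>2 / 2) *\<^sub>R cis (- (t * z))) = of_real (sqrt (2 * pi) * exp (- z\<^sup>2 / 2))"
    unfolding eq integral_scaleR_right by (simp add: scaleR_conv_of_real)
qed

lemma cis_sum: "finite A \<Longrightarrow> cis (\<Sum>i\<in>A. f i) = (\<Prod>i\<in>A. cis (f i))"
  by (induction A rule: finite_induct) (auto simp: cis_mult[symmetric])

lemma std_gaussian_fourier:
  fixes z :: "real ^ 'd::finite"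
  shows "integrable lborel (\<lambda>w. exp (- (w \<bullet> w) / 2) *\<^sub>R cis (- (w \<bullet> z)))"
    and "(LINT w|lborel. exp (- (w \<bullet> w) / 2) *\<^sub>R cis (- (w \<bullet> z)))
      = of_real (sqrt (2 * pi) ^ CARD('d) * exp (- (z \<bullet> z) / 2))"
proof -
  have eq: "exp (- (w \<bullet> w) / 2) *\<^sub>R cis (- (w \<bullet> z)) = (\<Prod>i\<in>UNIV. exp (- (w $ i)\<^sup>2 / 2) *\<^sub>R cis (- (w $ i * z $ i)))"
    for w :: "real^'d"
  proof -
    have "cis (- (w \<bullet> z)) = (\<Prod>i\<in>UNIV. cis (- (w $ i * z $ i)))"
      by (simp add: inner_vec_def cis_sum flip: sum_negf)
    moreover have "exp (- (w \<bullet> w) / 2) = (\<Prod>i\<in>UNIV. exp (- (w $ i)\<^sup>2 / 2))"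
      by (simp add: inner_vec_def power2_eq_square exp_sum[symmetric] sum_negf sum_divide_distrib[symmetric])
    ultimately show ?thesis
      by (simp add: scaleR_conv_of_real prod.distrib)
  qed
  show "integrable lborel (\<lambda>w. exp (- (w \<bullet> w) / 2) *\<^sub>R cis (- (w \<bullet> z)))"
    unfolding eq by (rule lborel_integral_vec_prod) (rule std_gaussian_fourier_real)
  have "(LINT w|lborel. exp (- (w \<bullet> w) / 2) *\<^sub>R cis (- (w \<bullet> z)))
      = (\<Prod>i\<in>UNIV. of_real (sqrt (2 * pi) * exp (- (z $ i)\<^sup>2 / 2)))"
    unfolding eq
    by (subst lborel_integral_vec_prod) (rule std_gaussian_fourier_real, simp only: std_gaussian_fourier_real(2))
  also have "\<dots> = of_real (sqrt (2 * pi) ^ CARD('d) * exp (- (z \<bullet> z) / 2))"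
    unfolding of_real_prod[symmetric] prod.distrib
    by (simp add: inner_vec_def power2_eq_square exp_sum[symmetric] sum_negf sum_divide_distrib[symmetric])
  finally show "(LINT w|lborel. exp (- (w \<bullet> w) / 2) *\<^sub>R cis (- (w \<bullet> z)))
      = of_real (sqrt (2 * pi) ^ CARD('d) * exp (- (z \<bullet> z) / 2))" .
qed

text \<open>With \<open>V\<close> orthonormalizing for \<open>Q\<close>, the substitution
  \<open>h = V w\<close> turns the quadratic form into \<open>w \<bullet> w\<close> and leaves a
  product of one-dimensional transforms. The same \<open>V\<close> gives the other data:
  \<open>V ** transpose V\<close> is the inverse of \<open>Q\<close>, and the modulus of
  \<open>det V\<close> is \<open>1 / sqrt (det Q)\<close>.\<close>

lemma gaussian_fourier:
  fixes Q :: "real ^ 'd::finite ^ 'd"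
  assumes sym: "transpose Q = Q" and pos: "\<And>u. u \<noteq> 0 \<Longrightarrow> (Q *v u) \<bullet> u > 0"
  shows "det Q > 0"
    and "integrable lborel (\<lambda>h. exp (- ((Q *v h) \<bullet> h) / 2))"
    and "(LINT h|lborel. exp (- ((Q *v h) \<bullet> h) / 2) *\<^sub>R cis (- (h \<bullet> y)))
      = of_real (sqrt (2 * pi) ^ CARD('d) / sqrt (det Q) * exp (- ((matrix_inv Q *v y) \<bullet> y) / 2))"
    and "y \<noteq> 0 \<Longrightarrow> (matrix_inv Q *v y) \<bullet> y > 0"
proof -
  obtain V :: "real^'d^'d" where V: "transpose V ** Q ** V = mat 1"
    using orthonormalizing_matrix_exists[OF assms] by blast
  have "det V * det Q * det V = 1"
    using arg_cong[OF V, of det] by (simp add: det_mul det_transpose)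
  hence dV: "(det V)\<^sup>2 * det Q = 1" by (simp add: power2_eq_square mult_ac)
  hence nz: "det V \<noteq> 0" by auto
  show dQ: "det Q > 0"
    using dV by (metis mult_pos_neg not_less_iff_gr_or_eq nz mult_zero_right zero_less_one zero_neq_one order_less_asym zero_less_power2)
  have absV: "\<bar>det V\<bar> = 1 / sqrt (det Q)"
  proof -
    have "(det V)\<^sup>2 = 1 / det Q" using dV dQ by (simp add: field_simps)
    hence "sqrt ((det V)\<^sup>2) = sqrt (1 / det Q)" by simp
    thus ?thesis by (simp add: real_sqrt_divide)
  qed
  have VVQ: "V ** (transpose V ** Q) = mat 1"
    using V matrix_left_right_inverse[of "transpose V ** Q" V] by simp
  hence inv1: "V ** transpose V ** Q = mat 1" by (simp add: matrix_mul_assoc)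
  hence inv2: "Q ** (V ** transpose V) = mat 1"
    using matrix_left_right_inverse[of "V ** transpose V" Q] by simp
  \<comment> \<open>\<open>matrix_inv\<close> is a choice among two-sided inverses, so an inverse is
    first exhibited as a witness, and uniqueness then identifies the two.\<close>
  have invQ: "matrix_inv Q = V ** transpose V"
  proof -
    have "Q ** matrix_inv Q = mat 1"
      unfolding matrix_inv_def by (rule someI2[where a = "V ** transpose V"]) (use inv1 inv2 in auto)
    hence "V ** transpose V ** (Q ** matrix_inv Q) = V ** transpose V" by simp
    thus ?thesis using inv1 by (simp add: matrix_mul_assoc)
  qed
  have qV: "(Q *v (V *v w)) \<bullet> (V *v w) = w \<bullet> w" for w
  proof -
    have "(Q *v (V *v w)) \<bullet> (V *v w) = ((transpose V ** Q ** V) *v w) \<bullet> w"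
      by (metis dot_lmul_matrix inner_commute matrix_vector_mul_assoc transpose_matrix_vector transpose_transpose)
    thus ?thesis by (simp add: V)
  qed
  have yV: "(V *v w) \<bullet> y = w \<bullet> (transpose V *v y)" for w y
    by (metis dot_lmul_matrix inner_commute transpose_matrix_vector transpose_transpose)
  have qinv: "(matrix_inv Q *v y) \<bullet> y = (transpose V *v y) \<bullet> (transpose V *v y)" for y
    by (simp add: invQ yV flip: matrix_vector_mul_assoc)
  have meas: "f \<in> borel_measurable borel" if "continuous_on UNIV f" for f :: "real^'d \<Rightarrow> complex"
    using that by (rule borel_measurable_continuous_onI)
  have linV: "linear ((*v) V)" "det (matrix ((*v) V)) \<noteq> 0"
    by (simp_all add: nz)
  have [measurable]: "(*v) V \<in> borel_measurable borel"
    by (intro borel_measurable_continuous_onI linear_continuous_on linear_linear[THEN iffD2] linV)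
  have LB: "lborel = density (distr lborel borel ((*v) V)) (\<lambda>_. ennreal \<bar>det V\<bar>)"
    using lborel_linear[OF linV] by simp
  have chg: "integrable lborel f \<and> (LINT h|lborel. f h) = \<bar>det V\<bar> *\<^sub>R (LINT w|lborel. f (V *v w))"
    if [measurable]: "f \<in> borel_measurable borel" and "integrable lborel (\<lambda>w. f (V *v w))"
    for f :: "real^'d \<Rightarrow> complex"
    using that(2) by (subst (1 2) LB) (simp add: integrable_density integrable_distr_eq integral_density integral_distr)
  let ?f = "\<lambda>y h. exp (- ((Q *v h) \<bullet> h) / 2) *\<^sub>R cis (- (h \<bullet> y))"
  have fV: "?f y (V *v w) = exp (- (w \<bullet> w) / 2) *\<^sub>R cis (- (w \<bullet> (transpose V *v y)))" for y w
    by (simp add: qV yV)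
  have fm: "?f y \<in> borel_measurable borel" for y
    by (intro meas continuous_intros matrix_vector_mult_linear_continuous_on) auto
  have fi: "integrable lborel (\<lambda>w. ?f y (V *v w))" for y
    unfolding fV by (rule std_gaussian_fourier)
  have main: "integrable lborel (?f y)" "(LINT h|lborel. ?f y h) = \<bar>det V\<bar> *\<^sub>R (LINT w|lborel. ?f y (V *v w))" for y
    using chg[OF fm fi] by auto
  have "integrable lborel (\<lambda>h. norm (?f 0 h))" using main(1) by (rule integrable_norm)
  thus "integrable lborel (\<lambda>h. exp (- ((Q *v h) \<bullet> h) / 2))" by simp
  show "(LINT h|lborel. ?f y h) = of_real (sqrt (2 * pi) ^ CARD('d) / sqrt (det Q) * exp (- ((matrix_inv Q *v y) \<bullet> y) / 2))"
    unfolding main(2) fV std_gaussian_fourier qinv absV by (simp add: scaleR_conv_of_real)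
  show "(matrix_inv Q *v y) \<bullet> y > 0" if "y \<noteq> 0"
  proof -
    have "transpose V *v y \<noteq> 0"
    proof
      assume "transpose V *v y = 0"
      hence "(Q ** (V ** transpose V)) *v y = 0" by (simp flip: matrix_vector_mul_assoc)
      thus False using inv2 that by simp
    qed
    thus ?thesis unfolding qinv by simp
  qed
qed

section \<open>The random walk and its characteristic function\<close>

text \<open>Convolution powers are rebuilt as distributions with finite support, which turns
  infinite lattice sums into finite ones; \<open>conv_power_eq_walk_pmf\<close> is the link to
  \<open>conv_power\<close>.\<close>

definition conv_pmf :: "'a::comm_monoid_add pmf \<Rightarrow> 'a pmf \<Rightarrow> 'a pmf" where
  "conv_pmf q q' = q \<bind> (\<lambda>u. q' \<bind> (\<lambda>v. return_pmf (u + v)))"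

primrec walk_pmf :: "'a::comm_monoid_add pmf \<Rightarrow> nat \<Rightarrow> 'a pmf" where
  "walk_pmf p 0 = return_pmf 0"
| "walk_pmf p (Suc n) = conv_pmf p (walk_pmf p n)"

lemma walk_pmf_add: "walk_pmf p (m + n) = conv_pmf (walk_pmf p m) (walk_pmf p n)"
  by (induction m) (simp_all add: conv_pmf_def bind_assoc_pmf bind_return_pmf bind_return_pmf' add.assoc)

lemma finite_set_conv_pmf:
  "finite (set_pmf q) \<Longrightarrow> finite (set_pmf q') \<Longrightarrow> finite (set_pmf (conv_pmf q q'))"
  by (simp add: conv_pmf_def)

lemma finite_set_walk_pmf: "finite (set_pmf p) \<Longrightarrow> finite (set_pmf (walk_pmf p n))"
  by (induction n) (simp_all add: finite_set_conv_pmf)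

lemma set_conv_pmf: "set_pmf (conv_pmf q q') = {u + v | u v. u \<in> set_pmf q \<and> v \<in> set_pmf q'}"
  by (auto simp: conv_pmf_def)

lemma pmf_conv_pmf:
  fixes q q' :: "'a::ab_group_add pmf"
  assumes "finite (set_pmf q)"
  shows "pmf (conv_pmf q q') x = (\<Sum>u\<in>set_pmf q. pmf q u * pmf q' (x - u))"
proof -
  have "pmf (q' \<bind> (\<lambda>v. return_pmf (u + v))) x = pmf q' (x - u)" for u
  proof -
    have "q' \<bind> (\<lambda>v. return_pmf (u + v)) = map_pmf ((+) u) q'"
      by (simp add: map_pmf_def)
    also have "pmf \<dots> (u + (x - u)) = pmf q' (x - u)"
      by (rule pmf_map_inj') (simp add: inj_def)
    finally show ?thesis by simp
  qed
  thus ?thesis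
    unfolding conv_pmf_def pmf_bind using assms
    by (subst integral_measure_pmf_real[of "set_pmf q"]) (auto simp: mult.commute)
qed

lemma lat_conv_pmf:
  assumes "finite (set_pmf q)"
  shows "lat_conv (pmf q) f x = (\<Sum>u\<in>set_pmf q. pmf q u * f (x - u))"
proof -
  have "lat_conv (pmf q) f x = (\<Sum>\<^sub>\<infinity>y\<in>set_pmf q. pmf q y * f (x - y))"
    unfolding lat_conv_def by (rule infsum_cong_neutral) (auto simp: pmf_eq_0_set_pmf)
  thus ?thesis using assms by simp
qed

lemma conv_power_eq_walk_pmf:
  assumes "finite (set_pmf p)"
  shows "conv_power (pmf p) n = pmf (walk_pmf p n)"
proof (induction n)
  case 0
  show ?case by (auto simp: dirac0_def pmf_return indicator_def)
next
  case (Suc n)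
  thus ?case using assms by (auto simp: lat_conv_pmf pmf_conv_pmf)
qed

lemma sum_conv_pmf:
  fixes h :: "'a::ab_group_add \<Rightarrow> 'b::{real_normed_field,banach,second_countable_topology}"
  assumes "finite (set_pmf q)" "finite (set_pmf q')" and h: "\<And>u v. h (u + v) = h u * h v"
  shows "(\<Sum>x\<in>set_pmf (conv_pmf q q'). pmf (conv_pmf q q') x *\<^sub>R h x)
    = (\<Sum>x\<in>set_pmf q. pmf q x *\<^sub>R h x) * (\<Sum>x\<in>set_pmf q'. pmf q' x *\<^sub>R h x)"
proof -
  have "(\<Sum>x\<in>set_pmf (conv_pmf q q'). pmf (conv_pmf q q') x *\<^sub>R h x) = measure_pmf.expectation (conv_pmf q q') h"
    using assms by (subst integral_measure_pmf[of "set_pmf (conv_pmf q q')"]) (auto simp: finite_set_conv_pmf)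
  also have "\<dots> = (\<Sum>u\<in>set_pmf q. pmf q u *\<^sub>R (\<Sum>v\<in>set_pmf q'. pmf q' v *\<^sub>R h (u + v)))"
    unfolding conv_pmf_def using assms(1,2)
    by (subst pmf_expectation_bind[of "set_pmf q"], simp, simp, simp)
       (intro sum.cong refl arg_cong2[where f="(*\<^sub>R)"],
        subst pmf_expectation_bind[of "set_pmf q'"], auto)
  also have "\<dots> = (\<Sum>x\<in>set_pmf q. pmf q x *\<^sub>R h x) * (\<Sum>x\<in>set_pmf q'. pmf q' x *\<^sub>R h x)"
    by (simp add: h sum_product scaleR_sum_right mult_ac)
  finally show ?thesis .
qed

text \<open>The multiplicative \<open>h\<close> is either a character
  \<open>cis (t \<bullet> lat_vec x)\<close>, for the characteristic function, or a real exponential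
  of one coordinate, for the exponential moments behind the Gaussian bound.\<close>

lemma sum_walk_pmf:
  fixes h :: "'a::ab_group_add \<Rightarrow> 'b::{real_normed_field,banach,second_countable_topology}"
  assumes "finite (set_pmf p)" and "\<And>u v. h (u + v) = h u * h v" "h 0 = 1"
  shows "(\<Sum>x\<in>set_pmf (walk_pmf p n). pmf (walk_pmf p n) x *\<^sub>R h x) = (\<Sum>v\<in>set_pmf p. pmf p v *\<^sub>R h v) ^ n"
proof (induction n)
  case (Suc n)
  show ?case
    using sum_conv_pmf[OF assms(1) finite_set_walk_pmf[OF assms(1)] assms(2), of n] Suc by simp
qed (simp add: assms)

lemma lat_vec_add [simp]: "lat_vec (u + v) = lat_vec u + lat_vec v"
  by (simp add: lat_vec_def vec_eq_iff)

lemma lat_vec_diff [simp]: "lat_vec (u - v) = lat_vec u - lat_vec v"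
  by (simp add: lat_vec_def vec_eq_iff)

lemma lat_vec_0 [simp]: "lat_vec 0 = 0"
  by (simp add: lat_vec_def vec_eq_iff)

lemma lat_vec_nth [simp]: "lat_vec v $ i = real_of_int (v $ i)"
  by (simp add: lat_vec_def)

locale class_S_walk =
  fixes p :: "(int ^ 'd::finite) pmf"
  assumes class_S: "class_S p"
begin

abbreviation tp :: "nat \<Rightarrow> int ^ 'd \<Rightarrow> real" where
  "tp n x \<equiv> pmf (walk_pmf p n) x"

abbreviation supp :: "nat \<Rightarrow> (int ^ 'd) set" where
  "supp n \<equiv> set_pmf (walk_pmf p n)"

abbreviation r :: nat where "r \<equiv> period p"

lemma finite_supp [simp]: "finite (set_pmf p)"
  using class_S by (simp add: class_S_def)

lemma conv_power_p: "conv_power (pmf p) n = tp n"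
  by (rule conv_power_eq_walk_pmf) simp

lemma mean_zero: "(\<Sum>v\<in>set_pmf p. pmf p v *\<^sub>R lat_vec v) = 0"
  using class_S by (simp add: class_S_def)

lemma irreducible: "\<exists>n. x \<in> set_pmf (walk_pmf p n)"
  using class_S by (simp add: class_S_def conv_power_p pmf_positive_iff)

lemma sum_pmf_p: "(\<Sum>v\<in>set_pmf p. pmf p v) = 1"
  by (rule sum_pmf_eq_1) auto

text \<open>A path to the all-ones vector followed by a path to its negative returns to the origin.
  The first path has positive length because the walk starts at 0, so the gcd is taken over a set
  with a positive element.\<close>

lemma period_pos: "r > 0"
proof -
  obtain m where m: "1 \<in> set_pmf (walk_pmf p m)" using irreducible by blast
  obtain n where n: "-1 \<in> set_pmf (walk_pmf p n)" using irreducible by blast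
  have "1 + (-1) \<in> set_pmf (walk_pmf p (m + n))"
    unfolding walk_pmf_add set_conv_pmf using m n by blast
  hence "tp (m + n) 0 > 0" by (simp add: pmf_positive)
  moreover have "m \<noteq> 0"
  proof
    assume "m = 0"
    hence "(1::int^'d) = 0" using m by simp
    thus False by simp
  qed
  ultimately have "m + n \<in> {n. 1 \<le> n \<and> conv_power (pmf p) n 0 > 0}" by (simp add: conv_power_p)
  hence "r dvd m + n" unfolding period_def by (rule Gcd_dvd_nat)
  thus ?thesis using \<open>m \<noteq> 0\<close> by (cases r) auto
qed

text \<open>A linear form that vanishes on all steps vanishes on every reachable point, hence on the
  whole lattice. This is how irreducibility makes \<open>Q\<close> positive definite.\<close>

lemma additive_zero_imp_zero:
  fixes u :: "real ^ 'd"
  assumes "\<And>v. v \<in> set_pmf p \<Longrightarrow> lat_vec v \<bullet> u = 0"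
  shows "u = 0"
proof -
  have "lat_vec x \<bullet> u = 0" if "x \<in> set_pmf (walk_pmf p n)" for n x
    using that
  proof (induction n arbitrary: x)
    case (Suc n)
    then obtain a b where "x = a + b" "a \<in> set_pmf p" "b \<in> set_pmf (walk_pmf p n)"
      by (auto simp: set_conv_pmf)
    thus ?case using Suc.IH[of b] assms[of a] by (simp add: inner_add_left)
  qed simp
  hence "lat_vec x \<bullet> u = 0" for x using irreducible[of x] by blast
  from this[of "axis i 1" for i] have "u $ i = 0" for i
  proof -
    have "lat_vec (axis i 1) = axis i 1" by (simp add: lat_vec_def vec_eq_iff axis_def)
    with \<open>lat_vec (axis i 1) \<bullet> u = 0\<close> show ?thesis by (simp add: inner_axis')
  qed
  thus ?thesis by (simp add: vec_eq_iff)
qed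

abbreviation Q where "Q \<equiv> cov_matrix p"

abbreviation qf :: "real ^ 'd \<Rightarrow> real" where "qf u \<equiv> (Q *v u) \<bullet> u"

abbreviation chi :: "int ^ 'd \<Rightarrow> real ^ 'd \<Rightarrow> complex" where
  "chi x u \<equiv> cis (- (u \<bullet> lat_vec x))"

abbreviation nrm :: "int ^ 'd \<Rightarrow> real" where "nrm \<equiv> cov_norm p"

lemma cov_pos: "u \<noteq> 0 \<Longrightarrow> qf u > 0"
proof -
  assume u: "u \<noteq> 0"
  then obtain v where v: "v \<in> set_pmf p" "lat_vec v \<bullet> u \<noteq> 0"
    using additive_zero_imp_zero by blast
  have "pmf p v * (lat_vec v \<bullet> u)\<^sup>2 > 0" using v by (simp add: pmf_positive)
  thus ?thesis unfolding cov_matrix_quadratic_form using v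
    by (intro sum_pos2[of _ v]) auto
qed

end

section \<open>Orthogonality of characters on the torus\<close>

lemma cis_int_integral:
  "(LINT t|lborel. indicator {-pi..pi} t *\<^sub>R cis (t * of_int m)) = (if m = 0 then of_real (2 * pi) else 0)"
  "integrable lborel (\<lambda>t. indicator {-pi..pi} t *\<^sub>R cis (t * of_int m))"
proof -
  have c: "continuous_on {-pi..pi} (\<lambda>t. cis (t * of_int m))" by (intro continuous_intros)
  show "integrable lborel (\<lambda>t. indicator {-pi..pi} t *\<^sub>R cis (t * of_int m))"
    using borel_integrable_atLeastAtMost'[OF c] by (simp add: set_integrable_def)
  show "(LINT t|lborel. indicator {-pi..pi} t *\<^sub>R cis (t * of_int m)) = (if m = 0 then of_real (2 * pi) else 0)"
  proof (cases "m = 0")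
    case True
    thus ?thesis by (simp add: scaleR_conv_of_real)
  next
    case False
    let ?F = "\<lambda>t. cis (t * of_int m) / (\<i> * of_int m)"
    have der: "(?F has_vector_derivative cis (t * of_int m)) (at t within {-pi..pi})" for t
      unfolding cis_conv_exp using False
      by (auto intro!: derivative_eq_intros has_vector_derivative_real_field simp: field_simps)
    have "(LINT t|lborel. indicator {-pi..pi} t *\<^sub>R cis (t * of_int m)) = ?F pi - ?F (-pi)"
      by (rule integral_FTC_atLeastAtMost) (use der c in auto)
    also have "cis (pi * of_int m) = cis (- pi * of_int m)"
      by (simp add: complex_eq_iff sin_npi_int)
    hence "?F pi - ?F (-pi) = 0" by simp
    finally show ?thesis using False by simp
  qed
qed

definition fbox :: "(real ^ 'd::finite) set" where
  "fbox = cbox (\<chi> i. - pi) (\<chi> i. pi)"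

lemma fbox_borel [measurable]: "fbox \<in> sets borel"
  by (simp add: fbox_def)

lemma mem_fbox: "t \<in> fbox \<longleftrightarrow> (\<forall>i. t $ i \<in> {-pi..pi})"
  by (auto simp: fbox_def mem_box_cart)

lemma fbox_cis_integral:
  fixes v :: "int ^ 'd::finite"
  shows "(LINT t|lborel. indicator fbox t *\<^sub>R cis (t \<bullet> lat_vec v)) = (if v = 0 then of_real ((2 * pi) ^ CARD('d)) else 0)"
    and "integrable lborel (\<lambda>t. indicator fbox t *\<^sub>R cis (t \<bullet> lat_vec v))"
proof -
  have eq: "indicator fbox t *\<^sub>R cis (t \<bullet> lat_vec v)
     = (\<Prod>i\<in>UNIV. indicator {-pi..pi} (t $ i) *\<^sub>R cis (t $ i * of_int (v $ i)))" for t :: "real^'d"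
  proof -
    have "cis (t \<bullet> lat_vec v) = (\<Prod>i\<in>UNIV. cis (t $ i * of_int (v $ i)))"
      by (simp add: inner_vec_def cis_sum)
    moreover have "indicator fbox t = (\<Prod>i\<in>UNIV. indicator {-pi..pi} (t $ i) :: real)"
      by (auto simp: indicator_def mem_fbox prod_zero_iff)
    ultimately show ?thesis
      by (simp add: scaleR_conv_of_real prod.distrib)
  qed
  show "integrable lborel (\<lambda>t. indicator fbox t *\<^sub>R cis (t \<bullet> lat_vec v))"
    unfolding eq by (rule lborel_integral_vec_prod) (rule cis_int_integral)
  have "(LINT t|lborel. indicator fbox t *\<^sub>R cis (t \<bullet> lat_vec v))
      = (\<Prod>i\<in>UNIV. if v $ i = 0 then of_real (2 * pi) else 0)"
    unfolding eq by (subst lborel_integral_vec_prod) (rule cis_int_integral, simp only: cis_int_integral)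
  also have "\<dots> = (if v = 0 then of_real ((2 * pi) ^ CARD('d)) else 0)"
  proof (cases "v = 0")
    case False
    then obtain i where "v $ i \<noteq> 0" by (auto simp: vec_eq_iff)
    thus ?thesis using False by (auto intro!: prod_zero)
  qed simp
  finally show "(LINT t|lborel. indicator fbox t *\<^sub>R cis (t \<bullet> lat_vec v)) = (if v = 0 then of_real ((2 * pi) ^ CARD('d)) else 0)" .
qed

lemma posdef_lower_bound:
  fixes Q :: "real ^ 'd::finite ^ 'd"
  assumes pos: "\<And>u. u \<noteq> 0 \<Longrightarrow> (Q *v u) \<bullet> u > 0"
  shows "\<exists>q>0. \<forall>u. q * (norm u)\<^sup>2 \<le> (Q *v u) \<bullet> u"
proof -
  have "continuous_on (sphere 0 1) (\<lambda>u. (Q *v u) \<bullet> u)"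
    by (intro continuous_intros matrix_vector_mult_linear_continuous_on)
  moreover have "sphere (0::real^'d) 1 \<noteq> {}" by simp
  ultimately obtain w :: "real^'d" where w: "norm w = 1" "\<And>u. norm u = 1 \<Longrightarrow> (Q *v w) \<bullet> w \<le> (Q *v u) \<bullet> u"
    using continuous_attains_inf[of "sphere (0::real^'d) 1" "\<lambda>u. (Q *v u) \<bullet> u"] by auto
  have "((Q *v w) \<bullet> w) * (norm u)\<^sup>2 \<le> (Q *v u) \<bullet> u" for u
  proof (cases "u = 0")
    case False
    let ?v = "(1 / norm u) *\<^sub>R u"
    have "(Q *v w) \<bullet> w \<le> (Q *v ?v) \<bullet> ?v" using False by (intro w) simp
    also have "\<dots> = ((Q *v u) \<bullet> u) / (norm u)\<^sup>2"
      by (simp add: matrix_vector_mult_scaleR power2_eq_square)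
    finally show ?thesis using False by (simp add: field_simps)
  qed simp
  moreover have "(Q *v w) \<bullet> w > 0" using w(1) by (intro pos) auto
  ultimately show ?thesis by blast
qed

section \<open>The characteristic function: inversion and behaviour near the origin\<close>

context class_S_walk begin

definition cf :: "real ^ 'd \<Rightarrow> complex" where
  "cf t = (\<Sum>v\<in>set_pmf p. pmf p v *\<^sub>R cis (t \<bullet> lat_vec v))"

lemma continuous_cf: "continuous_on A cf"
  unfolding cf_def by (intro continuous_intros)

lemma cf_borel [measurable]: "cf \<in> borel_measurable borel"
  by (intro borel_measurable_continuous_onI continuous_cf)

lemma norm_cf_le: "norm (cf t) \<le> 1"
proof -
  have "norm (cf t) \<le> (\<Sum>v\<in>set_pmf p. norm (pmf p v *\<^sub>R cis (t \<bullet> lat_vec v)))"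
    unfolding cf_def by (rule norm_sum)
  thus ?thesis by (simp add: sum_pmf_p)
qed

lemma cf_power: "cf t ^ n = (\<Sum>x\<in>supp n. tp n x *\<^sub>R cis (t \<bullet> lat_vec x))"
  unfolding cf_def by (rule sum_walk_pmf[symmetric]) (auto simp: inner_add_right cis_mult)

lemma tp_fourier:
  "(LINT t|lborel. indicator fbox t *\<^sub>R (cf t ^ n * chi x t)) = of_real ((2 * pi) ^ CARD('d) * tp n x)"
  "integrable lborel (\<lambda>t. indicator fbox t *\<^sub>R (cf t ^ n * chi x t))"
proof -
  let ?S = "supp n"
  have fin: "finite ?S" by (simp add: finite_set_walk_pmf)
  have eq: "indicator fbox t *\<^sub>R (cf t ^ n * chi x t)
     = (\<Sum>y\<in>?S. tp n y *\<^sub>R (indicator fbox t *\<^sub>R cis (t \<bullet> lat_vec (y - x))))" for t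
    unfolding cf_power
    by (simp add: sum_distrib_right scaleR_sum_right inner_diff_right cis_mult)
       (intro sum.cong refl, simp add: mult.commute)
  show "integrable lborel (\<lambda>t. indicator fbox t *\<^sub>R (cf t ^ n * chi x t))"
    unfolding eq by (intro Bochner_Integration.integrable_sum integrable_scaleR_right fbox_cis_integral)
  have "(LINT t|lborel. indicator fbox t *\<^sub>R (cf t ^ n * chi x t))
     = (\<Sum>y\<in>?S. tp n y *\<^sub>R (if y = x then of_real ((2 * pi) ^ CARD('d)) else 0))"
    unfolding eq
    by (subst Bochner_Integration.integral_sum, intro integrable_scaleR_right fbox_cis_integral)
       (simp only: integral_scaleR_right fbox_cis_integral right_minus_eq)
  also have "\<dots> = (\<Sum>y\<in>?S. if y = x then of_real ((2 * pi) ^ CARD('d) * tp n x) else 0)"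
    by (intro sum.cong) (auto simp: scaleR_conv_of_real)
  also have "\<dots> = of_real ((2 * pi) ^ CARD('d) * tp n x)"
    using fin by (auto simp: sum.delta set_pmf_iff)
  finally show "(LINT t|lborel. indicator fbox t *\<^sub>R (cf t ^ n * chi x t)) = of_real ((2 * pi) ^ CARD('d) * tp n x)" .
qed

text \<open>The linear term drops out because the steps have mean zero, and \<open>K\<close> is
  their third absolute moment, finite by the finite support.\<close>

lemma cf_taylor:
  "\<exists>K\<ge>0. \<forall>t. norm (cf t - of_real (1 - qf t / 2)) \<le> K * norm t ^ 3"
proof -
  define K where "K = (\<Sum>v\<in>set_pmf p. pmf p v * norm (lat_vec v) ^ 3)"
  have "norm (cf t - of_real (1 - qf t / 2)) \<le> K * norm t ^ 3" for t
  proof -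
    let ?t = "\<lambda>v. t \<bullet> lat_vec v"
    have lin: "(\<Sum>v\<in>set_pmf p. pmf p v * ?t v) = 0"
    proof -
      have "(\<Sum>v\<in>set_pmf p. pmf p v * ?t v) = t \<bullet> (\<Sum>v\<in>set_pmf p. pmf p v *\<^sub>R lat_vec v)"
        by (simp add: inner_sum_right)
      thus ?thesis by (simp add: mean_zero)
    qed
    have "(\<Sum>v\<in>set_pmf p. pmf p v *\<^sub>R (1 + \<i> * ?t v - of_real ((?t v)\<^sup>2 / 2)))
        = of_real (\<Sum>v\<in>set_pmf p. pmf p v) + \<i> * of_real (\<Sum>v\<in>set_pmf p. pmf p v * ?t v)
           - of_real ((\<Sum>v\<in>set_pmf p. pmf p v * (?t v)\<^sup>2) / 2)"
      by (simp add: scaleR_conv_of_real algebra_simps sum.distrib sum_subtractf sum_distrib_left sum_divide_distrib)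
    also have "\<dots> = of_real (1 - qf t / 2)"
      unfolding lin sum_pmf_p cov_matrix_quadratic_form by (simp add: inner_commute)
    finally have "cf t - of_real (1 - qf t / 2)
       = (\<Sum>v\<in>set_pmf p. pmf p v *\<^sub>R (cis (?t v) - (1 + \<i> * ?t v - of_real ((?t v)\<^sup>2 / 2))))"
      by (simp only: cf_def scaleR_diff_right sum_subtractf)
    also have "norm \<dots> \<le> (\<Sum>v\<in>set_pmf p. pmf p v * norm (cis (?t v) - (1 + \<i> * ?t v - of_real ((?t v)\<^sup>2 / 2))))"
      by (rule order_trans[OF norm_sum]) simp
    also have "\<dots> \<le> (\<Sum>v\<in>set_pmf p. pmf p v * (norm t * norm (lat_vec v)) ^ 3)"
    proof (intro sum_mono mult_left_mono)
      fix v
      have "norm (cis (?t v) - (1 + \<i> * ?t v - of_real ((?t v)\<^sup>2 / 2))) \<le> \<bar>?t v\<bar> ^ 3 / 6"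
        using iexp_approx1[of "?t v" 2]
        by (simp add: cis_conv_exp numeral_eq_Suc power2_eq_square field_simps)
      also have "\<dots> \<le> \<bar>?t v\<bar> ^ 3" by simp
      also have "\<dots> \<le> (norm t * norm (lat_vec v)) ^ 3"
        by (intro power_mono Cauchy_Schwarz_ineq2) auto
      finally show "norm (cis (?t v) - (1 + \<i> * ?t v - of_real ((?t v)\<^sup>2 / 2))) \<le> (norm t * norm (lat_vec v)) ^ 3" .
    qed auto
    also have "\<dots> = K * norm t ^ 3"
      by (simp add: K_def sum_distrib_left power_mult_distrib mult_ac)
    finally show ?thesis .
  qed
  moreover have "K \<ge> 0" unfolding K_def by (intro sum_nonneg) auto
  ultimately show ?thesis by blast
qed

lemma cf_gaussian_bound:
  "\<exists>\<delta>>0. \<exists>c>0. \<delta> \<le> pi \<and> (\<forall>h. norm h \<le> \<delta> \<longrightarrow> norm (cf h) \<le> exp (- c * (norm h)\<^sup>2))"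
proof -
  obtain K where K: "K \<ge> 0" "\<And>t. norm (cf t - of_real (1 - qf t / 2)) \<le> K * norm t ^ 3"
    using cf_taylor by blast
  obtain q where q: "q > 0" "\<And>u. q * (norm u)\<^sup>2 \<le> qf u"
    using posdef_lower_bound[OF cov_pos] by blast
  obtain L where L: "L > 0" "\<And>u. norm (Q *v u) \<le> L * norm u"
    using bounded_linear.pos_bounded[OF matrix_vector_mul_bounded_linear[of Q]] by (auto simp: mult.commute)
  \<comment> \<open>The bound \<open>pi\<close> keeps the ball inside \<open>fbox\<close>; the
    second bound makes the cubic Taylor error at most a quarter of \<open>q (norm h)^2\<close>; the
    third ensures \<open>qf h \<le> 1\<close>, so that \<open>1 - qf h / 2\<close> equals its own
    modulus. What is left is \<open>1 - (q / 4) (norm h)^2\<close>.\<close>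
  define \<delta> where "\<delta> = Min {pi, q / (4 * (K + 1)), 1 / sqrt L}"
  have \<delta>: "\<delta> > 0" "\<delta> \<le> pi" "\<delta> \<le> q / (4 * (K + 1))" "\<delta> \<le> 1 / sqrt L"
    using q L K by (auto simp: \<delta>_def)
  have "norm (cf h) \<le> exp (- (q / 4) * (norm h)\<^sup>2)" if h: "norm h \<le> \<delta>" for h
  proof -
    let ?z = "qf h"
    have "?z \<le> norm (Q *v h) * norm h" by (rule norm_cauchy_schwarz)
    also have "\<dots> \<le> L * norm h * norm h" using L by (intro mult_right_mono) auto
    also have "\<dots> \<le> L * ((1 / sqrt L) * (1 / sqrt L))"
      using h \<delta>(4) L unfolding mult.assoc by (intro mult_left_mono mult_mono) auto
    also have "\<dots> = 1" using L by simp
    finally have z: "?z \<le> 1" .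
    have "norm (cf h) \<le> norm (of_real (1 - ?z / 2) :: complex) + K * norm h ^ 3"
      using K(2)[of h] norm_triangle_ineq2[of "cf h" "of_real (1 - ?z / 2)"] by linarith
    also have "norm (of_real (1 - ?z / 2) :: complex) = 1 - ?z / 2"
      unfolding norm_of_real using z by simp
    also have "K * norm h ^ 3 = (K * norm h) * (norm h)\<^sup>2" by (simp add: power2_eq_square power3_eq_cube)
    also have "\<dots> \<le> (q / 4) * (norm h)\<^sup>2"
    proof (intro mult_right_mono)
      have "K * norm h \<le> (K + 1) * (q / (4 * (K + 1)))"
        using h \<delta>(3) K by (intro mult_mono) auto
      also have "\<dots> = q / 4" using K by (simp add: field_simps)
      finally show "K * norm h \<le> q / 4" .
    qed simp
    finally have "norm (cf h) \<le> 1 + (- (q / 4) * (norm h)\<^sup>2)"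
      using q(2)[of h] by simp
    also have "\<dots> \<le> exp (- (q / 4) * (norm h)\<^sup>2)" by (rule exp_ge_add_one_self)
    finally show ?thesis .
  qed
  thus ?thesis using \<delta> q by (intro exI[of _ \<delta>] conjI exI[of _ "q/4"]) auto
qed

text \<open>For numbers of modulus at most 1 the \<open>k\<close>-th powers differ by at most
  \<open>k\<close> times the difference of the numbers. The Taylor error at
  \<open>h / sqrt k\<close> is of order \<open>k^(- 3 / 2)\<close>, so the powers differ by
  \<open>O(k^(- 1 / 2))\<close>. Taking \<open>k \<ge> qf h\<close> keeps the comparison number in
  the unit disc.\<close>

lemma cf_scaled_limit:
  "(\<lambda>k. cf ((1 / sqrt (real k)) *\<^sub>R h) ^ k) \<longlonglongrightarrow> of_real (exp (- qf h / 2))"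
proof -
  let ?z = "qf h"
  obtain K where K: "K \<ge> 0" "\<And>t. norm (cf t - of_real (1 - qf t / 2)) \<le> K * norm t ^ 3"
    using cf_taylor by blast
  have z0: "?z \<ge> 0" using cov_pos[of h] by (cases "h = 0") auto
  have lim: "(\<lambda>k. (1 + (- ?z / 2) / real k) ^ k) \<longlonglongrightarrow> exp (- ?z / 2)"
    by (rule tendsto_exp_limit_sequentially)
  have "(\<lambda>k. cf ((1 / sqrt (real k)) *\<^sub>R h) ^ k - of_real ((1 + (- ?z / 2) / real k) ^ k)) \<longlonglongrightarrow> 0"
  proof (rule Lim_null_comparison)
    show "\<forall>\<^sub>F k in sequentially. norm (cf ((1 / sqrt (real k)) *\<^sub>R h) ^ k - of_real ((1 + (- ?z / 2) / real k) ^ k))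
         \<le> K * norm h ^ 3 / sqrt (real k)"
      using eventually_ge_at_top[of "max 1 (nat \<lceil>?z\<rceil>)"]
    proof eventually_elim
      case (elim k)
      hence k: "k \<ge> 1" "real k \<ge> ?z" by linarith+
      let ?t = "(1 / sqrt (real k)) *\<^sub>R h"
      have Qt: "qf ?t = ?z / real k"
        using k by (simp add: matrix_vector_mult_scaleR)
      have w: "1 + (- ?z / 2) / real k = 1 - qf ?t / 2"
        unfolding Qt by simp
      have "\<bar>1 + (- ?z / 2) / real k\<bar> \<le> 1"
        using z0 k by (auto simp: abs_le_iff field_simps)
      hence "norm (cf ?t ^ k - of_real (1 + (- ?z / 2) / real k) ^ k) \<le> real k * norm (cf ?t - of_real (1 + (- ?z / 2) / real k))"
        by (intro norm_power_diff norm_cf_le) (simp only: norm_of_real)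
      also have "\<dots> \<le> real k * (K * norm ?t ^ 3)"
        unfolding w by (intro mult_left_mono K(2)) auto
      also have "\<dots> = K * norm h ^ 3 / sqrt (real k)"
        using k by (simp add: power_divide power3_eq_cube)
      finally show ?case by simp
    qed
    show "(\<lambda>k. K * norm h ^ 3 / sqrt (real k)) \<longlonglongrightarrow> 0"
      by real_asymp
  qed
  from tendsto_add[OF this tendsto_of_real[OF lim]] show ?thesis by simp
qed

end

section \<open>Local limit theorem\<close>

lemma ball_borel [measurable]: "ball x e \<in> sets borel"
  by (rule borel_open) simp

lemma lborel_integral_scale:
  fixes f :: "'a::euclidean_space \<Rightarrow> 'b::{banach,second_countable_topology}"
  assumes [measurable]: "f \<in> borel_measurable borel" and s: "s > 0"
  shows "s ^ DIM('a) *\<^sub>R (LINT x|lborel. f x) = (LINT h|lborel. f (t + (1 / s) *\<^sub>R h))"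
proof -
  have "(LINT x|lborel. f x) = (1 / s) ^ DIM('a) *\<^sub>R (LINT h|lborel. f (t + (1 / s) *\<^sub>R h))"
    using s by (subst lborel_affine[of "1 / s" t]) (simp_all add: integral_density integral_distr)
  thus ?thesis using s by (simp add: power_divide)
qed

lemma integrable_scale:
  fixes f :: "'a::euclidean_space \<Rightarrow> 'b::{banach,second_countable_topology}"
  assumes "integrable lborel (\<lambda>h. f (t + (1 / s) *\<^sub>R h))" and [measurable]: "f \<in> borel_measurable borel" and s: "s > 0"
  shows "integrable lborel f"
  using assms
  by (subst lborel_affine[of "1 / s" t]) (simp_all add: integrable_density integrable_distr_eq)

lemma integrable_exp_neg_norm_sq:
  assumes "c > 0"
  shows "integrable lborel (\<lambda>h::real^'d::finite. exp (- c * (norm h)\<^sup>2))"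
proof -
  let ?Q = "(2 * c) *\<^sub>R mat 1 :: real^'d^'d"
  have tr: "transpose ?Q = ?Q" by (simp add: transpose_def mat_def vec_eq_iff)
  have q: "(?Q *v u) \<bullet> u = 2 * c * (norm u)\<^sup>2" for u
    by (simp add: scaleR_matrix_vector_assoc[symmetric] power2_norm_eq_inner)
  have "integrable lborel (\<lambda>h. exp (- ((?Q *v h) \<bullet> h) / 2))"
    by (rule gaussian_fourier(2)[OF tr]) (simp add: q assms)
  thus ?thesis unfolding q by simp
qed

lemma power_times_geometric_tendsto_0:
  fixes \<rho> :: real
  assumes "0 \<le> \<rho>" "\<rho> < 1"
  shows "(\<lambda>k. real k ^ m * \<rho> ^ k) \<longlonglongrightarrow> 0"
proof (cases "\<rho> = 0")
  case True
  show ?thesis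
    by (rule tendsto_eventually, rule eventually_mono[OF eventually_gt_at_top[of 0]]) (simp add: True)
next
  case False
  hence "ln \<rho> < 0" "\<rho> > 0" using assms by auto
  hence "((\<lambda>x::real. x ^ m * exp (ln \<rho> * x)) \<longlongrightarrow> 0) at_top" by real_asymp
  from filterlim_compose[OF this filterlim_real_sequentially]
  have "(\<lambda>k. real k ^ m * exp (ln \<rho> * real k)) \<longlonglongrightarrow> 0" .
  moreover have "exp (ln \<rho> * real k) = \<rho> ^ k" for k
    using \<open>\<rho> > 0\<close> by (simp add: exp_of_nat_mult mult.commute[of "ln \<rho>"])
  ultimately show ?thesis by simp
qed

text \<open>The multiplicative order of \<open>w\<close> divides every element of \<open>A\<close>
  and therefore their gcd. If \<open>A\<close> has no positive element, the gcd is 0.\<close>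

lemma power_Gcd_eq_1:
  fixes w :: "'a::monoid_mult"
  assumes "\<And>n. n \<in> A \<Longrightarrow> w ^ n = 1"
  shows "w ^ Gcd (A :: nat set) = 1"
proof (cases "\<exists>n\<in>A. n > 0")
  case True
  then obtain n0 where n0: "n0 \<in> A" "n0 > 0" by blast
  define m where "m = (LEAST m. m > 0 \<and> w ^ m = 1)"
  have m: "m > 0 \<and> w ^ m = 1"
    unfolding m_def by (rule LeastI[of _ n0]) (use n0 assms in auto)
  have "m dvd n" if "n \<in> A" for n
  proof -
    have "w ^ n = (w ^ m) ^ (n div m) * w ^ (n mod m)"
      by (simp flip: power_mult power_add)
    hence "w ^ (n mod m) = 1" using assms[OF that] m by simp
    moreover have "n mod m < m" using m by simp
    ultimately have "n mod m = 0"
      using not_less_Least[of "n mod m" "\<lambda>m. m > 0 \<and> w ^ m = 1"] by (auto simp: m_def)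
    thus ?thesis by auto
  qed
  hence "m dvd Gcd A" by (rule Gcd_greatest)
  then obtain c where "Gcd A = m * c" by blast
  thus ?thesis using m by (simp add: power_mult)
next
  case False
  hence "A \<subseteq> {0}" by auto
  hence G: "Gcd A = 0" by (simp add: Gcd_0_iff)
  show ?thesis unfolding G by simp
qed

context class_S_walk begin

text \<open>The Fourier transform of the period sum starting at time \<open>k\<close>. The geometric
  sum is the factor that vanishes when \<open>cf t\<close> is an \<open>r\<close>-th root of unity
  other than 1.\<close>

definition cfs :: "nat \<Rightarrow> real ^ 'd \<Rightarrow> complex" where
  "cfs k t = cf t ^ k * (\<Sum>j<r. cf t ^ j)"

lemma cfs_borel [measurable]: "cfs k \<in> borel_measurable borel"
  unfolding cfs_def[abs_def] by measurable

lemma norm_cfs_le: "norm (cfs k t) \<le> real r * norm (cf t) ^ k"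
proof -
  have "norm (\<Sum>j<r. cf t ^ j) \<le> (\<Sum>j<r. 1)"
    by (rule sum_norm_le) (simp add: norm_power power_le_one norm_cf_le)
  from mult_left_mono[OF this, of "norm (cf t) ^ k"] show ?thesis
    by (simp add: cfs_def norm_mult norm_power mult.commute)
qed

text \<open>A convex combination of unit numbers has modulus 1 only if they all coincide: rotated by
  \<open>cnj (cf t)\<close>, their real parts are at most 1 and average to 1. Hence every path of
  length \<open>n\<close> collects the phase \<open>cf t ^ n\<close>. Return paths make
  \<open>cf t ^ n = 1\<close> at return times, so the gcd of these times works as well. If
  \<open>cf t = 1\<close>, irreducibility gives \<open>cis (t $ i) = 1\<close> for each coordinate,
  and 0 is the only multiple of \<open>2 pi\<close> in \<open>[- pi, pi]\<close>.\<close>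

lemma cf_modulus_one:
  assumes "norm (cf t) = 1"
  shows "v \<in> set_pmf p \<Longrightarrow> cis (t \<bullet> lat_vec v) = cf t"
    and "x \<in> supp n \<Longrightarrow> cis (t \<bullet> lat_vec x) = cf t ^ n"
    and "cf t ^ r = 1"
    and "cf (t + h) = cf t * cf h"
    and "cf t = 1 \<Longrightarrow> t \<in> fbox \<Longrightarrow> t = 0"
proof -
  let ?w = "cf t"
  have Re_le: "Re (cis (t \<bullet> lat_vec v) * cnj ?w) \<le> 1" for v
    using complex_Re_le_cmod[of "cis (t \<bullet> lat_vec v) * cnj ?w"] by (simp only: norm_mult complex_mod_cnj assms norm_cis mult_1)
  have "?w * cnj ?w = 1" using assms complex_norm_square[of ?w] by simp
  hence "(\<Sum>v\<in>set_pmf p. pmf p v *\<^sub>R (cis (t \<bullet> lat_vec v) * cnj ?w)) = 1"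
    unfolding cf_def[of t] by (simp add: sum_distrib_right)
  hence "Re (\<Sum>v\<in>set_pmf p. pmf p v *\<^sub>R (cis (t \<bullet> lat_vec v) * cnj ?w)) = 1" by simp
  hence "(\<Sum>v\<in>set_pmf p. pmf p v * Re (cis (t \<bullet> lat_vec v) * cnj ?w)) = 1"
    by (simp only: Re_sum scaleR_complex.sel)
  hence s0: "(\<Sum>v\<in>set_pmf p. pmf p v * (1 - Re (cis (t \<bullet> lat_vec v) * cnj ?w))) = 0"
    by (simp only: right_diff_distrib sum_subtractf mult_1_right sum_pmf_p diff_self)
  show v: "cis (t \<bullet> lat_vec v) = ?w" if "v \<in> set_pmf p" for v
  proof -
    have nn: "pmf p v * (1 - Re (cis (t \<bullet> lat_vec v) * cnj ?w)) \<ge> 0" for v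
      by (intro mult_nonneg_nonneg pmf_nonneg) (use Re_le in \<open>simp only: diff_ge_0_iff_ge\<close>)
    have "\<forall>v\<in>set_pmf p. pmf p v * (1 - Re (cis (t \<bullet> lat_vec v) * cnj ?w)) = 0"
      using s0 nn by (subst (asm) sum_nonneg_eq_0_iff) simp_all
    hence re: "Re (cis (t \<bullet> lat_vec v) * cnj ?w) = 1"
      using that by (auto simp: set_pmf_iff)
    let ?z = "cis (t \<bullet> lat_vec v) * cnj ?w"
    have "(Re ?z)\<^sup>2 + (Im ?z)\<^sup>2 = 1"
      by (simp only: cmod_power2[symmetric] norm_mult complex_mod_cnj assms norm_cis) simp
    hence "Im ?z = 0" unfolding re by simp
    hence "?z = 1" using re by (simp only: complex_eq_iff one_complex.sel)
    hence "?z * ?w = ?w" by simp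
    thus ?thesis using \<open>?w * cnj ?w = 1\<close> by (simp only: mult.assoc mult.commute[of "cnj ?w"] mult_1_right)
  qed
  show x: "cis (t \<bullet> lat_vec x) = ?w ^ n" if "x \<in> supp n" for x n
    using that
  proof (induction n arbitrary: x)
    case (Suc n)
    then obtain a b where "x = a + b" "a \<in> set_pmf p" "b \<in> supp n"
      by (auto simp: set_conv_pmf)
    thus ?case using Suc.IH[of b] v[of a] by (simp add: inner_add_right cis_mult[symmetric])
  qed simp
  show "?w ^ r = 1"
    unfolding period_def
  proof (rule power_Gcd_eq_1)
    fix n assume "n \<in> {n. 1 \<le> n \<and> conv_power (pmf p) n 0 > 0}"
    hence "0 \<in> supp n" by (simp add: conv_power_p pmf_positive_iff)
    from x[OF this] show "?w ^ n = 1" by simp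
  qed
  have "cf (t + h) = (\<Sum>u\<in>set_pmf p. pmf p u *\<^sub>R (cis (t \<bullet> lat_vec u) * cis (h \<bullet> lat_vec u)))"
    by (simp add: cf_def inner_add_left cis_mult)
  also have "\<dots> = (\<Sum>u\<in>set_pmf p. pmf p u *\<^sub>R (?w * cis (h \<bullet> lat_vec u)))"
    using v by (intro sum.cong) auto
  also have "\<dots> = ?w * cf h" by (simp add: cf_def[of h] sum_distrib_left)
  finally show "cf (t + h) = ?w * cf h" .
  show "t = 0" if "?w = 1" "t \<in> fbox"
  proof -
    have "t $ i = 0" for i
    proof -
      obtain n where "axis i 1 \<in> supp n" using irreducible by blast
      from x[OF this] have "cis (t $ i) = 1"
        using that by (simp add: inner_vec_def axis_def if_distrib cong: if_cong)
      hence "cos (t $ i) = 1" by (simp add: complex_eq_iff)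
      then obtain m :: int where m: "t $ i = of_int m * 2 * pi" by (auto simp: cos_one_2pi_int)
      have "\<bar>t $ i\<bar> \<le> pi" using that(2) by (auto simp: mem_fbox abs_le_iff) (metis add.inverse_inverse neg_le_iff_le)
      hence "\<bar>of_int m * 2\<bar> * pi \<le> 1 * pi" by (simp add: m abs_mult)
      hence "\<bar>of_int m * 2 :: real\<bar> \<le> 1" using pi_gt_zero by (simp only: mult_le_cancel_right_pos)
      hence "m = 0" by linarith
      thus ?thesis using m by simp
    qed
    thus ?thesis by (simp add: vec_eq_iff)
  qed
qed

definition period_sum :: "int ^ 'd \<Rightarrow> nat \<Rightarrow> real" where
  "period_sum x k = (\<Sum>j<r. tp (k + j) x)"

text \<open>The density at \<open>x\<close> of the centred Gaussian with covariance matrix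
  \<open>k Q\<close>. For \<open>k = 0\<close> division by zero makes it 0.\<close>

definition gauss :: "int ^ 'd \<Rightarrow> nat \<Rightarrow> real" where
  "gauss x k = exp (- (nrm x)\<^sup>2 / (2 * real k)) / (sqrt (2 * pi * real k) ^ CARD('d) * sqrt (det Q))"

abbreviation err :: "int ^ 'd \<Rightarrow> nat \<Rightarrow> real" where
  "err x k \<equiv> \<bar>period_sum x k - real r * gauss x k\<bar>"

lemma period_sum_fourier:
  "of_real ((2 * pi) ^ CARD('d) * period_sum x k)
     = (LINT t|lborel. indicator fbox t *\<^sub>R (cfs k t * chi x t))"
  "integrable lborel (\<lambda>t. indicator fbox t *\<^sub>R (cfs k t * chi x t))"
proof -
  have eq: "indicator fbox t *\<^sub>R (cfs k t * chi x t)
     = (\<Sum>j<r. indicator fbox t *\<^sub>R (cf t ^ (k + j) * chi x t))" for t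
    by (simp add: cfs_def power_add sum_distrib_left sum_distrib_right scaleR_sum_right)
  show "integrable lborel (\<lambda>t. indicator fbox t *\<^sub>R (cfs k t * chi x t))"
    unfolding eq by (intro Bochner_Integration.integrable_sum tp_fourier)
  show "of_real ((2 * pi) ^ CARD('d) * period_sum x k)
     = (LINT t|lborel. indicator fbox t *\<^sub>R (cfs k t * chi x t))"
    unfolding eq
    by (subst Bochner_Integration.integral_sum, rule tp_fourier)
       (simp add: tp_fourier period_sum_def sum_distrib_left)
qed

lemma inverse_cov_norm_sq: "(nrm x)\<^sup>2 = (matrix_inv Q *v lat_vec x) \<bullet> lat_vec x"
proof -
  have "(matrix_inv Q *v lat_vec x) \<bullet> lat_vec x \<ge> 0"
    using gaussian_fourier(4)[OF transpose_cov_matrix cov_pos, of "lat_vec x"]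
    by (cases "lat_vec x = 0") auto
  thus ?thesis by (simp add: cov_norm_def)
qed

lemma det_cov_pos: "det Q > 0"
  by (rule gaussian_fourier(1)[OF transpose_cov_matrix cov_pos])

lemma mult_cov_borel [measurable]: "(*v) Q \<in> borel_measurable borel"
  by (intro borel_measurable_continuous_onI matrix_vector_mult_linear_continuous_on)

lemma gauss_fourier:
  assumes k: "k > 0"
  shows "of_real ((2 * pi) ^ CARD('d) * gauss x k)
     = (LINT t|lborel. exp (- (real k * qf t) / 2) *\<^sub>R chi x t)"
    and "integrable lborel (\<lambda>t. exp (- (real k * qf t) / 2))"
proof -
  let ?s = "sqrt (real k)"
  have s: "?s > 0" using k by simp
  let ?f = "\<lambda>t::real^'d. exp (- (real k * qf t) / 2) *\<^sub>R chi x t"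
  have fm: "?f \<in> borel_measurable borel"
    by (intro borel_measurable_continuous_onI continuous_intros matrix_vector_mult_linear_continuous_on) auto
  have Qs: "real k * ((Q *v ((1 / ?s) *\<^sub>R h)) \<bullet> ((1 / ?s) *\<^sub>R h)) = qf h" for h
    using k by (simp add: matrix_vector_mult_scaleR)
  have "?s ^ CARD('d) *\<^sub>R (LINT t|lborel. ?f t) = (LINT h|lborel. ?f ((1 / ?s) *\<^sub>R h))"
    using lborel_integral_scale[OF fm s, of 0] by (simp only: add_0 DIM_cart DIM_real mult_1_right)
  also have "\<dots> = (LINT h|lborel. exp (- qf h / 2) *\<^sub>R cis (- (h \<bullet> ((1 / ?s) *\<^sub>R lat_vec x))))"
    unfolding Qs by simp
  also have "\<dots> = of_real (sqrt (2 * pi) ^ CARD('d) / sqrt (det Q) * exp (- (nrm x)\<^sup>2 / (2 * real k)))"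
    using k by (subst gaussian_fourier(3)[OF transpose_cov_matrix cov_pos])
      (auto simp: inverse_cov_norm_sq matrix_vector_mult_scaleR field_simps)
  finally have scaled: "?s ^ CARD('d) *\<^sub>R (LINT t|lborel. ?f t)
      = of_real (sqrt (2 * pi) ^ CARD('d) / sqrt (det Q) * exp (- (nrm x)\<^sup>2 / (2 * real k)))" .
  have "I = of_real (C / a)" if "a *\<^sub>R I = of_real C" "a > 0" for I :: complex and a C :: real
  proof -
    have "I = (1 / a) *\<^sub>R (a *\<^sub>R I)" using that(2) by simp
    thus ?thesis unfolding that(1) by (simp add: scaleR_conv_of_real)
  qed
  from this[OF scaled] have "(LINT t|lborel. ?f t)
      = of_real ((sqrt (2 * pi) ^ CARD('d) / sqrt (det Q) * exp (- (nrm x)\<^sup>2 / (2 * real k))) / ?s ^ CARD('d))"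
    using s by simp
  also have "(sqrt (2 * pi) ^ CARD('d) / sqrt (det Q) * exp (- (nrm x)\<^sup>2 / (2 * real k))) / ?s ^ CARD('d)
      = (2 * pi) ^ CARD('d) * gauss x k"
  proof -
    have "(2 * pi) ^ CARD('d) = sqrt (2 * pi) ^ CARD('d) * sqrt (2 * pi) ^ CARD('d)"
      unfolding power_mult_distrib[symmetric] by simp
    moreover have "sqrt (2 * pi * real k) = sqrt (2 * pi) * ?s" by (simp add: real_sqrt_mult)
    ultimately show ?thesis
      unfolding gauss_def using s by (simp add: power_mult_distrib)
  qed
  finally show "of_real ((2 * pi) ^ CARD('d) * gauss x k) = (LINT t|lborel. ?f t)" ..
  show "integrable lborel (\<lambda>t. exp (- (real k * qf t) / 2))"
  proof (rule integrable_scale[where t=0 and s="?s"])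
    show "integrable lborel (\<lambda>h. exp (- (real k * ((Q *v (0 + (1 / ?s) *\<^sub>R h)) \<bullet> (0 + (1 / ?s) *\<^sub>R h))) / 2))"
      unfolding add_0 Qs by (rule gaussian_fourier(2)[OF transpose_cov_matrix cov_pos])
    show "(\<lambda>t. exp (- (real k * qf t) / 2)) \<in> borel_measurable borel"
      by (intro borel_measurable_continuous_onI continuous_intros matrix_vector_mult_linear_continuous_on) auto
  qed (rule s)
qed

text \<open>At a point of modulus 1, \<open>cf (t + h) = cf t * cf h\<close> carries the behaviour
  at the origin over to \<open>t\<close>. After rescaling by \<open>sqrt k\<close>,
  \<open>cf_scaled_limit\<close> gives the pointwise limit and \<open>cf_gaussian_bound\<close> an
  integrable majorant. The claim concerns the integral of a modulus, so the resulting error is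
  uniform in \<open>x\<close>. It serves \<open>t = 0\<close>, where the geometric sum is
  \<open>r\<close>, and the other points, where it is 0.\<close>

lemma cfs_near_modulus_one:
  assumes one: "norm (cf t) = 1"
  shows "\<exists>\<delta>>0. \<delta> \<le> pi \<and> (\<lambda>k. sqrt (real k) ^ CARD('d) * (LINT z|lborel. norm (indicator (ball t \<delta>) z *\<^sub>R cfs k z
      - cf t ^ k * (\<Sum>j<r. cf t ^ j) * of_real (exp (- (real k * qf (z - t)) / 2))))) \<longlonglongrightarrow> 0"
proof -
  note shift = cf_modulus_one(4)[OF one]
  obtain \<delta> c where \<delta>: "\<delta> > 0" "\<delta> \<le> pi" "c > 0" "\<And>h. norm h \<le> \<delta> \<Longrightarrow> norm (cf h) \<le> exp (- c * (norm h)\<^sup>2)"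
    using cf_gaussian_bound by blast
  define S where "S = (\<Sum>j<r. cf t ^ j)"
  have S: "norm (cf t ^ k * S) \<le> real r" for k
    using norm_cfs_le[of k t] by (simp add: cfs_def S_def one)
  let ?G = "\<lambda>k h. cf t ^ k * S * of_real (exp (- (real k * qf h) / 2))"
  let ?D = "\<lambda>k z. norm (indicator (ball t \<delta>) z *\<^sub>R cfs k z - ?G k (z - t))"
  have Dm: "?D k \<in> borel_measurable borel" for k
    by measurable
  let ?s = "\<lambda>k h. (1 / sqrt (real k)) *\<^sub>R h"
  let ?g = "\<lambda>k h. ?D k (t + ?s k h)"
  have Qs: "real k * qf (?s k h) = qf h" if "k > 0" for h k
    using that by (simp add: matrix_vector_mult_scaleR)
  have "(\<lambda>k. sqrt (real k) ^ CARD('d) * (LINT z|lborel. ?D k z)) \<longlonglongrightarrow> 0"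
  proof (rule Lim_transform_eventually)
    show "\<forall>\<^sub>F k in sequentially. (LINT h|lborel. ?g (Suc (k - 1)) h) = sqrt (real k) ^ CARD('d) * (LINT z|lborel. ?D k z)"
      using eventually_gt_at_top[of 0]
    proof eventually_elim
      case (elim k)
      thus ?case
        using lborel_integral_scale[OF Dm, of "sqrt (real k)" k t] by simp
    qed
    \<comment> \<open>The majorant relies on rescaling by \<open>sqrt k\<close> with positive
      \<open>k\<close>; dominated convergence is therefore run along \<open>Suc k\<close> and
      shifted back at the end.\<close>
    have "(\<lambda>k. LINT h|lborel. ?g (Suc k) h) \<longlonglongrightarrow> (LINT h|(lborel :: (real^'d) measure). 0)"
    proof (rule integral_dominated_convergence[where w="\<lambda>h. real r * exp (- c * (norm h)\<^sup>2) + real r * exp (- qf h / 2)"])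
      show "integrable lborel (\<lambda>h::real^'d. real r * exp (- c * (norm h)\<^sup>2) + real r * exp (- qf h / 2))"
        by (intro Bochner_Integration.integrable_add integrable_mult_right integrable_exp_neg_norm_sq \<delta>
            gaussian_fourier(2)[OF transpose_cov_matrix cov_pos])
      show "?g (Suc k) \<in> borel_measurable lborel" for k
        using measurable_compose[OF _ Dm, of "\<lambda>h. t + ?s (Suc k) h" lborel "Suc k"] by simp
      show "AE h in lborel. norm (?g (Suc k) h) \<le> real r * exp (- c * (norm h)\<^sup>2) + real r * exp (- qf h / 2)" for k
      proof (rule AE_I2)
        fix h :: "real^'d"
        let ?k = "Suc k" and ?h = "?s (Suc k) h"
        have 1: "norm (indicator (ball t \<delta>) (t + ?h) *\<^sub>R cfs ?k (t + ?h)) \<le> real r * exp (- c * (norm h)\<^sup>2)"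
        proof (cases "norm ?h < \<delta>")
          case True
          have "norm (cf ?h) ^ ?k \<le> exp (- c * (norm ?h)\<^sup>2) ^ ?k"
            using \<delta>(4)[of ?h] True by (intro power_mono) auto
          also have "\<dots> = exp (real ?k * (- c * (norm ?h)\<^sup>2))" by (simp only: exp_of_nat_mult)
          also have "real ?k * (- c * (norm ?h)\<^sup>2) = - c * (norm h)\<^sup>2"
            by (simp add: power_divide)
          finally have 1: "norm (cf ?h) ^ ?k \<le> exp (- c * (norm h)\<^sup>2)" .
          have "norm (indicator (ball t \<delta>) (t + ?h) *\<^sub>R cfs ?k (t + ?h)) \<le> norm (cfs ?k (t + ?h))"
            by (auto simp: indicator_def)
          also have "\<dots> \<le> real r * norm (cf (t + ?h)) ^ ?k" by (rule norm_cfs_le)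
          also have "norm (cf (t + ?h)) = norm (cf ?h)" by (simp only: shift norm_mult one mult_1_left)
          also have "real r * norm (cf ?h) ^ ?k \<le> real r * exp (- c * (norm h)\<^sup>2)" using 1 by (intro mult_left_mono) auto
          finally show ?thesis .
        next
          case False
          thus ?thesis by (auto simp: indicator_def dist_norm)
        qed
        have "norm (?G ?k ?h) = norm (cf t ^ ?k * S) * exp (- qf h / 2)"
          unfolding norm_mult[of "_ * _"] Qs[OF zero_less_Suc] by simp
        also have "\<dots> \<le> real r * exp (- qf h / 2)" by (rule mult_right_mono[OF S exp_ge_zero])
        finally have 2: "norm (?G ?k ?h) \<le> real r * exp (- qf h / 2)" .
        have "?g ?k h \<le> norm (indicator (ball t \<delta>) (t + ?h) *\<^sub>R cfs ?k (t + ?h)) + norm (?G ?k (t + ?h - t))"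
          by (rule norm_triangle_ineq4)
        thus "norm (?g ?k h) \<le> real r * exp (- c * (norm h)\<^sup>2) + real r * exp (- qf h / 2)"
          using 1 2 by (simp only: add_diff_cancel_left' real_norm_def abs_norm_cancel)
      qed
      show "AE h in lborel. (\<lambda>k. ?g (Suc k) h) \<longlonglongrightarrow> 0"
      proof (rule AE_I2)
        fix h :: "real^'d"
        have "(\<lambda>k. ?s k h) \<longlonglongrightarrow> 0 *\<^sub>R h"
          by (intro tendsto_intros) real_asymp
        hence h0: "(\<lambda>k. ?s k h) \<longlonglongrightarrow> 0" by simp
        hence "(\<lambda>k. t + ?s k h) \<longlonglongrightarrow> t + 0" by (intro tendsto_add tendsto_const)
        hence "(\<lambda>k. \<Sum>j<r. cf (t + ?s k h) ^ j) \<longlonglongrightarrow> S"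
          using continuous_cf[of UNIV] unfolding S_def
          by (intro tendsto_intros isCont_tendsto_compose[where g=cf]) (auto simp: continuous_on_eq_continuous_at)
        from tendsto_mult[OF cf_scaled_limit[of h] this]
        have "(\<lambda>k. cf (?s k h) ^ k * (\<Sum>j<r. cf (t + ?s k h) ^ j) - S * of_real (exp (- qf h / 2)))
            \<longlonglongrightarrow> of_real (exp (- qf h / 2)) * S - S * of_real (exp (- qf h / 2))"
          by (intro tendsto_diff tendsto_const)
        hence lim: "(\<lambda>k. norm (cf (?s k h) ^ k * (\<Sum>j<r. cf (t + ?s k h) ^ j) - S * of_real (exp (- qf h / 2)))) \<longlonglongrightarrow> 0"
          by (intro tendsto_norm_zero) (simp add: mult.commute)
        have "\<forall>\<^sub>F k in sequentially. dist (?s k h) 0 < \<delta>"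
          using h0 \<delta>(1) by (auto simp: tendsto_iff)
        hence ev: "\<forall>\<^sub>F k in sequentially. norm (cf (?s k h) ^ k * (\<Sum>j<r. cf (t + ?s k h) ^ j) - S * of_real (exp (- qf h / 2))) = ?g k h"
          using eventually_gt_at_top[of 0]
        proof eventually_elim
          case (elim k)
          hence "t + ?s k h \<in> ball t \<delta>" by (simp add: dist_norm)
          hence "?g k h = norm (cfs k (t + ?s k h) - ?G k (?s k h))"
            by (simp only: indicator_simps scaleR_one add_diff_cancel_left')
          also have "cfs k (t + ?s k h) - ?G k (?s k h)
              = cf t ^ k * (cf (?s k h) ^ k * (\<Sum>j<r. cf (t + ?s k h) ^ j) - S * of_real (exp (- qf h / 2)))"
          proof -
            have "cf (t + ?s k h) ^ k = cf t ^ k * cf (?s k h) ^ k" by (simp only: shift power_mult_distrib)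
            thus ?thesis unfolding Qs[OF elim(2)] cfs_def by (simp only: right_diff_distrib mult.assoc)
          qed
          finally show ?case by (simp only: norm_mult norm_power one power_one mult_1_left)
        qed
        from Lim_transform_eventually[OF lim ev] have "(\<lambda>k. ?g k h) \<longlonglongrightarrow> 0" .
        thus "(\<lambda>k. ?g (Suc k) h) \<longlonglongrightarrow> 0" by (rule LIMSEQ_Suc)
      qed
    qed simp_all
    hence "(\<lambda>k. LINT h|lborel. ?g (Suc k) h) \<longlonglongrightarrow> 0" by simp
    thus "(\<lambda>k. LINT h|lborel. ?g (Suc (k - 1)) h) \<longlonglongrightarrow> 0"
      by (rule filterlim_compose) (simp add: filterlim_minus_const_nat_at_top)
  qed
  thus ?thesis using \<delta> unfolding S_def by blast
qed

text \<open>Where the modulus is below 1, it stays below some \<open>\<rho> < 1\<close> nearby, and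
  geometric decay beats \<open>k^(d / 2)\<close>. Where it equals 1, \<open>cf t\<close> is an
  \<open>r\<close>-th root of unity different from 1, the geometric sum is 0, and
  \<open>cfs_near_modulus_one\<close> has no Gaussian term left.\<close>

lemma cfs_negligible_near:
  assumes t: "t \<in> fbox" "t \<noteq> 0"
  shows "\<exists>e>0. (\<lambda>k. sqrt (real k) ^ CARD('d) * (LINT z|lborel. indicator (ball t e) z * norm (cfs k z))) \<longlonglongrightarrow> 0"
proof (cases "norm (cf t) = 1")
  case False
  hence lt: "norm (cf t) < 1" using norm_cf_le[of t] by simp
  then obtain \<rho> where \<rho>: "norm (cf t) < \<rho>" "\<rho> < 1" using dense by blast
  have ic: "isCont (\<lambda>z. norm (cf z)) t"
    using continuous_cf[of UNIV] by (intro continuous_intros) (simp add: continuous_on_eq_continuous_at)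
  have "\<forall>\<^sub>F z in nhds t. norm (cf z) < \<rho>"
    using order_tendstoD(2)[OF isContD[OF ic] \<rho>(1)] \<rho>(1) by (simp add: eventually_nhds_conv_at)
  then obtain e where e: "e > 0" "\<And>z. dist z t < e \<Longrightarrow> norm (cf z) < \<rho>"
    by (auto simp: eventually_nhds_metric)
  have r0: "\<rho> \<ge> 0" using \<rho>(1) norm_ge_zero[of "cf t"] by linarith
  define V where "V = measure lborel (ball t e)"
  have iB: "integrable lborel (indicator (ball t e) :: _ \<Rightarrow> real)"
    by (rule integrable_real_indicator) (simp_all add: emeasure_bounded_finite flip: infinity_ennreal_def)
  have bnd: "indicator (ball t e) z * norm (cfs k z) \<le> indicator (ball t e) z * (real r * \<rho> ^ k)" for k z
  proof (cases "z \<in> ball t e")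
    case True
    hence "norm (cf z) \<le> \<rho>" using e(2)[of z] by (simp add: dist_commute)
    hence "norm (cfs k z) \<le> real r * \<rho> ^ k"
      by (intro order_trans[OF norm_cfs_le] mult_left_mono power_mono) auto
    thus ?thesis using True by simp
  qed simp
  have "(\<lambda>k. sqrt (real k) ^ CARD('d) * (LINT z|lborel. indicator (ball t e) z * norm (cfs k z))) \<longlonglongrightarrow> 0"
  proof (rule Lim_null_comparison)
    show "\<forall>\<^sub>F k in sequentially. norm (sqrt (real k) ^ CARD('d) * (LINT z|lborel. indicator (ball t e) z * norm (cfs k z)))
       \<le> (V * real r) * (real k ^ CARD('d) * \<rho> ^ k)"
      using eventually_ge_at_top[of 1]
    proof eventually_elim
      case (elim k)
      have "(LINT z|lborel. indicator (ball t e) z * norm (cfs k z))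
          \<le> (LINT z|lborel. indicator (ball t e) z * (real r * \<rho> ^ k))"
        using iB r0 by (intro integral_mono_AE' AE_I2 bnd integrable_mult_left) auto
      also have "\<dots> = V * (real r * \<rho> ^ k)"
        using iB by (simp add: V_def)
      finally have I: "(LINT z|lborel. indicator (ball t e) z * norm (cfs k z)) \<le> V * (real r * \<rho> ^ k)" .
      have I0: "(LINT z|lborel. indicator (ball t e) z * norm (cfs k z)) \<ge> 0"
        by (rule Bochner_Integration.integral_nonneg) auto
      have "sqrt (real k) \<le> real k"
        using elim by (intro real_le_lsqrt) (auto simp: power2_eq_square)
      hence "sqrt (real k) ^ CARD('d) \<le> real k ^ CARD('d)" by (intro power_mono) auto
      hence "sqrt (real k) ^ CARD('d) * (LINT z|lborel. indicator (ball t e) z * norm (cfs k z))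
          \<le> real k ^ CARD('d) * (V * (real r * \<rho> ^ k))"
        using I I0 by (intro mult_mono) auto
      thus ?case using I0 by (simp add: mult_ac abs_mult)
    qed
    show "(\<lambda>k. (V * real r) * (real k ^ CARD('d) * \<rho> ^ k)) \<longlonglongrightarrow> 0"
      by (rule tendsto_mult_right_zero, rule power_times_geometric_tendsto_0) (use r0 \<rho> in auto)
  qed
  thus ?thesis using e(1) by blast
next
  case True
  have "cf t \<noteq> 1" using cf_modulus_one(5)[OF True] t by auto
  hence "(\<Sum>j<r. cf t ^ j) = 0"
    using geometric_sum[of "cf t" r] cf_modulus_one(3)[OF True] by simp
  thus ?thesis using cfs_near_modulus_one[OF True] by auto
qed

text \<open>Compactness: outside a ball around 0 the box is covered by finitely many neighbourhoods
  on which \<open>cfs k\<close> is negligible. The point \<open>x\<close> enters only through the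
  unimodular factor \<open>chi x\<close>, so taking moduli under the integral makes the estimate
  uniform.\<close>

lemma local_limit:
  "\<exists>e::nat \<Rightarrow> real. e \<longlonglongrightarrow> 0 \<and> (\<forall>k>0. \<forall>x. sqrt (real k) ^ CARD('d) * err x k \<le> e k)"
proof -
  let ?c = "(2 * pi) ^ CARD('d) :: real"
  let ?s = "\<lambda>k. sqrt (real k) ^ CARD('d)"
  obtain \<delta> where \<delta>: "\<delta> > 0" "\<delta> \<le> pi" and near: "(\<lambda>k. ?s k *
      (LINT z|lborel. norm (indicator (ball 0 \<delta>) z *\<^sub>R cfs k z - of_real (real r * exp (- (real k * qf z) / 2))))) \<longlonglongrightarrow> 0"
  proof -
    have "cf 0 = 1"
      using sum_pmf_p by (simp add: cf_def scaleR_conv_of_real flip: of_real_sum)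
    thus ?thesis using cfs_near_modulus_one[of 0] that by auto
  qed
  have "\<exists>e. \<forall>t\<in>fbox - {0}. e t > 0 \<and> (\<lambda>k. ?s k * (LINT z|lborel. indicator (ball t (e t)) z * norm (cfs k z))) \<longlonglongrightarrow> 0"
    using cfs_negligible_near by (intro bchoice) blast
  then obtain \<epsilon> where \<epsilon>: "\<And>t. t \<in> fbox - {0} \<Longrightarrow> \<epsilon> t > 0"
    "\<And>t. t \<in> fbox - {0} \<Longrightarrow> (\<lambda>k. ?s k * (LINT z|lborel. indicator (ball t (\<epsilon> t)) z * norm (cfs k z))) \<longlonglongrightarrow> 0"
    by blast
  have cpt: "compact (fbox - ball 0 \<delta> :: (real^'d) set)"
    unfolding fbox_def by (intro compact_diff compact_cbox open_ball)
  have cov: "fbox - ball 0 \<delta> \<subseteq> (\<Union>t\<in>fbox - {0}. ball t (\<epsilon> t))"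
    using \<epsilon>(1) \<delta>(1) by fastforce
  obtain T where T: "T \<subseteq> fbox - {0}" "finite T" "fbox - ball 0 \<delta> \<subseteq> (\<Union>t\<in>T. ball t (\<epsilon> t))"
    by (rule compactE_image[OF cpt _ cov]) auto
  let ?E = "\<lambda>k z. of_real (real r * exp (- (real k * qf z) / 2)) :: complex"
  let ?D = "\<lambda>k z. norm (indicator (ball 0 \<delta>) z *\<^sub>R cfs k z - ?E k z)"
  let ?F = "\<lambda>k x z. indicator fbox z *\<^sub>R (cfs k z * chi x z) - ?E k z * chi x z"
  let ?R = "\<lambda>k t z. indicator (ball t (\<epsilon> t)) z * norm (cfs k z)"
  define e0 where "e0 k = ?s k * (LINT z|lborel. ?D k z)
     + (\<Sum>t\<in>T. ?s k * (LINT z|lborel. ?R k t z))" for k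
  have "e0 \<longlonglongrightarrow> 0 + (\<Sum>t\<in>T. 0)"
    unfolding e0_def[abs_def] by (intro tendsto_intros near \<epsilon>(2)) (use T in auto)
  hence e0: "e0 \<longlonglongrightarrow> 0" by simp
  have ball_sub: "ball 0 \<delta> \<subseteq> (fbox :: (real^'d) set)"
  proof
    fix z :: "real^'d" assume "z \<in> ball 0 \<delta>"
    hence "norm z < pi" using \<delta>(2) by simp
    hence "\<bar>z $ i\<bar> \<le> pi" for i using component_le_norm_cart[of z i] by simp
    thus "z \<in> fbox" by (simp add: mem_fbox abs_le_iff) (metis minus_le_iff)
  qed
  have "?s k * err x k \<le> e0 k" if k: "k > 0" for k x
  proof -
    have iE: "integrable lborel (?E k)"
      using gauss_fourier(2)[OF k] by (intro integrable_of_real integrable_mult_right)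
    have ibc: "integrable lborel (\<lambda>z. indicator (ball t e) z *\<^sub>R cfs k z)" for t :: "real^'d" and e
    proof (rule Bochner_Integration.integrable_bound)
      show "integrable lborel (\<lambda>z. real r * indicator (ball t e) z :: real)"
        by (intro integrable_mult_right integrable_real_indicator)
           (simp_all add: emeasure_bounded_finite flip: infinity_ennreal_def)
      have "norm (cfs k z) \<le> real r" for z
        using norm_cfs_le[of k z] mult_left_mono[OF power_le_one[OF norm_ge_zero norm_cf_le, of z k], of "real r"] by simp
      thus "AE z in lborel. norm (indicator (ball t e) z *\<^sub>R cfs k z) \<le> norm (real r * indicator (ball t e) z)"
        by (auto simp: indicator_def)
    qed measurable
    have iD: "integrable lborel (?D k)"
      by (intro integrable_norm Bochner_Integration.integrable_diff ibc iE)
    have iR: "integrable lborel (?R k t)" for t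
      using integrable_norm[OF ibc[of t "\<epsilon> t"]] by simp
    have iEc: "integrable lborel (\<lambda>z. ?E k z * chi x z)"
    proof (rule Bochner_Integration.integrable_bound[OF iE])
      have "(\<lambda>z. chi x z) \<in> borel_measurable borel"
        by (intro borel_measurable_continuous_onI continuous_intros)
      thus "(\<lambda>z. ?E k z * chi x z) \<in> borel_measurable lborel"
        using borel_measurable_integrable[OF iE] by simp
    qed (simp add: norm_mult)
    have "of_real (?c * (period_sum x k - real r * gauss x k))
       = of_real (?c * period_sum x k) - of_real (real r) * of_real (?c * gauss x k)"
      by (simp add: algebra_simps)
    also have "of_real (real r) * of_real (?c * gauss x k) = (LINT z|lborel. ?E k z * chi x z)"
      unfolding gauss_fourier(1)[OF k] integral_mult_right_zero[symmetric]
      by (simp add: scaleR_conv_of_real mult.assoc)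
    also have "of_real (?c * period_sum x k) - (LINT z|lborel. ?E k z * chi x z)
       = (LINT z|lborel. ?F k x z)"
      unfolding period_sum_fourier(1) by (rule Bochner_Integration.integral_diff[symmetric], rule period_sum_fourier, rule iEc)
    finally have eq: "of_real (?c * (period_sum x k - real r * gauss x k)) = \<dots>" .
    have "\<bar>?c * (period_sum x k - real r * gauss x k)\<bar>
       = norm (of_real (?c * (period_sum x k - real r * gauss x k)) :: complex)" by (simp only: norm_of_real)
    also have "\<dots> \<le> (LINT z|lborel. ?D k z + (\<Sum>t\<in>T. ?R k t z))"
      unfolding eq
    proof (rule Bochner_Integration.integral_norm_bound_integral)
      show "integrable lborel (\<lambda>z. ?D k z + (\<Sum>t\<in>T. ?R k t z))"
        by (intro Bochner_Integration.integrable_add iD Bochner_Integration.integrable_sum iR)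
      show "integrable lborel (\<lambda>z. ?F k x z)"
        by (intro Bochner_Integration.integrable_diff period_sum_fourier iEc)
      fix z :: "real^'d"
      have "?F k x z
         = (indicator fbox z *\<^sub>R cfs k z - ?E k z) * chi x z"
        by (simp add: algebra_simps)
      hence "norm (?F k x z)
         = norm (indicator fbox z *\<^sub>R cfs k z - ?E k z)"
        by (simp only: norm_mult norm_cis mult_1_right)
      also have "\<dots> \<le> ?D k z + (\<Sum>t\<in>T. ?R k t z)"
      proof -
        have R0: "(\<Sum>t\<in>T. ?R k t z) \<ge> 0" by (intro sum_nonneg) auto
        consider "z \<in> ball 0 \<delta>" | "z \<notin> fbox" "z \<notin> ball 0 \<delta>" | "z \<in> fbox - ball 0 \<delta>" by blast
        thus ?thesis
        proof cases
          case 1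
          hence "z \<in> fbox" using ball_sub by blast
          thus ?thesis using 1 R0 by simp
        next
          case 2
          thus ?thesis using R0 by simp
        next
          case 3
          then obtain t where t: "t \<in> T" "z \<in> ball t (\<epsilon> t)" using T(3) by blast
          have "norm (cfs k z) = ?R k t z" using t by simp
          also have "\<dots> \<le> (\<Sum>t\<in>T. ?R k t z)"
            using t(1) T(2) by (intro member_le_sum) auto
          finally have "norm (cfs k z) \<le> (\<Sum>t\<in>T. ?R k t z)" .
          thus ?thesis using 3 norm_triangle_ineq4[of "cfs k z" "?E k z"] by simp
        qed
      qed
      finally show "norm (?F k x z)
         \<le> ?D k z + (\<Sum>t\<in>T. ?R k t z)" .
    qed
    also have "\<dots> = (LINT z|lborel. ?D k z) + (\<Sum>t\<in>T. LINT z|lborel. ?R k t z)"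
      by (subst Bochner_Integration.integral_add[OF iD Bochner_Integration.integrable_sum[OF iR]],
          subst Bochner_Integration.integral_sum[OF iR]) (rule refl)
    finally have b: "\<bar>?c * (period_sum x k - real r * gauss x k)\<bar> \<le> \<dots>" .
    have "(1::real) \<le> 2 * pi" using pi_ge_two by simp
    hence "1 * err x k \<le> ?c * err x k"
      by (intro mult_right_mono one_le_power) auto
    also have "\<dots> = \<bar>?c * (period_sum x k - real r * gauss x k)\<bar>" by (simp add: abs_mult)
    also note b
    finally have "?s k * err x k
       \<le> ?s k * ((LINT z|lborel. ?D k z) + (\<Sum>t\<in>T. LINT z|lborel. ?R k t z))"
      by (intro mult_left_mono) auto
    also have "\<dots> = e0 k" by (simp only: e0_def distrib_left sum_distrib_left)
    finally show ?thesis .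
  qed
  thus ?thesis using e0 by blast
qed

end

section \<open>Gaussian upper bound\<close>

text \<open>Tailored to centred variables: in expectation the linear term vanishes, and a bounded
  step has a sub-Gaussian exponential moment.\<close>

lemma exp_le_add_exp_square:
  fixes y :: real
  shows "exp y \<le> y + exp (y\<^sup>2)"
proof -
  consider "y \<le> 0" | "0 \<le> y" "y \<le> 1" | "1 < y" by linarith
  thus ?thesis
  proof cases
    case 1
    \<comment> \<open>Together with \<open>1 - y \<le> exp (- y)\<close> this yields
      \<open>exp y \<le> 1 + y + y^2\<close> for negative \<open>y\<close>, where the usual bound
      for \<open>0 \<le> y \<le> 1\<close> does not apply.\<close>
    have "(1 - y) * (1 + y + y\<^sup>2) = 1 - y ^ 3" by (simp add: power2_eq_square power3_eq_cube algebra_simps)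
    also have "\<dots> \<ge> 1" using 1 by (simp add: power_le_zero_eq)
    finally have a: "1 \<le> (1 - y) * (1 + y + y\<^sup>2)" .
    have pos: "0 \<le> 1 + y + y\<^sup>2"
      using a 1 by (smt (verit) mult_nonneg_nonpos zero_le_mult_iff)
    have "1 - y \<le> exp (- y)" using exp_ge_add_one_self[of "- y"] by simp
    hence "1 \<le> exp (- y) * (1 + y + y\<^sup>2)"
      using a mult_right_mono[OF _ pos] by fastforce
    hence "exp y * 1 \<le> exp y * (exp (- y) * (1 + y + y\<^sup>2))" by (intro mult_left_mono) auto
    also have "exp y * (exp (- y) * (1 + y + y\<^sup>2)) = 1 + y + y\<^sup>2" by (simp add: exp_minus)
    finally have "exp y \<le> 1 + y + y\<^sup>2" by simp
    thus ?thesis using exp_ge_add_one_self[of "y\<^sup>2"] by linarith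
  next
    case 2
    thus ?thesis using exp_bound[of y] exp_ge_add_one_self[of "y\<^sup>2"] by linarith
  next
    case 3
    hence "y \<le> y\<^sup>2" by (simp add: power2_eq_square)
    hence "exp y \<le> exp (y\<^sup>2)" by simp
    thus ?thesis using 3 by linarith
  qed
qed

context class_S_walk begin

lemma cov_norm_nonneg: "nrm x \<ge> 0"
  unfolding cov_norm_def using inverse_cov_norm_sq[of x] by (metis real_sqrt_ge_zero zero_le_power2)

lemma gauss_nonneg: "gauss x k \<ge> 0"
  using det_cov_pos by (simp add: gauss_def)

lemma gauss_le:
  assumes "k > 0"
  shows "sqrt (real k) ^ CARD('d) * gauss x k \<le> exp (- (nrm x)\<^sup>2 / (2 * real k)) / sqrt (det Q)"
proof -
  have "(1::real) \<le> sqrt (2 * pi)" using pi_ge_two by simp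
  hence 1: "(1::real) \<le> sqrt (2 * pi) ^ CARD('d)" by (rule one_le_power)
  have "sqrt (real k) ^ CARD('d) * gauss x k = exp (- (nrm x)\<^sup>2 / (2 * real k)) / sqrt (det Q) / sqrt (2 * pi) ^ CARD('d)"
    using assms by (simp add: gauss_def real_sqrt_mult power_mult_distrib)
  also have "\<dots> \<le> exp (- (nrm x)\<^sup>2 / (2 * real k)) / sqrt (det Q) / 1"
    using 1 det_cov_pos by (intro divide_left_mono) auto
  finally show ?thesis by simp
qed

lemma tp_le_period_sum: "tp k x \<le> period_sum x k"
proof -
  have "tp (k + 0) x \<le> (\<Sum>j<r. tp (k + j) x)"
    using period_pos by (intro member_le_sum) auto
  thus ?thesis by (simp add: period_sum_def)
qed

text \<open>A single transition probability is one term of a period sum, and that sum is bounded by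
  the Gaussian plus the error of \<open>local_limit\<close>. Writing \<open>k + 1\<close> in the
  denominator includes time 0.\<close>

lemma tp_sup_bound: "\<exists>C>0. \<forall>k x. tp k x \<le> C / sqrt (real (k + 1)) ^ CARD('d)"
proof -
  obtain e where e: "e \<longlonglongrightarrow> 0" "\<And>k x. k > 0 \<Longrightarrow> sqrt (real k) ^ CARD('d) * err x k \<le> e k"
    using local_limit by blast
  obtain E where E: "\<And>k. \<bar>e k\<bar> \<le> E"
    using convergent_imp_Bseq[OF convergentI[OF e(1)]] by (auto simp: Bseq_def)
  define B where "B = E + real r / sqrt (det Q)"
  have "E \<ge> 0" using E[of 0] by linarith
  have B0: "B \<ge> 0" unfolding B_def using \<open>E \<ge> 0\<close> det_cov_pos by simp
  have b: "sqrt (real k) ^ CARD('d) * tp k x \<le> B" if k: "k > 0" for k x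
  proof -
    let ?s = "sqrt (real k) ^ CARD('d)"
    have "?s * gauss x k \<le> 1 / sqrt (det Q)"
      by (rule order_trans[OF gauss_le[OF k]]) (use det_cov_pos in \<open>auto simp: divide_right_mono\<close>)
    hence "real r * (?s * gauss x k) \<le> real r * (1 / sqrt (det Q))" by (intro mult_left_mono) auto
    moreover have "?s * tp k x \<le> ?s * period_sum x k" by (intro mult_left_mono tp_le_period_sum) auto
    moreover have "?s * period_sum x k \<le> ?s * err x k + real r * (?s * gauss x k)"
    proof -
      have "?s * period_sum x k \<le> ?s * (err x k + real r * gauss x k)"
        by (intro mult_left_mono) auto
      thus ?thesis by (simp add: algebra_simps)
    qed
    ultimately show ?thesis
      unfolding B_def using e(2)[OF k, of x] E[of k] by simp
  qed
  \<comment> \<open>The entry 1 covers \<open>k = 0\<close>, where a probability is at most 1; the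
    other entry covers positive \<open>k\<close>, for which \<open>k + 1 \<le> 2 k\<close>.\<close>
  define C where "C = max 1 (sqrt 2 ^ CARD('d) * B)"
  have "tp k x \<le> C / sqrt (real (k + 1)) ^ CARD('d)" for k x
  proof (cases "k = 0")
    case True
    thus ?thesis using pmf_le_1[of "walk_pmf p 0" x] by (simp add: C_def le_max_iff_disj del: walk_pmf.simps)
  next
    case False
    have "sqrt (real (k + 1)) ^ CARD('d) * tp k x \<le> (sqrt 2 * sqrt (real k)) ^ CARD('d) * tp k x"
      using False by (intro mult_right_mono power_mono) (auto simp flip: real_sqrt_mult)
    also have "\<dots> = sqrt 2 ^ CARD('d) * (sqrt (real k) ^ CARD('d) * tp k x)" by (simp add: power_mult_distrib)
    also have "\<dots> \<le> sqrt 2 ^ CARD('d) * B" using b[of k x] False by (intro mult_left_mono) auto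
    also have "\<dots> \<le> C" by (simp add: C_def)
    finally show ?thesis by (simp add: field_simps)
  qed
  moreover have "C > 0" by (simp add: C_def)
  ultimately show ?thesis by blast
qed

lemma exp_moment_bound:
  assumes K: "\<And>v. v \<in> set_pmf p \<Longrightarrow> \<bar>real_of_int (v $ i)\<bar> \<le> K"
  shows "(\<Sum>y\<in>supp n. tp n y * exp (s * real_of_int (y $ i))) \<le> exp (real n * (s * K)\<^sup>2)"
proof -
  have mz: "(\<Sum>v\<in>set_pmf p. pmf p v * real_of_int (v $ i)) = 0"
    using arg_cong[OF mean_zero, of "\<lambda>u. u $ i"] by simp
  have "(\<Sum>v\<in>set_pmf p. pmf p v * exp (s * real_of_int (v $ i)))
      \<le> (\<Sum>v\<in>set_pmf p. pmf p v * (s * real_of_int (v $ i) + exp ((s * K)\<^sup>2)))"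
  proof (intro sum_mono mult_left_mono)
    fix v assume v: "v \<in> set_pmf p"
    have "(s * real_of_int (v $ i))\<^sup>2 \<le> (s * K)\<^sup>2"
      unfolding power_mult_distrib using K[OF v] by (intro mult_left_mono) (auto simp: abs_le_square_iff[symmetric])
    thus "exp (s * real_of_int (v $ i)) \<le> s * real_of_int (v $ i) + exp ((s * K)\<^sup>2)"
      using exp_le_add_exp_square[of "s * real_of_int (v $ i)"] by (smt (verit) exp_le_cancel_iff)
  qed simp
  also have "\<dots> = s * (\<Sum>v\<in>set_pmf p. pmf p v * real_of_int (v $ i)) + (\<Sum>v\<in>set_pmf p. pmf p v) * exp ((s * K)\<^sup>2)"
    by (simp add: distrib_left sum.distrib sum_distrib_left sum_distrib_right mult_ac)
  finally have 1: "(\<Sum>v\<in>set_pmf p. pmf p v * exp (s * real_of_int (v $ i))) \<le> exp ((s * K)\<^sup>2)"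
    by (simp add: mz sum_pmf_p)
  have "(\<Sum>y\<in>supp n. tp n y * exp (s * real_of_int (y $ i)))
      = (\<Sum>v\<in>set_pmf p. pmf p v * exp (s * real_of_int (v $ i))) ^ n"
    using sum_walk_pmf[of p "\<lambda>y. exp (s * real_of_int (y $ i))" n] by (simp add: exp_add distrib_left)
  also have "\<dots> \<le> exp ((s * K)\<^sup>2) ^ n" by (intro power_mono 1 sum_nonneg) auto
  finally show ?thesis by (simp add: exp_of_nat_mult)
qed

text \<open>Splitting the walk at time \<open>m\<close>, one of the two pieces covers at least half of the
  displacement \<open>x $ i\<close>; that piece is exponentially tilted and the other one is bounded uniformly.\<close>

lemma tp_split_bound:
  assumes K: "\<And>v. v \<in> set_pmf p \<Longrightarrow> \<bar>real_of_int (v $ i)\<bar> \<le> K"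
    and B: "\<And>y. tp m y \<le> B" "\<And>y. tp l y \<le> B"
  shows "tp (m + l) x \<le> 2 * B * exp (real (m + l) * (s * K)\<^sup>2 - s * real_of_int (x $ i) / 2)"
proof -
  let ?EE = "exp (real (m + l) * (s * K)\<^sup>2)"
  let ?xi = "real_of_int (x $ i)"
  let ?e = "exp (- s * ?xi / 2)"
  let ?g = "\<lambda>y. exp (s * real_of_int (y $ i))"
  let ?S = "supp m" and ?S' = "supp l"
  have fin: "finite ?S" "finite ?S'" by (simp_all add: finite_set_walk_pmf)
  have B0: "B \<ge> 0" using B(1)[of 0] pmf_nonneg[of "walk_pmf p m" 0] by linarith
  have E: "exp (real n * (s * K)\<^sup>2) \<le> ?EE" if "n \<le> m + l" for n
    using that by (simp add: mult_right_mono)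
  have "tp (m + l) x = (\<Sum>y\<in>?S. tp m y * tp l (x - y))"
    unfolding walk_pmf_add by (rule pmf_conv_pmf) (rule fin)
  also have "\<dots> \<le> (\<Sum>y\<in>?S. ?e * (tp m y * ?g y * B + B * (tp l (x - y) * ?g (x - y))))"
  proof (rule sum_mono)
    fix y
    \<comment> \<open>The inequality \<open>1 \<le> exp a + exp (- a)\<close> replaces the case
      distinction on which of \<open>y\<close> and \<open>x - y\<close> covers half of the
      displacement.\<close>
    let ?a = "s * real_of_int (y $ i) - s * ?xi / 2"
    have "1 \<le> exp ?a + exp (- ?a)"
      by (smt (verit) exp_ge_zero one_le_exp_iff)
    also have "exp ?a = ?e * ?g y" by (simp flip: exp_add)
    also have "exp (- ?a) = ?e * ?g (x - y)"
      by (simp add: algebra_simps flip: exp_add)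
    finally have "tp m y * tp l (x - y) * 1 \<le> tp m y * tp l (x - y) * (?e * ?g y + ?e * ?g (x - y))"
      by (intro mult_left_mono) auto
    also have "\<dots> = ?e * (tp m y * ?g y * tp l (x - y) + tp m y * (tp l (x - y) * ?g (x - y)))"
      by (simp add: algebra_simps)
    also have "\<dots> \<le> ?e * (tp m y * ?g y * B + B * (tp l (x - y) * ?g (x - y)))"
      by (intro mult_left_mono add_mono mult_right_mono B) auto
    finally show "tp m y * tp l (x - y) \<le> ?e * (tp m y * ?g y * B + B * (tp l (x - y) * ?g (x - y)))" by simp
  qed
  also have "\<dots> = ?e * ((\<Sum>y\<in>?S. tp m y * ?g y) * B + B * (\<Sum>y\<in>?S. tp l (x - y) * ?g (x - y)))"
    by (simp only: sum_distrib_left[symmetric] sum_distrib_right[symmetric] sum.distrib)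
  also have "(\<Sum>y\<in>?S. tp l (x - y) * ?g (x - y)) = (\<Sum>z\<in>(-) x ` ?S. tp l z * ?g z)"
    by (subst sum.reindex) (auto simp: inj_on_def)
  also have "\<dots> = (\<Sum>z\<in>(-) x ` ?S \<inter> ?S'. tp l z * ?g z)"
    using fin by (intro sum.mono_neutral_right) (auto simp: pmf_eq_0_set_pmf)
  also have "?e * ((\<Sum>y\<in>?S. tp m y * ?g y) * B + B * (\<Sum>z\<in>(-) x ` ?S \<inter> ?S'. tp l z * ?g z))
    \<le> ?e * (?EE * B + B * ?EE)"
  proof (intro mult_left_mono add_mono mult_right_mono)
    show "(\<Sum>y\<in>?S. tp m y * ?g y) \<le> ?EE"
      by (rule order_trans[OF exp_moment_bound[OF K] E]) simp_all
    have "(\<Sum>z\<in>(-) x ` ?S \<inter> ?S'. tp l z * ?g z) \<le> (\<Sum>z\<in>?S'. tp l z * ?g z)"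
      using fin by (intro sum_mono2) auto
    also have "\<dots> \<le> ?EE"
      by (rule order_trans[OF exp_moment_bound[OF K] E]) simp_all
    finally show "(\<Sum>z\<in>(-) x ` ?S \<inter> ?S'. tp l z * ?g z) \<le> ?EE" .
  qed (use B0 in auto)
  also have "\<dots> = 2 * B * (?EE * exp (- (s * ?xi / 2)))" by simp
  also have "?EE * exp (- (s * ?xi / 2)) = exp (real (m + l) * (s * K)\<^sup>2 - s * ?xi / 2)"
    unfolding exp_add[symmetric] by simp
  finally show ?thesis .
qed

text \<open>The tilt is made along the largest coordinate of \<open>x\<close>, whose square controls
  \<open>nrm x ^ 2\<close> up to the factor \<open>L * CARD('d)\<close>. The sign of the tilt
  follows that coordinate, so both directions are handled at once.\<close>

lemma tp_gaussian_bound: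
  "\<exists>C>0. \<exists>c>0. \<forall>k x. tp k x \<le> C / sqrt (real (k + 1)) ^ CARD('d) * exp (- c * (nrm x)\<^sup>2 / real (k + 1))"
proof -
  obtain C where C: "C > 0" "\<And>k x. tp k x \<le> C / sqrt (real (k + 1)) ^ CARD('d)"
    using tp_sup_bound by blast
  define K where "K = 1 + (\<Sum>v\<in>set_pmf p. norm (lat_vec v))"
  have K1: "K \<ge> 1" unfolding K_def by (simp add: sum_nonneg)
  have K: "\<bar>real_of_int (v $ i)\<bar> \<le> K" if "v \<in> set_pmf p" for v i
  proof -
    have "\<bar>lat_vec v $ i\<bar> \<le> norm (lat_vec v)" by (rule component_le_norm_cart)
    also have "\<dots> \<le> (\<Sum>v\<in>set_pmf p. norm (lat_vec v))" using that by (intro member_le_sum) auto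
    finally show ?thesis by (simp add: K_def)
  qed
  obtain L where L: "L > 0" "\<And>u. norm (matrix_inv Q *v u) \<le> L * norm u"
    using bounded_linear.pos_bounded[OF matrix_vector_mul_bounded_linear[of "matrix_inv Q"]] by (auto simp: mult.commute)
  define C' where "C' = 2 * C * sqrt 2 ^ CARD('d)"
  define c where "c = 1 / (L * real CARD('d) * (16 * K\<^sup>2))"
  have "tp k x \<le> C' / sqrt (real (k + 1)) ^ CARD('d) * exp (- c * (nrm x)\<^sup>2 / real (k + 1))" for k x
  proof -
  let ?n = "real (k + 1)"
    obtain i where i: "\<And>j. \<bar>real_of_int (x $ j)\<bar> \<le> \<bar>real_of_int (x $ i)\<bar>"
    proof -
      let ?A = "range (\<lambda>j. \<bar>real_of_int (x $ j)\<bar>)"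
      have "Max ?A \<in> ?A" by (rule Max_in) auto
      then obtain i where "Max ?A = \<bar>real_of_int (x $ i)\<bar>" by (rule rangeE)
      moreover have "\<bar>real_of_int (x $ j)\<bar> \<le> Max ?A" for j by (rule Max_ge) auto
      ultimately show ?thesis using that by metis
    qed
    let ?xi = "real_of_int (x $ i)"
    have "(nrm x)\<^sup>2 \<le> norm (matrix_inv Q *v lat_vec x) * norm (lat_vec x)"
      unfolding inverse_cov_norm_sq by (rule norm_cauchy_schwarz)
    also have "\<dots> \<le> L * norm (lat_vec x) * norm (lat_vec x)" by (intro mult_right_mono L) auto
    also have "\<dots> = L * (\<Sum>j\<in>UNIV. (real_of_int (x $ j))\<^sup>2)"
      by (simp add: norm_vec_def L2_set_def sum_nonneg)
    also have "\<dots> \<le> L * (\<Sum>j\<in>(UNIV::'d set). ?xi\<^sup>2)"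
      using i L(1) by (intro mult_left_mono sum_mono) (auto simp: abs_le_square_iff[symmetric])
    finally have cn: "(nrm x)\<^sup>2 \<le> L * real CARD('d) * ?xi\<^sup>2" by simp
    have "c * (nrm x)\<^sup>2 \<le> c * (L * real CARD('d) * ?xi\<^sup>2)"
      using cn L(1) K1 by (intro mult_left_mono) (auto simp: c_def)
    also have "\<dots> = ?xi\<^sup>2 / (16 * K\<^sup>2)" using L(1) K1 by (simp add: c_def)
    finally have cc: "c * (nrm x)\<^sup>2 \<le> ?xi\<^sup>2 / (16 * K\<^sup>2)" .
    \<comment> \<open>Each half has length at least \<open>(k + 1) / 2 - 1\<close>, so the uniform
      bound at either half costs only the factor \<open>sqrt 2 ^ CARD('d)\<close>.\<close>
    define l where "l = k div 2"
    define m where "m = k - l"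
    have kml: "k = m + l" by (simp add: m_def l_def)
    define B where "B = C * sqrt 2 ^ CARD('d) / sqrt (?n) ^ CARD('d)"
    have half: "tp n y \<le> B" if "k + 1 \<le> 2 * (n + 1)" for n y
    proof -
      have "sqrt (?n) ^ CARD('d) \<le> (sqrt 2 * sqrt (real (n + 1))) ^ CARD('d)"
        using that by (intro power_mono) (auto simp flip: real_sqrt_mult)
      hence "C / sqrt (real (n + 1)) ^ CARD('d) \<le> B"
        using C(1) by (simp add: B_def field_simps power_mult_distrib)
      thus ?thesis using C(2)[of n y] by linarith
    qed
    have hl: "k + 1 \<le> 2 * (l + 1)" "k + 1 \<le> 2 * (m + 1)" by (auto simp: l_def m_def)
    \<comment> \<open>The minimiser of \<open>n (s K)^2 - s xi / 2\<close> with
      \<open>n = k + 1\<close>; the minimum is \<open>- xi^2 / (16 n K^2)\<close>, which explains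
      the constant 16 in \<open>c\<close>.\<close>
    define s where "s = ?xi / (4 * ?n * K\<^sup>2)"
    have "tp k x \<le> 2 * B * exp (real k * (s * K)\<^sup>2 - s * ?xi / 2)"
      unfolding kml by (rule tp_split_bound[OF K]) (use half hl in \<open>auto simp: kml\<close>)
    also have "\<dots> \<le> 2 * B * exp (- c * (nrm x)\<^sup>2 / ?n)"
    proof -
      have "real k * (s * K)\<^sup>2 - s * ?xi / 2 \<le> ?n * (s * K)\<^sup>2 - s * ?xi / 2"
        by (simp add: mult_right_mono)
      also have "\<dots> = - (?xi\<^sup>2 / (16 * K\<^sup>2)) / ?n"
      proof -
        have "n * (z / (4 * n * Z\<^sup>2) * Z)\<^sup>2 - z / (4 * n * Z\<^sup>2) * z / 2 = - (z\<^sup>2 / (16 * Z\<^sup>2)) / n" if "n > 0" "Z > 0" for n z Z :: real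
          using that by (simp add: power2_eq_square field_simps)
        from this[of "?n" K] show ?thesis unfolding s_def using K1 by simp
      qed
      also have "\<dots> \<le> - (c * (nrm x)\<^sup>2) / ?n"
        using cc by (intro divide_right_mono) auto
      finally have "exp (real k * (s * K)\<^sup>2 - s * ?xi / 2) \<le> exp (- c * (nrm x)\<^sup>2 / ?n)" by simp
      thus ?thesis using C(1) by (intro mult_left_mono) (auto simp: B_def)
    qed
    also have "2 * B = C' / sqrt (?n) ^ CARD('d)" by (simp add: B_def C'_def)
    finally show ?thesis .
  qed
  moreover have "C' > 0" "c > 0" using C(1) L(1) K1 by (auto simp: C'_def c_def)
  ultimately show ?thesis by blast
qed

lemma period_sum_nonneg: "period_sum x k \<ge> 0"
  unfolding period_sum_def by (intro sum_nonneg) auto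

lemma period_sum_error_gaussian:
  "\<exists>C>0. \<exists>c>0. \<forall>k>0. \<forall>x. sqrt (real k) ^ CARD('d) * err x k \<le> C * exp (- c * (nrm x)\<^sup>2 / real k)"
proof -
  obtain C c where C: "C > 0" "c > 0" "\<And>k x. tp k x \<le> C / sqrt (real (k + 1)) ^ CARD('d) * exp (- c * (nrm x)\<^sup>2 / real (k + 1))"
    using tp_gaussian_bound by blast
  \<comment> \<open>For \<open>j < r\<close> and \<open>k \<ge> 1\<close> the time
    \<open>k + j + 1\<close> is at most \<open>k (r + 1)\<close>, which costs the factor
    \<open>r + 1\<close> in the exponent; \<open>1 / 2\<close> is the rate of \<open>gauss\<close>
    itself.\<close>
  define c' where "c' = min (c / (real r + 1)) (1 / 2)"
  define C' where "C' = real r * C + real r / sqrt (det Q)"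
  have c': "c' > 0" using C(2) by (simp add: c'_def)
  have c'_le: "c' \<le> c / (real r + 1)" "c' \<le> 1 / 2"
    unfolding c'_def by (rule min.cobounded1, rule min.cobounded2)
  have "sqrt (real k) ^ CARD('d) * err x k \<le> C' * exp (- c' * (nrm x)\<^sup>2 / real k)"
    if k: "k > 0" for k x
  proof -
    let ?s = "sqrt (real k) ^ CARD('d)" and ?E = "exp (- c' * (nrm x)\<^sup>2 / real k)"
    have s0: "?s > 0" using k by simp
    have "period_sum x k \<le> (\<Sum>j<r. C / ?s * ?E)"
      unfolding period_sum_def
    proof (rule sum_mono)
      fix j assume j: "j \<in> {..<r}"
      have "tp (k + j) x \<le> C / sqrt (real (k + j + 1)) ^ CARD('d) * exp (- c * (nrm x)\<^sup>2 / real (k + j + 1))"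
        by (rule C)
      also have "\<dots> \<le> C / ?s * ?E"
      proof (intro mult_mono)
        show "C / sqrt (real (k + j + 1)) ^ CARD('d) \<le> C / ?s"
          using C(1) k by (intro divide_left_mono power_mono mult_pos_pos zero_less_power) auto
        have "real (k + j + 1) \<le> real k * (real r + 1)"
        proof -
          have "k + j + 1 \<le> k + r" using j by simp
          also have "\<dots> \<le> k * (r + 1)" using k by (simp add: algebra_simps)
          finally have "real (k + j + 1) \<le> real (k * (r + 1))" by (simp only: of_nat_le_iff)
          thus ?thesis by (simp add: algebra_simps)
        qed
        hence D: "c * (nrm x)\<^sup>2 / (real k * (real r + 1)) \<le> c * (nrm x)\<^sup>2 / real (k + j + 1)"
          using C(2) k by (intro divide_left_mono mult_pos_pos) auto
        have "c' * (nrm x)\<^sup>2 / real k \<le> c / (real r + 1) * (nrm x)\<^sup>2 / real k"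
          by (intro divide_right_mono mult_right_mono c'_le) auto
        also have "\<dots> = c * (nrm x)\<^sup>2 / (real k * (real r + 1))"
          by (simp add: mult.commute)
        also note D
        finally show "exp (- c * (nrm x)\<^sup>2 / real (k + j + 1)) \<le> ?E"
          by simp
      qed (use C(1) in auto)
      finally show "tp (k + j) x \<le> C / ?s * ?E" .
    qed
    hence "?s * period_sum x k \<le> ?s * (real r * (C / ?s * ?E))" using s0 by (intro mult_left_mono) auto
    also have "\<dots> = real r * C * ?E" using k by simp
    finally have 1: "?s * period_sum x k \<le> real r * C * ?E" .
    have "?s * gauss x k \<le> exp (- (nrm x)\<^sup>2 / (2 * real k)) / sqrt (det Q)" by (rule gauss_le[OF k])
    also have "exp (- (nrm x)\<^sup>2 / (2 * real k)) \<le> ?E"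
    proof -
      have "c' * (nrm x)\<^sup>2 / real k \<le> 1 / 2 * (nrm x)\<^sup>2 / real k"
        by (intro divide_right_mono mult_right_mono c'_le) auto
      thus ?thesis by simp
    qed
    finally have "?s * gauss x k \<le> ?E / sqrt (det Q)" using det_cov_pos by (simp add: divide_right_mono)
    hence "real r * (?s * gauss x k) \<le> real r * (?E / sqrt (det Q))" by (intro mult_left_mono) auto
    hence 2: "?s * (real r * gauss x k) \<le> real r / sqrt (det Q) * ?E" by (simp add: mult_ac)
    have "err x k \<le> period_sum x k + real r * gauss x k"
      using period_sum_nonneg[of x k] mult_nonneg_nonneg[OF of_nat_0_le_iff gauss_nonneg, of r x k] by linarith
    hence "?s * err x k \<le> ?s * (period_sum x k + real r * gauss x k)"
      using s0 by (intro mult_left_mono) auto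
    also have "\<dots> \<le> C' * ?E" using 1 2 by (simp add: C'_def algebra_simps)
    finally show ?thesis .
  qed
  moreover have "C' > 0" unfolding C'_def using C(1) period_pos det_cov_pos by (intro add_pos_pos) auto
  ultimately show ?thesis using c' by blast
qed

lemma one_minus_exp_ge_half:
  fixes t :: real
  assumes "0 \<le> t" "t \<le> 1"
  shows "t / 2 \<le> 1 - exp (- t)"
proof -
  have "exp (- t) \<le> 1 / (1 + t)"
    using exp_ge_add_one_self[of t] assms by (simp add: exp_minus divide_simps)
  also have "\<dots> \<le> 1 - t / 2" using assms by (simp add: field_simps power2_eq_square mult_left_le)
  finally show ?thesis by simp
qed

text \<open>Put \<open>t = k / (nrm x)^2\<close>. For \<open>t \<ge> \<delta>\<close> the time
  \<open>k\<close> is large with \<open>nrm x\<close> and the weight is bounded below, so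
  \<open>local_limit\<close> suffices. For \<open>t < \<delta>\<close> the Gaussian bound gives
  \<open>exp (- c / t)\<close>, which is smaller than \<open>t^(d / 2)\<close> times the
  weight.\<close>

lemma period_sum_error:
  assumes \<epsilon>: "\<epsilon> > 0"
  shows "\<exists>N>0. \<forall>x k. nrm x \<ge> N \<longrightarrow> k > 0 \<longrightarrow>
     err x k \<le> \<epsilon> * (1 - exp (- real k / (nrm x)\<^sup>2)) / nrm x ^ CARD('d)"
proof -
  obtain e where e: "e \<longlonglongrightarrow> 0" "\<And>k x. k > 0 \<Longrightarrow> sqrt (real k) ^ CARD('d) * err x k \<le> e k"
    using local_limit by blast
  obtain C c where C: "C > 0" "c > 0"
    "\<And>k x. k > 0 \<Longrightarrow> sqrt (real k) ^ CARD('d) * err x k \<le> C * exp (- c * (nrm x)\<^sup>2 / real k)"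
    using period_sum_error_gaussian by blast
  have "((\<lambda>t::real. C * exp (- c / t) / (sqrt t ^ CARD('d) * t)) \<longlongrightarrow> 0) (at_right 0)"
    using C(1,2) by real_asymp
  hence "\<forall>\<^sub>F t in at_right 0. C * exp (- c / t) / (sqrt t ^ CARD('d) * t) < \<epsilon> / 2"
    using \<epsilon> by (auto dest!: order_tendstoD(2)[of _ _ _ "\<epsilon> / 2"])
  then obtain \<delta>0 where \<delta>0: "\<delta>0 > 0" "\<And>t. 0 < t \<Longrightarrow> t < \<delta>0 \<Longrightarrow> C * exp (- c / t) / (sqrt t ^ CARD('d) * t) < \<epsilon> / 2"
    by (auto simp: eventually_at_right_field)
  define \<delta> where "\<delta> = min 1 \<delta>0"
  have \<delta>: "\<delta> > 0" "\<delta> \<le> 1" using \<delta>0 by (auto simp: \<delta>_def)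
  \<comment> \<open>The value at \<open>t = \<delta>\<close> of the bound to be reached,
    \<open>\<epsilon> (1 - exp (- t)) t^(d / 2)\<close>, which increases with
    \<open>t\<close>.\<close>
  define \<epsilon>' where "\<epsilon>' = \<epsilon> * (1 - exp (- \<delta>)) * sqrt \<delta> ^ CARD('d)"
  have "\<epsilon>' > 0" using \<epsilon> \<delta> by (simp add: \<epsilon>'_def)
  then obtain N0 where N0: "\<And>k. k \<ge> N0 \<Longrightarrow> e k < \<epsilon>'"
    using order_tendstoD(2)[OF e(1)] by (auto simp: eventually_sequentially)
  \<comment> \<open>Since \<open>k = (nrm x)^2 t\<close>, the second entry forces
    \<open>k \<ge> N0\<close> whenever \<open>t \<ge> \<delta>\<close>; the first keeps the norm
    positive.\<close>
  define N where "N = max 1 (sqrt (real N0 / \<delta>))"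
  have "err x k \<le> \<epsilon> * (1 - exp (- real k / (nrm x)\<^sup>2)) / nrm x ^ CARD('d)"
    if x: "nrm x \<ge> N" and k: "k > 0" for x k
  proof -
    let ?\<rho> = "nrm x" and ?D = "err x k"
    have \<rho>: "?\<rho> \<ge> 1" "?\<rho> \<ge> sqrt (real N0 / \<delta>)" using x by (auto simp: N_def)
    define t where "t = real k / ?\<rho>\<^sup>2"
    have t: "t > 0" using \<rho> k by (simp add: t_def)
    have kt: "real k = ?\<rho>\<^sup>2 * t" using \<rho> by (simp add: t_def)
    have sk: "sqrt (real k) ^ CARD('d) = ?\<rho> ^ CARD('d) * sqrt t ^ CARD('d)"
      using \<rho> by (simp add: kt real_sqrt_mult power_mult_distrib)
    have key: "sqrt (real k) ^ CARD('d) * ?D \<le> \<epsilon> * (1 - exp (- t)) * sqrt t ^ CARD('d)"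
    proof (cases "t < \<delta>")
      case True
      have "sqrt (real k) ^ CARD('d) * ?D \<le> C * exp (- c * ?\<rho>\<^sup>2 / real k)" by (rule C(3)[OF k])
      also have "- c * ?\<rho>\<^sup>2 / real k = - c / t" using \<rho> k by (simp add: t_def)
      also have "C * exp (- c / t) \<le> \<epsilon> / 2 * (sqrt t ^ CARD('d) * t)"
        using \<delta>0(2)[of t] t True by (simp add: \<delta>_def pos_divide_less_eq less_imp_le)
      also have "\<dots> = \<epsilon> * (t / 2) * sqrt t ^ CARD('d)" by simp
      also have "\<dots> \<le> \<epsilon> * (1 - exp (- t)) * sqrt t ^ CARD('d)"
        using t True \<delta> \<epsilon> by (intro mult_right_mono mult_left_mono one_minus_exp_ge_half) auto
      finally show ?thesis .
    next
      case False
      have "real N0 / \<delta> \<le> ?\<rho>\<^sup>2" using \<rho> \<delta> by (metis real_sqrt_le_iff real_sqrt_unique cov_norm_nonneg real_sqrt_pow2 zero_le_power2 abs_of_nonneg real_sqrt_abs)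
      hence "real N0 \<le> ?\<rho>\<^sup>2 * \<delta>" using \<delta> by (simp add: field_simps)
      also have "\<dots> \<le> real k" unfolding kt using False by (intro mult_left_mono) auto
      finally have "e k < \<epsilon>'" by (intro N0) simp
      hence "sqrt (real k) ^ CARD('d) * ?D \<le> \<epsilon>'" using e(2)[OF k, of x] by simp
      also have "\<dots> \<le> \<epsilon> * (1 - exp (- t)) * sqrt t ^ CARD('d)"
        unfolding \<epsilon>'_def using False \<epsilon> \<delta> by (intro mult_mono power_mono) auto
      finally show ?thesis .
    qed
    have "sqrt t ^ CARD('d) * (?\<rho> ^ CARD('d) * ?D) \<le> sqrt t ^ CARD('d) * (\<epsilon> * (1 - exp (- t)))"
      using key unfolding sk by (simp add: mult_ac)
    hence "?\<rho> ^ CARD('d) * ?D \<le> \<epsilon> * (1 - exp (- t))"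
      using t by (subst (asm) mult_le_cancel_left_pos) auto
    moreover have "?\<rho> ^ CARD('d) > 0" using \<rho> by simp
    ultimately show ?thesis by (simp add: t_def pos_le_divide_eq mult.commute)
  qed
  moreover have "N > 0" by (simp add: N_def)
  ultimately show ?thesis by blast
qed

end

section \<open>Bernstein functions and the subordinator\<close>

lemma one_minus_exp_le:
  fixes x s :: real
  assumes "x \<ge> 0" "s \<ge> 0"
  shows "1 - exp (- (x * s)) \<le> max 1 x * min 1 s"
proof (cases "s \<le> 1")
  case True
  have "1 - exp (- (x * s)) \<le> x * s" using exp_ge_add_one_self[of "- (x * s)"] by simp
  also have "\<dots> \<le> max 1 x * s" using assms by (intro mult_right_mono) auto
  finally show ?thesis using True by simp
next
  case False
  have "1 - exp (- (x * s)) \<le> 1" by simp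
  also have "1 \<le> max 1 x" by simp
  finally show ?thesis using False by simp
qed

locale bernstein_rep =
  fixes \<psi> :: "real \<Rightarrow> real" and a b :: real and \<nu> :: "real measure"
  assumes rep: "bernstein_representation \<psi> a b \<nu>"
    and psi_0: "\<psi> 0 = 0" and psi_1: "\<psi> 1 = 1"
begin

lemma sets_nu [measurable_cong]: "sets \<nu> = sets borel"
  using rep by (simp add: bernstein_representation_def)

lemma b_nonneg: "b \<ge> 0"
  using rep by (simp add: bernstein_representation_def)

lemma integrable_min: "integrable \<nu> (\<lambda>s. indicator {0..} s * min 1 s)"
  using rep by (simp add: bernstein_representation_def set_integrable_def)

lemma integrable_exponent:
  assumes "x \<ge> 0"
  shows "integrable \<nu> (\<lambda>s. indicator {0..} s * (1 - exp (- (x * s))))"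
proof (rule Bochner_Integration.integrable_bound)
  show "integrable \<nu> (\<lambda>s. max 1 x * (indicator {0..} s * min 1 s))"
    by (intro integrable_mult_right integrable_min)
  show "AE s in \<nu>. norm (indicator {0..} s * (1 - exp (- (x * s)))) \<le> norm (max 1 x * (indicator {0..} s * min 1 s))"
    using one_minus_exp_le[OF assms] assms by (intro AE_I2) (auto simp: indicator_def abs_mult)
qed measurable

lemma psi_eq:
  assumes "x \<ge> 0"
  shows "\<psi> x = b * x + (LINT s|\<nu>. indicator {0..} s * (1 - exp (- (x * s))))"
proof -
  have "\<psi> x = a + b * x + (LINT s|\<nu>. indicator {0..} s * (1 - exp (- (x * s))))" if "x \<ge> 0" for x
    using rep that by (simp add: bernstein_representation_def set_lebesgue_integral_def)
  from this[OF assms] this[of 0] psi_0 show ?thesis by simp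
qed

lemma psi_mono:
  assumes "0 \<le> x" "x \<le> y"
  shows "\<psi> x \<le> \<psi> y"
proof -
  have "(LINT s|\<nu>. indicator {0..} s * (1 - exp (- (x * s)))) \<le> (LINT s|\<nu>. indicator {0..} s * (1 - exp (- (y * s))))"
    using assms by (intro integral_mono integrable_exponent) (auto simp: indicator_def mult_right_mono)
  thus ?thesis using assms b_nonneg by (simp add: psi_eq mult_left_mono add_mono)
qed

text \<open>Concavity along a ray from the origin, where \<open>\<psi>\<close> vanishes; under the
  integral it is convexity of \<open>exp\<close>. It yields positivity of \<open>\<psi>\<close> on
  \<open>(0, 1]\<close> and, later, the lower half of
  \<open>\<psi> (1 - exp (- u)) \<sim> \<psi> u\<close>.\<close>

lemma psi_scale_ge:
  assumes "0 \<le> x" "0 \<le> c" "c \<le> 1"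
  shows "c * \<psi> x \<le> \<psi> (c * x)"
proof -
  have pw: "c * (1 - exp (- (x * s))) \<le> 1 - exp (- (c * x * s))" for s
  proof -
    have "exp ((1 - c) *\<^sub>R 0 + c *\<^sub>R (- (x * s))) \<le> (1 - c) * exp 0 + c * exp (- (x * s))"
      using assms by (intro convex_onD[OF exp_convex]) auto
    thus ?thesis by (simp add: algebra_simps)
  qed
  have "c * (LINT s|\<nu>. indicator {0..} s * (1 - exp (- (x * s)))) = (LINT s|\<nu>. c * (indicator {0..} s * (1 - exp (- (x * s)))))"
    by simp
  also have "\<dots> \<le> (LINT s|\<nu>. indicator {0..} s * (1 - exp (- (c * x * s))))"
    using assms pw by (intro integral_mono integrable_mult_right integrable_exponent) (auto simp: indicator_def)
  finally show ?thesis using assms by (simp add: psi_eq algebra_simps)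
qed

lemma psi_pos: "0 < x \<Longrightarrow> x \<le> 1 \<Longrightarrow> 0 < \<psi> x"
  using psi_scale_ge[of 1 x] psi_1 by simp

lemma psi_le_1: "0 \<le> x \<Longrightarrow> x \<le> 1 \<Longrightarrow> \<psi> x \<le> 1"
  using psi_mono[of x 1] psi_1 by simp

text \<open>Expanding \<open>exp (z t)\<close> under the integral, the terms from index 1 on add up
  to \<open>exp (- (1 - z) t) - exp (- t)\<close>, whose integral is
  \<open>\<psi> 1 - \<psi> (1 - z)\<close> up to the drift. The drift \<open>b\<close> contributes
  only to the coefficient of index 1.\<close>

lemma coeff_generating_function:
  assumes z: "0 \<le> z" "z \<le> 1"
  shows "(\<lambda>k. bernstein_coeff b \<nu> (Suc k) * z ^ Suc k) sums (1 - \<psi> (1 - z))"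
proof -
  define f where "f k t = indicator {0..} t * ((z * t) ^ Suc k / fact (Suc k) * exp (- t))" for k and t :: real
  have f_meas [measurable]: "f k \<in> borel_measurable \<nu>" for k
    unfolding f_def[abs_def] by measurable
  have f_nonneg: "f k t \<ge> 0" for k t
    using z by (auto simp: f_def indicator_def)
  \<comment> \<open>Written as a difference of two exponent integrands, \<open>F\<close> is
    integrable by \<open>integrable_exponent\<close>; being the sum of the nonnegative
    \<open>f k\<close>, it dominates all partial sums.\<close>
  define F where "F t = indicator {0..} t * (1 - exp (- (1 * t))) - indicator {0..} t * (1 - exp (- ((1 - z) * t)))" for t :: real
  have F_int: "integrable \<nu> F"
    unfolding F_def[abs_def] using z by (intro Bochner_Integration.integrable_diff integrable_exponent) auto
  have f_sums: "(\<lambda>k. f k t) sums F t" for t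
  proof (cases "t \<ge> 0")
    case True
    have "(\<lambda>k. (z * t) ^ k / fact k) sums exp (z * t)"
      using exp_converges[of "z * t"] by (simp add: divide_inverse mult.commute)
    hence "(\<lambda>k. (z * t) ^ Suc k / fact (Suc k)) sums (exp (z * t) - 1)"
      using sums_split_initial_segment[of "\<lambda>k. (z * t) ^ k / fact k" _ 1] by fastforce
    hence "(\<lambda>k. (z * t) ^ Suc k / fact (Suc k) * exp (- t)) sums ((exp (z * t) - 1) * exp (- t))"
      by (rule sums_mult2)
    moreover have "(exp (z * t) - 1) * exp (- t) = F t"
      using True by (simp add: F_def algebra_simps flip: exp_add)
    ultimately show ?thesis using True by (simp add: f_def)
  next
    case False
    thus ?thesis by (simp add: f_def F_def)
  qed
  have f_le: "sum (\<lambda>k. f k t) A \<le> F t" if "finite A" for A t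
    using sum_le_suminf[OF sums_summable[OF f_sums] that] f_nonneg sums_unique[OF f_sums] by metis
  have f_int: "integrable \<nu> (f k)" for k
  proof (rule Bochner_Integration.integrable_bound[OF F_int f_meas])
    show "AE t in \<nu>. norm (f k t) \<le> norm (F t)"
      using f_le[of "{k}"] f_nonneg by (intro AE_I2) (auto intro: order_trans[OF _ abs_ge_self])
  qed
  have "(\<lambda>k. LINT t|\<nu>. f k t) sums (LINT t|\<nu>. (\<Sum>k. f k t))"
  proof (rule sums_integral)
    show "AE t in \<nu>. summable (\<lambda>k. norm (f k t))"
      using f_nonneg sums_summable[OF f_sums] by (intro AE_I2) simp
    show "summable (\<lambda>k. LINT t|\<nu>. norm (f k t))"
    proof (rule summableI_nonneg_bounded)
      fix n
      have "(\<Sum>k<n. LINT t|\<nu>. norm (f k t)) = (LINT t|\<nu>. (\<Sum>k<n. f k t))"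
        using f_nonneg f_int by (subst Bochner_Integration.integral_sum) auto
      also have "\<dots> \<le> (LINT t|\<nu>. F t)"
        by (intro integral_mono Bochner_Integration.integrable_sum f_int F_int f_le) auto
      finally show "(\<Sum>k<n. LINT t|\<nu>. norm (f k t)) \<le> (LINT t|\<nu>. F t)" .
    qed auto
  qed (rule f_int)
  moreover have "(LINT t|\<nu>. (\<Sum>k. f k t)) = (LINT t|\<nu>. F t)"
    using sums_unique[OF f_sums] by simp
  moreover have "(LINT t|\<nu>. F t) = (\<psi> 1 - b * 1) - (\<psi> (1 - z) - b * (1 - z))"
    unfolding F_def using z
    by (subst Bochner_Integration.integral_diff[OF integrable_exponent integrable_exponent]) (auto simp: psi_eq)
  ultimately have 1: "(\<lambda>k. LINT t|\<nu>. f k t) sums (1 - \<psi> (1 - z) - b * z)"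
    by (simp add: psi_1 algebra_simps)
  have 2: "(\<lambda>k. if k = 0 then b * z else 0) sums (b * z)"
    using sums_single[of 0 "\<lambda>_. b * z"] by simp
  have "bernstein_coeff b \<nu> (Suc k) * z ^ Suc k = (LINT t|\<nu>. f k t) + (if k = 0 then b * z else 0)" for k
  proof -
    have "(LINT t|\<nu>. f k t) = (LINT t|\<nu>. (z ^ Suc k / fact (Suc k)) * (indicator {0..} t * (t ^ Suc k * exp (- t))))"
      unfolding f_def by (intro Bochner_Integration.integral_cong) (auto simp: power_mult_distrib simp del: power_Suc fact_Suc)
    also have "\<dots> = z ^ Suc k / fact (Suc k) * (LINT t:{0..}|\<nu>. t ^ Suc k * exp (- t))"
      unfolding set_lebesgue_integral_def by simp
    finally show ?thesis
      by (simp add: bernstein_coeff_def algebra_simps del: fact_Suc)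
  qed
  with sums_add[OF 1 2] show ?thesis by simp
qed

end

section \<open>Laws of partial sums and of the subordinate walk\<close>

lemma measurable_count_space_binop:
  fixes f :: "'a::countable \<Rightarrow> 'b::countable \<Rightarrow> 'c"
  assumes "g \<in> measurable M (count_space UNIV)" "h \<in> measurable M (count_space UNIV)"
  shows "(\<lambda>x. f (g x) (h x)) \<in> measurable M (count_space UNIV)"
  by (rule measurable_compose_countable[OF _ assms(1)])
     (rule measurable_compose[OF assms(2)], simp)

lemma measurable_partial_sum:
  fixes X :: "nat \<Rightarrow> 'w \<Rightarrow> 'a::{countable, comm_monoid_add}"
  assumes "\<And>i. i < n \<Longrightarrow> X i \<in> measurable M (count_space UNIV)"
  shows "partial_sum X n \<in> measurable M (count_space UNIV)"
  using assms
proof (induction n)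
  case 0
  show ?case by (simp add: partial_sum_def[abs_def])
next
  case (Suc n)
  have "partial_sum X (Suc n) = (\<lambda>s. partial_sum X n s + X n s)"
    by (simp add: partial_sum_def[abs_def])
  thus ?case using measurable_count_space_binop[of "partial_sum X n" M "X n" "(+)"] Suc by simp
qed

lemma partial_sum_in_generated_events:
  fixes Y :: "nat \<Rightarrow> 'w \<Rightarrow> 'a::{countable, comm_monoid_add}"
  shows "{s \<in> space M. partial_sum Y n s = y} \<in> generated_events M Y"
proof -
  let ?P = "\<Pi>\<^sub>M i\<in>(UNIV::nat set). (count_space UNIV :: 'a measure)"
  have "partial_sum (\<lambda>i g. g i) n \<in> measurable ?P (count_space UNIV)"
    by (rule measurable_partial_sum) (rule measurable_component_singleton, simp)
  hence "partial_sum (\<lambda>i g. g i) n -` {y} \<inter> space ?P \<in> sets ?P"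
    by (rule measurable_sets) simp
  from in_vimage_algebra[OF this, of "\<lambda>s i. Y i s" "space M"] show ?thesis
    unfolding generated_events_def
    by (rule back_subst[where P="\<lambda>A. A \<in> _"]) (auto simp: space_PiM partial_sum_def)
qed

lemma component_in_generated_events:
  fixes Y :: "nat \<Rightarrow> 'w \<Rightarrow> 'a"
  shows "{s \<in> space M. Y n s = y} \<in> generated_events M Y"
proof -
  let ?P = "\<Pi>\<^sub>M i\<in>(UNIV::nat set). (count_space UNIV :: 'a measure)"
  have "(\<lambda>g. g n) \<in> measurable ?P (count_space UNIV)"
    by (rule measurable_component_singleton) simp
  hence "(\<lambda>g. g n) -` {y} \<inter> space ?P \<in> sets ?P"
    by (rule measurable_sets) simp
  from in_vimage_algebra[OF this, of "\<lambda>s i. Y i s" "space M"] show ?thesis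
    unfolding generated_events_def
    by (rule back_subst[where P="\<lambda>A. A \<in> _"]) (auto simp: space_PiM)
qed

context prob_space begin

lemma expectation_sums:
  fixes Y :: "'a \<Rightarrow> nat" and f :: "nat \<Rightarrow> real"
  assumes [measurable]: "Y \<in> measurable M (count_space UNIV)" and B: "\<And>k. \<bar>f k\<bar> \<le> B"
  shows "(\<lambda>k. prob {s \<in> space M. Y s = k} * f k) sums expectation (\<lambda>s. f (Y s))"
proof -
  let ?A = "\<lambda>k. {s \<in> space M. Y s = k}"
  have [measurable]: "?A k \<in> events" for k by measurable
  let ?g = "\<lambda>k s. f k * indicator (?A k) s"
  have int: "integrable M (?g k)" for k by (intro integrable_mult_right integrable_real_indicator) (auto simp: less_top[symmetric])
  have pw: "(\<lambda>k. h k * indicator (?A k) s) sums h (Y s)" if "s \<in> space M" for s and h :: "nat \<Rightarrow> real"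
  proof -
    have "(\<lambda>k. h k * indicator (?A k) s) = (\<lambda>k. if k = Y s then h k else 0)"
      using that by (auto simp: fun_eq_iff indicator_def)
    thus ?thesis using sums_single[of "Y s" h] by simp
  qed
  have sumP: "summable (\<lambda>k. prob (?A k))"
    by (rule sums_summable[OF finite_measure_UNION]) (auto simp: disjoint_family_on_def)
  have "(\<lambda>k. expectation (?g k)) sums expectation (\<lambda>s. \<Sum>k. ?g k s)"
  proof (rule sums_integral[OF int])
    show "AE s in M. summable (\<lambda>k. norm (?g k s))"
      using sums_summable[OF pw[of _ "\<lambda>k. \<bar>f k\<bar>"]] by (intro AE_I2) (simp add: abs_mult)
    show "summable (\<lambda>k. expectation (\<lambda>s. norm (?g k s)))"
    proof (rule summable_comparison_test'[OF summable_mult[OF sumP, of B]])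
      fix k
      have "norm (expectation (\<lambda>s. norm (?g k s))) = \<bar>f k\<bar> * prob (?A k)"
        by (simp add: abs_mult)
      thus "norm (expectation (\<lambda>s. norm (?g k s))) \<le> B * prob (?A k)"
        using B by (simp add: mult_right_mono)
    qed
  qed
  moreover have "expectation (\<lambda>s. \<Sum>k. ?g k s) = expectation (\<lambda>s. f (Y s))"
    using sums_unique[OF pw] by (intro Bochner_Integration.integral_cong) auto
  ultimately show ?thesis by (simp add: mult.commute[of "f _"])
qed

lemma prob_partial_sum_iid:
  fixes p :: "'b::{countable, ab_group_add} pmf"
  assumes iid: "iid_steps M p X" and fin: "finite (set_pmf p)"
  shows "prob {s \<in> space M. partial_sum X k s = x} = pmf (walk_pmf p k) x"
proof (induction k arbitrary: x)
  case 0
  show ?case by (auto simp: partial_sum_def pmf_return prob_space indicator_def)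
next
  case (Suc k)
  have indep: "indep_vars (\<lambda>_. count_space UNIV) X UNIV" and dist: "\<And>i. distr M (count_space UNIV) (X i) = measure_pmf p"
    using iid by (auto simp: iid_steps_def)
  have rv[measurable]: "X i \<in> measurable M (count_space UNIV)" for i
    using indep by (auto simp: indep_vars_def)
  have ps[measurable]: "partial_sum X n \<in> measurable M (count_space UNIV)" for n
    by (rule measurable_partial_sum) (rule rv)
  have pX: "prob {s \<in> space M. X i s = v} = pmf p v" for i v
  proof -
    have "prob {s \<in> space M. X i s = v} = measure (distr M (count_space UNIV) (X i)) {v}"
      by (subst measure_distr) (auto simp: vimage_def Int_def conj_commute)
    thus ?thesis by (simp add: dist measure_pmf_single)
  qed
  have "AE v in distr M (count_space UNIV) (X k). v \<in> set_pmf p"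
    unfolding dist by (simp add: AE_measure_pmf)
  hence AEX: "AE s in M. X k s \<in> set_pmf p"
    by (subst (asm) AE_distr_iff) auto
  have ind: "prob {s \<in> space M. X k s = v \<and> partial_sum X k s = y} = pmf p v * pmf (walk_pmf p k) y" for v y
  proof -
    \<comment> \<open>The new step and the current position depend on the disjoint index sets
      \<open>{k}\<close> and \<open>{..<k}\<close>.\<close>
    have "indep_var (PiM {k} (\<lambda>_. count_space UNIV)) (\<lambda>s. restrict (\<lambda>i. X i s) {k})
       (PiM {..<k} (\<lambda>_. count_space UNIV)) (\<lambda>s. restrict (\<lambda>i. X i s) {..<k})"
      by (rule indep_var_restrict[OF indep]) auto
    hence "indep_var (count_space UNIV) ((\<lambda>g. g k) \<circ> (\<lambda>s. restrict (\<lambda>i. X i s) {k}))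
       (count_space UNIV) (partial_sum (\<lambda>i g. g i) k \<circ> (\<lambda>s. restrict (\<lambda>i. X i s) {..<k}))"
      by (rule indep_var_compose)
         (rule measurable_component_singleton, simp, rule measurable_partial_sum, rule measurable_component_singleton, simp)
    moreover have "(\<lambda>g. g k) \<circ> (\<lambda>s. restrict (\<lambda>i. X i s) {k}) = X k" by auto
    moreover have "partial_sum (\<lambda>i g. g i) k \<circ> (\<lambda>s. restrict (\<lambda>i. X i s) {..<k}) = partial_sum X k"
      by (auto simp: partial_sum_def)
    ultimately have "indep_var (count_space UNIV) (X k) (count_space UNIV) (partial_sum X k)" by simp
    from indep_varD[OF this, of "{v}" "{y}"]
    have "prob ((\<lambda>s. (X k s, partial_sum X k s)) -` ({v} \<times> {y}) \<inter> space M) = prob (X k -` {v} \<inter> space M) * prob (partial_sum X k -` {y} \<inter> space M)"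
      by simp
    moreover have "(\<lambda>s. (X k s, partial_sum X k s)) -` ({v} \<times> {y}) \<inter> space M = {s \<in> space M. X k s = v \<and> partial_sum X k s = y}"
      "X k -` {v} \<inter> space M = {s \<in> space M. X k s = v}" "partial_sum X k -` {y} \<inter> space M = {s \<in> space M. partial_sum X k s = y}"
      by auto
    ultimately show ?thesis using pX Suc.IH by simp
  qed
  have "prob {s \<in> space M. partial_sum X (Suc k) s = x}
      = prob (\<Union>v\<in>set_pmf p. {s \<in> space M. X k s = v \<and> partial_sum X k s = x - v})"
  proof (rule measure_eq_AE)
    show "AE s in M. (s \<in> {s \<in> space M. partial_sum X (Suc k) s = x}) =
       (s \<in> (\<Union>v\<in>set_pmf p. {s \<in> space M. X k s = v \<and> partial_sum X k s = x - v}))"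
      using AEX by eventually_elim (auto simp: partial_sum_def algebra_simps)
    show "{s \<in> space M. partial_sum X (Suc k) s = x} \<in> events" by measurable
    show "(\<Union>v\<in>set_pmf p. {s \<in> space M. X k s = v \<and> partial_sum X k s = x - v}) \<in> events"
      using fin by (intro sets.finite_UN) auto
  qed
  also have "\<dots> = (\<Sum>v\<in>set_pmf p. prob {s \<in> space M. X k s = v \<and> partial_sum X k s = x - v})"
    using fin by (intro finite_measure_finite_Union) (auto simp: disjoint_family_on_def)
  also have "\<dots> = pmf (walk_pmf p (Suc k)) x"
    unfolding ind by (simp add: pmf_conv_pmf[OF fin])
  finally show ?case .
qed

lemma subordinate_transition_expectation:
  fixes p :: "(int ^ 'd::finite) pmf"
  assumes iid: "iid_steps M p X" and fin: "finite (set_pmf p)"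
    and indep: "independent_processes M R (partial_sum X)"
    and R: "\<And>i. R i \<in> measurable M (count_space UNIV)"
  shows "subordinate_transition M X R x n = expectation (\<lambda>s. pmf (walk_pmf p (partial_sum R n s)) x)"
proof -
  let ?T = "\<lambda>k. {s \<in> space M. partial_sum R n s = k}"
  have rv[measurable]: "X i \<in> measurable M (count_space UNIV)" for i
    using iid by (auto simp: iid_steps_def indep_vars_def)
  have ps[measurable]: "partial_sum X n \<in> measurable M (count_space UNIV)" for n
    by (rule measurable_partial_sum) (rule rv)
  have pr[measurable]: "partial_sum R n \<in> measurable M (count_space UNIV)" for n
    by (rule measurable_partial_sum) (rule R)
  let ?A = "\<lambda>k. {s \<in> space M. partial_sum R n s = k \<and> partial_sum X k s = x}"
  have "prob (?A k) = prob (?T k) * pmf (walk_pmf p k) x" for k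
  proof -
    \<comment> \<open>The second process is the walk itself and not its steps, so its position at
      the fixed time \<open>k\<close> is a coordinate event.\<close>
    have "prob ((?T k) \<inter> {s \<in> space M. partial_sum X k s = x})
       = prob (?T k) * prob {s \<in> space M. partial_sum X k s = x}"
      using indep unfolding independent_processes_def
      by (rule indep_setD) (rule partial_sum_in_generated_events, rule component_in_generated_events)
    moreover have "(?T k) \<inter> {s \<in> space M. partial_sum X k s = x} = ?A k" by auto
    ultimately show ?thesis using prob_partial_sum_iid[OF iid fin] by simp
  qed
  moreover have "(\<lambda>k. prob (?A k)) sums prob (\<Union>k. ?A k)"
    by (rule finite_measure_UNION) (auto simp: disjoint_family_on_def)
  moreover have "(\<Union>k. ?A k) = {s \<in> space M. subordinate_walk X R n s = x}"
    by (auto simp: subordinate_walk_def)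
  moreover have "(\<lambda>k. prob (?T k) * pmf (walk_pmf p k) x) sums expectation (\<lambda>s. pmf (walk_pmf p (partial_sum R n s)) x)"
    by (rule expectation_sums[OF pr, of _ 1]) (simp add: pmf_le_1)
  ultimately show ?thesis
    unfolding subordinate_transition_def by (simp add: sums_unique2)
qed

end

lemma lat_conv_sum_pmf:
  fixes q :: "nat \<Rightarrow> (int ^ 'd::finite) pmf"
  assumes fin: "\<And>j. finite (set_pmf (q j))"
  shows "lat_conv (\<lambda>y. \<Sum>j<m. pmf (q j) y) f x = (\<Sum>j<m. \<Sum>u\<in>set_pmf (q j). pmf (q j) u * f (x - u))"
proof -
  let ?U = "\<Union>j<m. set_pmf (q j)"
  have finU: "finite ?U" using fin by auto
  have "lat_conv (\<lambda>y. \<Sum>j<m. pmf (q j) y) f x = (\<Sum>\<^sub>\<infinity>y\<in>?U. (\<Sum>j<m. pmf (q j) y) * f (x - y))"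
    unfolding lat_conv_def by (rule infsum_cong_neutral) (auto simp: pmf_eq_0_set_pmf intro!: sum.neutral)
  also have "\<dots> = (\<Sum>y\<in>?U. \<Sum>j<m. pmf (q j) y * f (x - y))"
    using finU by (simp add: sum_distrib_right)
  also have "\<dots> = (\<Sum>j<m. \<Sum>y\<in>?U. pmf (q j) y * f (x - y))"
    by (rule sum.swap)
  also have "\<dots> = (\<Sum>j<m. \<Sum>u\<in>set_pmf (q j). pmf (q j) u * f (x - u))"
    using finU by (intro sum.cong refl sum.mono_neutral_right) (auto simp: pmf_eq_0_set_pmf)
  finally show ?thesis .
qed

lemma regularly_varying_ratio:
  assumes "regularly_varying_at_zero \<psi> \<beta>" and l: "l > 0"
  shows "((\<lambda>y. \<psi> (l * y) / \<psi> y) \<longlongrightarrow> l powr \<beta>) (at_right 0)"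
proof -
  obtain L where L: "slowly_varying L" "\<forall>\<^sub>F x in at_right 0. \<psi> x = x powr \<beta> * L (1 / x)"
    using assms by (auto simp: regularly_varying_at_zero_def)
  have f: "filterlim (\<lambda>y::real. l * y) (at_right 0) (at_right 0)" using l by real_asymp
  have g: "filterlim (\<lambda>y::real. 1 / y) at_top (at_right 0)" by real_asymp
  \<comment> \<open>\<open>\<psi> (l * y)\<close> evaluates \<open>L\<close> at
    \<open>1 / (l y) = (1 / l) (1 / y)\<close>; slow variation is therefore used with the factor
    \<open>1 / l\<close>.\<close>
  have "((\<lambda>z. L (1 / l * z) / L z) \<longlongrightarrow> 1) at_top"
    using L(1) l unfolding slowly_varying_def by (metis zero_less_divide_1_iff)
  from tendsto_mult[OF tendsto_const[of "l powr \<beta>"] filterlim_compose[OF this g]]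
  have "((\<lambda>y. l powr \<beta> * (L (1 / l * (1 / y)) / L (1 / y))) \<longlongrightarrow> l powr \<beta>) (at_right 0)" by simp
  moreover have "\<forall>\<^sub>F y in at_right 0. l powr \<beta> * (L (1 / l * (1 / y)) / L (1 / y)) = \<psi> (l * y) / \<psi> y"
    using L(2) filterlim_iff[THEN iffD1, OF f, rule_format, OF L(2)] eventually_at_right_less[of 0]
  proof eventually_elim
    case (elim y)
    thus ?case using l by (simp add: powr_mult)
  qed
  ultimately show ?thesis by (rule Lim_transform_eventually)
qed

section \<open>The Laplace transform of the subordinator and its asymptotics\<close>

locale subordinator = bernstein_rep \<psi> a b \<nu> + prob_space M
  for \<psi> :: "real \<Rightarrow> real" and a b and \<nu> :: "real measure" and M :: "'w measure" +
  fixes R :: "nat \<Rightarrow> 'w \<Rightarrow> nat"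
  assumes steps: "iid_subordinator_steps M b \<nu> R"
begin

lemma R_meas [measurable]: "R i \<in> measurable M (count_space UNIV)"
  using steps by (auto simp: iid_subordinator_steps_def indep_vars_def)

lemma tau_meas [measurable]: "partial_sum R n \<in> measurable M (count_space UNIV)"
  by (rule measurable_partial_sum) (rule R_meas)

text \<open>Only the probabilities of positive values are prescribed. At \<open>z = 1\<close> the
  generating function must equal 1, and \<open>\<psi> 0 = 0\<close> then forces the mass at 0 to
  vanish.\<close>

lemma expectation_power_step:
  assumes z: "0 \<le> z" "z \<le> 1"
  shows "expectation (\<lambda>s. z ^ R i s) = 1 - \<psi> (1 - z)"
proof -
  let ?p = "\<lambda>k. prob {s \<in> space M. R i s = k}"
  have pk: "?p (Suc k) = bernstein_coeff b \<nu> (Suc k)" for k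
    using steps by (simp add: iid_subordinator_steps_def)
  have E: "expectation (\<lambda>s. z ^ R i s) = ?p 0 + (1 - \<psi> (1 - z))" if z: "0 \<le> z" "z \<le> 1" for z
  proof -
    have "(\<lambda>k. ?p k * z ^ k) sums expectation (\<lambda>s. z ^ R i s)"
      by (rule expectation_sums[OF R_meas, of _ 1]) (use z in \<open>auto simp: power_le_one abs_le_iff intro: order_trans[of _ 0]\<close>)
    hence "(\<lambda>k. ?p (Suc k) * z ^ Suc k) sums (expectation (\<lambda>s. z ^ R i s) - ?p 0)"
      using sums_split_initial_segment[of "\<lambda>k. ?p k * z ^ k" _ 1] by fastforce
    thus ?thesis using coeff_generating_function[OF z] sums_unique2 unfolding pk by fastforce
  qed
  have "?p 0 = 0" using E[of 1] psi_0 by (simp add: prob_space)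
  thus ?thesis using E[OF z] by simp
qed

lemma expectation_power_tau:
  assumes z: "0 \<le> z" "z \<le> 1"
  shows "expectation (\<lambda>s. z ^ partial_sum R n s) = (1 - \<psi> (1 - z)) ^ n"
proof -
  have "indep_vars (\<lambda>_. count_space UNIV) R UNIV" using steps by (simp add: iid_subordinator_steps_def)
  hence "indep_vars (\<lambda>_. borel) (\<lambda>i s. z ^ R i s) UNIV"
    by (rule indep_vars_compose2[where Y="\<lambda>i k. z ^ k"]) simp
  hence ind: "indep_vars (\<lambda>_. borel) (\<lambda>i s. z ^ R i s) {..<n}"
    by (rule indep_vars_subset) simp
  have int: "integrable M (\<lambda>s. z ^ R i s)" for i
    by (rule integrable_const_bound[of _ 1]) (use z in \<open>auto intro!: power_le_one\<close>)
  have "expectation (\<lambda>s. z ^ partial_sum R n s) = expectation (\<lambda>s. \<Prod>i<n. z ^ R i s)"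
    by (simp add: partial_sum_def power_sum)
  also have "\<dots> = (\<Prod>i<n. expectation (\<lambda>s. z ^ R i s))"
    by (rule indep_vars_lebesgue_integral[OF _ ind]) (auto intro: int)
  also have "\<dots> = (1 - \<psi> (1 - z)) ^ n" by (simp add: expectation_power_step[OF z])
  finally show ?thesis .
qed

text \<open>\<open>0 ^ partial_sum R n s\<close> is the indicator of the event that the sum is 0,
  and its expectation is \<open>(1 - \<psi> 1) ^ n = 0\<close>. Positivity is needed because
  \<open>period_sum_error\<close> speaks of positive times.\<close>

lemma AE_tau_pos:
  assumes "n > 0"
  shows "AE s in M. partial_sum R n s > 0"
proof -
  have int: "integrable M (\<lambda>s. (0::real) ^ partial_sum R n s)"
    by (rule integrable_const_bound[of _ 1]) (auto simp: power_0_left)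
  have "expectation (\<lambda>s. (0::real) ^ partial_sum R n s) = 0"
    using expectation_power_tau[of 0 n] assms psi_1 by simp
  hence "AE s in M. (0::real) ^ partial_sum R n s = 0"
    using integral_nonneg_eq_0_iff_AE[OF int] by simp
  thus ?thesis by eventually_elim (auto simp: power_0_left split: if_splits)
qed

text \<open>The random point of \<open>[0, 1]\<close> at which \<open>mix_kernel\<close> is
  evaluated; \<open>y\<close> will be the inverse square of the norm of \<open>x\<close>.\<close>

definition lw :: "real \<Rightarrow> nat \<Rightarrow> 'w \<Rightarrow> real" where
  "lw y n s = exp (- (y * real (partial_sum R n s)))"

lemma lw_measurable [measurable]: "lw y n \<in> borel_measurable M"
  unfolding lw_def[abs_def] by measurable

lemma lw_range: "y \<ge> 0 \<Longrightarrow> lw y n s \<in> {0..1}"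
  by (simp add: lw_def)

lemma integrable_lw: "y \<ge> 0 \<Longrightarrow> integrable M (\<lambda>s. 1 - lw y n s)"
  by (rule integrable_const_bound[of _ 1]) (auto simp: lw_def)

lemma eventually_scale_pos:
  assumes "filterlim y (at_right 0) sequentially" "\<forall>\<^sub>F k in sequentially. n k > 0"
  shows "\<forall>\<^sub>F k in sequentially. real (n k) * \<psi> (y k) > 0"
proof -
  have "\<forall>\<^sub>F z in at_right 0. 0 < z \<and> z \<le> (1::real)"
    using eventually_at_right_real[of 0 1] by (auto elim!: eventually_mono)
  hence "\<forall>\<^sub>F k in sequentially. 0 < y k \<and> y k \<le> 1" using assms(1) by (auto simp: filterlim_iff)
  with assms(2) show ?thesis by eventually_elim (simp add: psi_pos)
qed

text \<open>Let \<open>q = \<psi> (1 - exp (- m y))\<close>. Monotonicity and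
  \<open>psi_scale_ge\<close> enclose \<open>q\<close> between
  \<open>(1 - exp (- u)) / u * \<psi> u\<close> and \<open>\<psi> u\<close> for
  \<open>u = m y\<close>, and regular variation gives \<open>q / \<psi> y\<close> the limit
  \<open>m powr \<beta>\<close>. Hence \<open>n q\<close> tends to 0, and
  \<open>1 - (1 - q)^n\<close> is enclosed between \<open>1 - exp (- n q)\<close> and
  \<open>n q\<close>, the latter by Bernoulli's inequality.\<close>

lemma laplace_asymptotics:
  fixes y :: "nat \<Rightarrow> real" and n :: "nat \<Rightarrow> nat"
  assumes rv: "regularly_varying_at_zero \<psi> \<beta>" and \<beta>: "\<beta> > 0"
    and y: "filterlim y (at_right 0) sequentially" and n: "\<forall>\<^sub>F k in sequentially. n k > 0"
    and small: "(\<lambda>k. real (n k) * \<psi> (y k)) \<longlonglongrightarrow> 0"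
  shows "(\<lambda>k. (1 - (1 - \<psi> (1 - exp (- (real m * y k)))) ^ n k) / (real (n k) * \<psi> (y k))) \<longlonglongrightarrow> real m powr \<beta>"
proof (cases "m = 0")
  case True
  thus ?thesis by (simp add: psi_0)
next
  case False
  hence m: "real m > 0" by simp
  let ?f = "\<lambda>t::real. (1 - exp (- t)) / t"
  define q where "q k = \<psi> (1 - exp (- (real m * y k)))" for k
  have ev: "\<forall>\<^sub>F k in sequentially. 0 < y k \<and> y k < 1 / real m \<and> y k \<le> 1"
  proof -
    have "\<forall>\<^sub>F z in at_right 0. 0 < z \<and> z < 1 / real m \<and> z \<le> 1"
    proof -
      have "1 / real m \<le> 1" using m by simp
      hence "z \<le> 1" if "z < 1 / real m" for z using that by linarith
      thus ?thesis
        using eventually_at_right_real[of 0 "1 / real m"] m by (auto elim!: eventually_mono)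
    qed
    thus ?thesis using y by (auto simp: filterlim_iff)
  qed
  have evp: "\<forall>\<^sub>F k in sequentially. \<psi> (y k) > 0 \<and> q k > 0 \<and> q k \<le> 1"
    using ev
  proof eventually_elim
    case (elim k)
    have "0 < 1 - exp (- (real m * y k))" using elim m by simp
    thus ?case using elim by (auto simp: q_def intro!: psi_pos psi_le_1)
  qed
  have my: "filterlim (\<lambda>k. real m * y k) (at_right 0) sequentially"
  proof -
    have "filterlim (\<lambda>z. real m * z) (at_right 0) (at_right 0)" using m by real_asymp
    thus ?thesis using y by (rule filterlim_compose)
  qed
  have frac: "((\<lambda>t::real. (1 - exp (- t)) / t) \<longlongrightarrow> 1) (at_right 0)" by real_asymp
  have ratio: "(\<lambda>k. \<psi> (real m * y k) / \<psi> (y k)) \<longlonglongrightarrow> real m powr \<beta>"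
    by (rule filterlim_compose[OF regularly_varying_ratio[OF rv m] y])
  have "(\<lambda>k. q k / \<psi> (y k)) \<longlonglongrightarrow> real m powr \<beta>"
  proof (rule tendsto_sandwich[OF _ _ _ ratio])
    show "(\<lambda>k. ?f (real m * y k) * (\<psi> (real m * y k) / \<psi> (y k))) \<longlonglongrightarrow> real m powr \<beta>"
      using tendsto_mult[OF filterlim_compose[OF frac my] ratio] by simp
    show "\<forall>\<^sub>F k in sequentially. ?f (real m * y k) * (\<psi> (real m * y k) / \<psi> (y k)) \<le> q k / \<psi> (y k)"
      using ev evp
    proof eventually_elim
      case (elim k)
      let ?u = "real m * y k"
      have u: "?u > 0" using elim m by simp
      have le: "1 - exp (- ?u) \<le> ?u" using exp_ge_add_one_self[of "- ?u"] by simp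
      have "?f ?u * \<psi> ?u \<le> \<psi> (?f ?u * ?u)"
        using u le by (intro psi_scale_ge) (auto simp: divide_le_eq_1)
      also have "?f ?u * ?u = 1 - exp (- ?u)" using u by simp
      finally have "?f ?u * \<psi> ?u \<le> q k" by (simp add: q_def)
      hence "?f ?u * \<psi> ?u / \<psi> (y k) \<le> q k / \<psi> (y k)"
        using elim by (intro divide_right_mono) auto
      thus ?case by simp
    qed
    show "\<forall>\<^sub>F k in sequentially. q k / \<psi> (y k) \<le> \<psi> (real m * y k) / \<psi> (y k)"
      using ev evp
    proof eventually_elim
      case (elim k)
      have "1 - exp (- (real m * y k)) \<le> real m * y k" using exp_ge_add_one_self[of "- (real m * y k)"] by simp
      hence "q k \<le> \<psi> (real m * y k)" unfolding q_def using elim m by (intro psi_mono) auto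
      thus ?case using elim by (intro divide_right_mono) auto
    qed
  qed
  note qlim = this
  define t where "t k = real (n k) * q k" for k
  have "(\<lambda>k. (real (n k) * \<psi> (y k)) * (q k / \<psi> (y k))) \<longlonglongrightarrow> 0 * real m powr \<beta>"
    by (rule tendsto_mult[OF small qlim])
  moreover have "\<forall>\<^sub>F k in sequentially. (real (n k) * \<psi> (y k)) * (q k / \<psi> (y k)) = t k"
    using evp by eventually_elim (simp add: t_def)
  ultimately have t0: "t \<longlonglongrightarrow> 0" using Lim_transform_eventually[of _ 0 sequentially t] by simp
  have tpos: "\<forall>\<^sub>F k in sequentially. t k > 0"
    using evp n by eventually_elim (simp add: t_def)
  have tr: "filterlim t (at_right 0) sequentially"
    using t0 tpos by (auto simp: filterlim_at elim: eventually_mono)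
  have "(\<lambda>k. (1 - (1 - q k) ^ n k) / t k) \<longlonglongrightarrow> 1"
  proof (rule tendsto_sandwich[OF _ _ filterlim_compose[OF frac tr] tendsto_const])
    show "\<forall>\<^sub>F k in sequentially. (1 - exp (- t k)) / t k \<le> (1 - (1 - q k) ^ n k) / t k"
      using evp tpos
    proof eventually_elim
      case (elim k)
      have "(1 - q k) ^ n k \<le> exp (- q k) ^ n k"
        using elim exp_ge_add_one_self[of "- q k"] by (intro power_mono) auto
      also have "\<dots> = exp (- t k)" by (simp add: t_def exp_of_nat_mult[symmetric])
      finally show ?case using elim by (intro divide_right_mono) auto
    qed
    show "\<forall>\<^sub>F k in sequentially. (1 - (1 - q k) ^ n k) / t k \<le> 1"
      using evp tpos
    proof eventually_elim
      case (elim k)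
      have "1 + real (n k) * (- q k) \<le> (1 + (- q k)) ^ n k"
        using elim by (intro Bernoulli_inequality) auto
      thus ?case using elim by (simp add: t_def)
    qed
  qed
  from tendsto_mult[OF this qlim]
  have "(\<lambda>k. (1 - (1 - q k) ^ n k) / t k * (q k / \<psi> (y k))) \<longlonglongrightarrow> real m powr \<beta>" by simp
  moreover have "\<forall>\<^sub>F k in sequentially. (1 - (1 - q k) ^ n k) / t k * (q k / \<psi> (y k)) = (1 - (1 - q k) ^ n k) / (real (n k) * \<psi> (y k))"
    using evp n by eventually_elim (simp add: t_def)
  ultimately show ?thesis unfolding q_def by (rule Lim_transform_eventually)
qed

text \<open>The method of moments on \<open>[0, 1]\<close>: the expectation of \<open>w^m\<close> is
  the Laplace transform at \<open>m y\<close>, so the moments of the weighted laws tend to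
  \<open>(m + 1) powr \<beta> - m powr \<beta>\<close>, which are those of the stable Levy measure.
  The second claim is the case \<open>m = 0\<close>.\<close>

lemma mix_kernel_asymptotics:
  fixes y :: "nat \<Rightarrow> real" and n :: "nat \<Rightarrow> nat"
  assumes rv: "regularly_varying_at_zero \<psi> \<beta>" and \<beta>: "0 < \<beta>" "\<beta> < 1" and d: "d \<ge> 1"
    and y: "filterlim y (at_right 0) sequentially" "\<And>k. y k \<ge> 0" and n: "\<forall>\<^sub>F k in sequentially. n k > 0"
    and small: "(\<lambda>k. real (n k) * \<psi> (y k)) \<longlonglongrightarrow> 0"
  defines "w \<equiv> \<lambda>k. lw (y k) (n k)"
  shows "(\<lambda>k. expectation (\<lambda>s. (1 - w k s) * mix_kernel d (w k s)) / (real (n k) * \<psi> (y k)))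
      \<longlonglongrightarrow> \<beta> / Gamma (1 - \<beta>) * 2 powr (real d / 2 + \<beta>) * Gamma (real d / 2 + \<beta>)"
    and "(\<lambda>k. expectation (\<lambda>s. 1 - w k s) / (real (n k) * \<psi> (y k))) \<longlonglongrightarrow> 1"
proof -
  have w01: "w k s \<in> {0..1}" for k s using lw_range[OF y(2)] by (simp add: w_def)
  have wm [measurable]: "w k \<in> borel_measurable M" for k by (simp add: w_def)
  have wpint: "integrable M (\<lambda>s. w k s ^ m)" for k m
    by (rule integrable_const_bound[of _ 1]) (use w01 in \<open>auto intro!: power_le_one\<close>)
  have wpow: "expectation (\<lambda>s. w k s ^ m) = (1 - \<psi> (1 - exp (- (real m * y k)))) ^ n k" for k m
  proof -
    have "w k s ^ m = exp (- (real m * y k)) ^ partial_sum R (n k) s" for s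
      by (simp add: w_def lw_def exp_of_nat_mult[symmetric] mult_ac)
    thus ?thesis using expectation_power_tau[of "exp (- (real m * y k))" "n k"] y(2)[of k] by simp
  qed
  have lim: "(\<lambda>k. expectation (\<lambda>s. (1 - w k s) * w k s ^ m) / (real (n k) * \<psi> (y k))) \<longlonglongrightarrow> real (m + 1) powr \<beta> - real m powr \<beta>" for m
  proof -
    let ?\<Phi> = "\<lambda>m k. (1 - (1 - \<psi> (1 - exp (- (real m * y k)))) ^ n k) / (real (n k) * \<psi> (y k))"
    have "(1 - w k s) * w k s ^ m = w k s ^ m - w k s ^ (m + 1)" for k s by (simp add: algebra_simps)
    hence "expectation (\<lambda>s. (1 - w k s) * w k s ^ m) = expectation (\<lambda>s. w k s ^ m) - expectation (\<lambda>s. w k s ^ (m + 1))" for k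
      using wpint by (simp only: Bochner_Integration.integral_diff)
    hence "expectation (\<lambda>s. (1 - w k s) * w k s ^ m) / (real (n k) * \<psi> (y k)) = ?\<Phi> (m + 1) k - ?\<Phi> m k" for k
      unfolding wpow by (simp only: diff_divide_distrib[symmetric]) simp
    moreover have "(\<lambda>k. ?\<Phi> (m + 1) k - ?\<Phi> m k) \<longlonglongrightarrow> real (m + 1) powr \<beta> - real m powr \<beta>"
      by (intro tendsto_diff laplace_asymptotics rv \<beta> y n small)
    ultimately show ?thesis by simp
  qed
  show "(\<lambda>k. expectation (\<lambda>s. 1 - w k s) / (real (n k) * \<psi> (y k))) \<longlonglongrightarrow> 1"
    using lim[of 0] by simp
  show "(\<lambda>k. expectation (\<lambda>s. (1 - w k s) * mix_kernel d (w k s)) / (real (n k) * \<psi> (y k)))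
      \<longlonglongrightarrow> \<beta> / Gamma (1 - \<beta>) * 2 powr (real d / 2 + \<beta>) * Gamma (real d / 2 + \<beta>)"
    unfolding stable_levy_mix_kernel[OF \<beta>, symmetric]
  proof (rule weighted_moment_convergence)
    show "(\<lambda>k. expectation (\<lambda>s. (1 - w k s) * w k s ^ m) / (real (n k) * \<psi> (y k)))
        \<longlonglongrightarrow> (LINT s|stable_levy \<beta>. (1 - exp (- max 0 s)) * exp (- max 0 s) ^ m)" for m
      unfolding stable_levy_moment(2)[OF \<beta>] by (rule lim)
    show "integrable (stable_levy \<beta>) (\<lambda>s. 1 - exp (- max 0 s))" by (rule stable_levy_moment(1)[OF \<beta>])
    show "continuous_on {0..1} (mix_kernel d)" by (rule continuous_mix_kernel[OF d])
  qed (use w01 wm integrable_lw[OF y(2)] eventually_scale_pos[OF y(1) n] in \<open>auto simp: w_def\<close>)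
qed

end

section \<open>The asymptotics\<close>

context class_S_walk begin

text \<open>Given that the random time equals \<open>m\<close>, convolving with the law at time
  \<open>j\<close> is the Chapman-Kolmogorov sum for time \<open>m + j\<close>; summing over
  \<open>j < r\<close> gives the period sum.\<close>

lemma lat_conv_period_sum:
  assumes P: "prob_space M" and \<tau>: "\<tau> \<in> measurable M (count_space UNIV)"
    and f: "\<And>y. f y = (LINT s|M. tp (\<tau> s) y)"
  shows "lat_conv (\<lambda>y. \<Sum>j<r. conv_power (pmf p) j y) f x = (LINT s|M. period_sum x (\<tau> s))"
proof -
  interpret prob_space M by (rule P)
  have meas: "(\<lambda>s. g (\<tau> s)) \<in> borel_measurable M" for g :: "nat \<Rightarrow> real"
    using \<tau> by (rule measurable_compose) simp
  have int: "integrable M (\<lambda>s. tp (j + \<tau> s) y)" for j y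
    by (rule integrable_const_bound[of _ 1]) (auto intro: meas simp: pmf_le_1)
  have "(\<Sum>u\<in>supp j. tp j u * f (x - u)) = (LINT s|M. tp (\<tau> s + j) x)" for j
  proof -
    have conv: "(\<Sum>u\<in>supp j. tp j u * tp m (x - u)) = tp (m + j) x" for m
      unfolding add.commute[of m] walk_pmf_add
      by (rule pmf_conv_pmf[symmetric]) (simp add: finite_set_walk_pmf)
    have "(\<Sum>u\<in>supp j. tp j u * f (x - u))
        = (LINT s|M. (\<Sum>u\<in>supp j. tp j u * tp (\<tau> s) (x - u)))"
      unfolding f using int[of 0] by (subst Bochner_Integration.integral_sum) simp_all
    thus ?thesis unfolding conv .
  qed
  hence "lat_conv (\<lambda>y. \<Sum>j<r. conv_power (pmf p) j y) f x = (\<Sum>j<r. LINT s|M. tp (\<tau> s + j) x)"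
    unfolding conv_power_p by (simp add: lat_conv_sum_pmf finite_set_walk_pmf)
  also have "\<dots> = (LINT s|M. period_sum x (\<tau> s))"
    unfolding period_sum_def using int by (subst Bochner_Integration.integral_sum) (simp_all add: add.commute)
  finally show ?thesis .
qed

text \<open>Diffusive scaling: apart from the factor \<open>nrm x ^ (- d)\<close>, the density
  depends on \<open>k\<close> only through \<open>s = k / (nrm x)^2\<close>. For
  \<open>k = 0\<close> both sides are 0.\<close>

lemma gauss_eq_mix_kernel:
  assumes "nrm x > 0"
  shows "gauss x k = (1 / (sqrt (2 * pi) ^ CARD('d) * sqrt (det Q))) / nrm x ^ CARD('d)
     * ((1 - exp (- (inverse ((nrm x)\<^sup>2) * real k))) * mix_kernel CARD('d) (exp (- (inverse ((nrm x)\<^sup>2) * real k))))"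
proof (cases "k = 0")
  case True
  thus ?thesis by (simp add: gauss_def)
next
  case False
  let ?\<rho> = "nrm x"
  let ?s = "inverse (?\<rho>\<^sup>2) * real k"
  have s: "?s > 0" using False assms by simp
  have k: "real k = ?\<rho>\<^sup>2 * ?s" using assms by simp
  have e: "- ?\<rho>\<^sup>2 / (2 * real k) = - 1 / (2 * ?s)" using False assms by (simp add: field_simps)
  have sq: "sqrt (2 * pi * real k) ^ CARD('d) = sqrt (2 * pi) ^ CARD('d) * (?\<rho> ^ CARD('d) * sqrt ?s ^ CARD('d))"
    using assms by (subst k) (simp only: real_sqrt_mult power_mult_distrib real_sqrt_abs abs_of_pos)
  have "A / (B * (C * D) * E) = 1 / (B * E) / C * (A / D)" for A B C D E :: real
    by (simp add: field_simps)
  thus ?thesis unfolding mix_kernel_exp[OF s] gauss_def e sq .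
qed

end

text \<open>The right-hand side is what the computation delivers: the prefactor of the Gaussian
  density times the limit from \<open>stable_levy_mix_kernel\<close>. The reflection formula trades
  \<open>1 / Gamma (1 - \<alpha> / 2)\<close> for
  \<open>Gamma (\<alpha> / 2) sin (pi \<alpha> / 2) / pi\<close>; the rest collects powers of 2 and
  \<open>pi\<close>.\<close>

lemma C_const_eq:
  fixes p :: "(int ^ 'd::finite) pmf"
  assumes \<alpha>: "0 < \<alpha>" "\<alpha> < 2" and det: "det (cov_matrix p) > 0"
  shows "C_const p \<alpha> = 1 / (sqrt (2 * pi) ^ CARD('d) * sqrt (det (cov_matrix p)))
      * (\<alpha> / 2 / Gamma (1 - \<alpha> / 2) * 2 powr (real CARD('d) / 2 + \<alpha> / 2) * Gamma (real CARD('d) / 2 + \<alpha> / 2))"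
    and "C_const p \<alpha> > 0"
proof -
  let ?\<beta> = "\<alpha> / 2" and ?D = "real CARD('d) / 2" and ?\<Delta> = "det (cov_matrix p)"
  have \<beta>: "0 < ?\<beta>" "?\<beta> < 1" using \<alpha> by auto
  have G1: "Gamma (1 - ?\<beta>) > 0" and G2: "Gamma ?\<beta> > 0" and G3: "Gamma (?D + ?\<beta>) > 0"
    using \<beta> by (auto intro!: Gamma_real_pos add_nonneg_pos)
  have sp: "sin (pi * ?\<beta>) > 0" using \<beta> by (intro sin_gt_zero) auto
  have refl: "1 / Gamma (1 - ?\<beta>) = Gamma ?\<beta> * sin (pi * ?\<beta>) / pi"
    using Gamma_reflection_real[OF \<beta>] G1 sp by (simp add: field_simps)
  have s2: "sqrt (2 * pi) ^ CARD('d) = 2 powr ?D * pi powr ?D"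
    by (simp add: powr_half_sqrt[symmetric] powr_realpow[symmetric] powr_powr powr_mult)
  have dd: "?\<Delta> powr (- 1 / 2) = 1 / sqrt ?\<Delta>"
    using det by (simp add: powr_minus_divide powr_half_sqrt)
  have p1: "pi powr (- real CARD('d) / 2 - 1) = 1 / (pi powr ?D * pi)"
    by (simp add: powr_diff powr_minus_divide)
  have p2: "2 powr (\<alpha> / 2 - 1) = 2 powr ?\<beta> / (2::real)" by (simp add: powr_diff)
  have p3: "(2::real) powr (?D + ?\<beta>) = 2 powr ?D * 2 powr ?\<beta>" by (rule powr_add)
  have g: "(real CARD('d) + \<alpha>) / 2 = ?D + ?\<beta>" by (simp add: add_divide_distrib)
  have s: "sin (pi * \<alpha> / 2) = sin (pi * ?\<beta>)" by simp
  have e: "C_const p \<alpha> = \<alpha> * (2 powr ?\<beta> / 2) * (1 / (pi powr ?D * pi)) * (1 / sqrt ?\<Delta>) * Gamma ?\<beta> * Gamma (?D + ?\<beta>) * sin (pi * ?\<beta>)"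
    unfolding C_const_def p1 p2 dd g s ..
  show "C_const p \<alpha> = 1 / (sqrt (2 * pi) ^ CARD('d) * sqrt ?\<Delta>)
      * (?\<beta> / Gamma (1 - ?\<beta>) * 2 powr (?D + ?\<beta>) * Gamma (?D + ?\<beta>))"
  proof -
    have "?\<beta> / Gamma (1 - ?\<beta>) = ?\<beta> * (1 / Gamma (1 - ?\<beta>))" by simp
    hence b: "?\<beta> / Gamma (1 - ?\<beta>) = ?\<beta> * (Gamma ?\<beta> * sin (pi * ?\<beta>) / pi)" unfolding refl .
    have "a * (A / 2) * (1 / (P * q)) * (1 / S) * g1 * g2 * z = 1 / (T * P * S) * (a / 2 * (g1 * z / q) * (T * A) * g2)"
      if "T \<noteq> 0" for a A P q S g1 g2 z T :: real
    proof -
      have "1 / (T * P * S) * (a / 2 * (g1 * z / q) * (T * A) * g2) = (T * (1 / T)) * (a * (A / 2) * (1 / (P * q)) * (1 / S) * g1 * g2 * z)"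
        by (simp only: divide_inverse inverse_mult_distrib mult_1_left mult_ac)
      thus ?thesis using that by simp
    qed
    from this[of "2 powr ?D"] show ?thesis unfolding e b s2 p3 by simp
  qed
  show "C_const p \<alpha> > 0"
    unfolding e using \<alpha> det G2 G3 sp by (intro mult_pos_pos) auto
qed

theorem theorem5p3:
  fixes \<alpha> a b :: real
    and \<psi> :: "real \<Rightarrow> real"
    and \<nu> :: "real measure"
    and p :: "(int ^ 'd::finite) pmf"
    and r :: nat
    and M :: "'w measure"
    and X :: "nat \<Rightarrow> 'w \<Rightarrow> int ^ 'd"
    and R :: "nat \<Rightarrow> 'w \<Rightarrow> nat"
    and x :: "nat \<Rightarrow> int ^ 'd"
    and n :: "nat \<Rightarrow> nat"
  assumes "0 < \<alpha>" "\<alpha> < 2"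
    and "bernstein_function \<psi>"
    and "bernstein_representation \<psi> a b \<nu>"
    and "regularly_varying_at_zero \<psi> (\<alpha> / 2)"
    and "\<psi> 0 = 0" "\<psi> 1 = 1"
    and "class_S p"
    and "r = period p"
    and "prob_space M"
    and "iid_steps M p X"
    and "iid_subordinator_steps M b \<nu> R"
    and "independent_processes M R (partial_sum X)"
    and "filterlim n at_top sequentially"
    and "filterlim (\<lambda>k. cov_norm p (x k)) at_top sequentially"
    and "(\<lambda>k. real (n k) * \<psi> (cov_norm p (x k) powi (- 2))) \<longlonglongrightarrow> 0"
  shows "(\<lambda>k. lat_conv (\<lambda>y. \<Sum>j<r. conv_power (pmf p) j y)
                 (\<lambda>y. subordinate_transition M X R y (n k)) (x k)
              / (real r * C_const p \<alpha> * real (n k)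
                 * cov_norm p (x k) powi (- int CARD('d))
                 * \<psi> (cov_norm p (x k) powi (- 2)))) \<longlonglongrightarrow> 1"
proof -
  let ?r = "real (period p)"
  interpret class_S_walk p using assms(8) by unfold_locales
  interpret prob_space M by (rule assms(10))
  interpret subordinator \<psi> a b \<nu> M R
    using assms(4,6,7,12) by unfold_locales
  let ?\<rho> = "\<lambda>k. cov_norm p (x k)"
  let ?\<tau> = "\<lambda>k s. partial_sum R (n k) s"
  define y where "y k = inverse ((?\<rho> k)\<^sup>2)" for k
  define N where "N k = real (n k) * \<psi> (y k)" for k
  have y_powi: "?\<rho> k powi (- 2) = y k" for k
    by (simp add: y_def power_int_minus)
  have \<rho>_powi: "?\<rho> k powi (- int CARD('d)) = 1 / ?\<rho> k ^ CARD('d)" for k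
    by (simp add: power_int_minus divide_inverse)
  have y0: "y k \<ge> 0" for k by (simp add: y_def)
  have ylim: "filterlim y (at_right 0) sequentially"
  proof -
    have "filterlim (\<lambda>z::real. inverse (z\<^sup>2)) (at_right 0) at_top" by real_asymp
    from filterlim_compose[OF this assms(15)] show ?thesis by (simp add: y_def[abs_def])
  qed
  have "\<forall>\<^sub>F k in sequentially. n k \<ge> 1"
    using assms(14) unfolding filterlim_at_top by blast
  hence npos: "\<forall>\<^sub>F k in sequentially. n k > 0" by eventually_elim simp
  have small: "(\<lambda>k. real (n k) * \<psi> (y k)) \<longlonglongrightarrow> 0" using assms(16) by (simp add: y_powi)
  have \<beta>: "0 < \<alpha> / 2" "\<alpha> / 2 < 1" using assms(1,2) by auto
  define w where "w k = lw (y k) (n k)" for k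
  define \<kappa> where "\<kappa> = 1 / (sqrt (2 * pi) ^ CARD('d) * sqrt (det Q))"
  define K where "K = \<alpha> / 2 / Gamma (1 - \<alpha> / 2) * 2 powr (real CARD('d) / 2 + \<alpha> / 2) * Gamma (real CARD('d) / 2 + \<alpha> / 2)"
  have C: "C_const p \<alpha> = \<kappa> * K" and Cpos: "C_const p \<alpha> > 0"
    using C_const_eq[OF assms(1,2) det_cov_pos] by (simp_all add: \<kappa>_def K_def)
  define EK where "EK k = expectation (\<lambda>s. (1 - w k s) * mix_kernel CARD('d) (w k s))" for k
  have lim1: "(\<lambda>k. EK k / N k) \<longlonglongrightarrow> K"
    and lim2: "(\<lambda>k. expectation (\<lambda>s. 1 - w k s) / N k) \<longlonglongrightarrow> 1"
    unfolding EK_def N_def K_def w_def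
    by (rule mix_kernel_asymptotics[where d="CARD('d)", OF assms(5) \<beta> _ ylim y0 npos small], simp)+
  define U where "U k = expectation (\<lambda>s. period_sum (x k) (?\<tau> k s))" for k
  have U: "lat_conv (\<lambda>y. \<Sum>j<r. conv_power (pmf p) j y) (\<lambda>y. subordinate_transition M X R y (n k)) (x k) = U k" for k
    unfolding U_def assms(9)
    by (rule lat_conv_period_sum[OF assms(10) tau_meas])
       (rule subordinate_transition_expectation[OF assms(11) finite_supp assms(13) R_meas])
  have psum_le: "\<bar>period_sum z k\<bar> \<le> ?r" for z k
    using period_sum_nonneg[of z k] sum_mono[of "{..<period p}" "\<lambda>j. pmf (walk_pmf p (k + j)) z" "\<lambda>_. 1"]
    by (simp add: period_sum_def pmf_le_1)
  have psum_int: "integrable M (\<lambda>s. period_sum (x k) (?\<tau> k s))" for k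
    by (rule integrable_const_bound[of _ "?r"])
       (use psum_le in \<open>auto intro: measurable_compose[OF tau_meas]\<close>)
  have "\<exists>B. \<forall>z\<in>{0..1}. \<bar>mix_kernel CARD('d) z\<bar> \<le> B"
    using compact_imp_bounded[OF compact_continuous_image[OF continuous_mix_kernel[of "CARD('d)"] compact_Icc]]
    by (auto simp: bounded_iff)
  then obtain B where B: "\<And>z. z \<in> {0..1} \<Longrightarrow> \<bar>mix_kernel CARD('d) z\<bar> \<le> B" by blast
  have wint: "integrable M (\<lambda>s. 1 - w k s)" for k
    unfolding w_def by (rule integrable_lw[OF y0])
  have mint: "integrable M (\<lambda>s. (1 - w k s) * mix_kernel CARD('d) (w k s))" for k
    unfolding w_def
    by (rule integral_unit_interval_bound(1)[OF integrable_lw[OF y0] lw_range[OF y0] lw_measurable mix_kernel_borel B])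
  \<comment> \<open>\<open>U k\<close> and the Gaussian term are expectations over the same random
    time, so the pointwise bound \<open>period_sum_error\<close> can be integrated. Its weight is
    \<open>1 - w k\<close>, whose expectation is asymptotic to \<open>N k\<close> by
    \<open>lim2\<close>; the error thus has the size of the main term times an arbitrarily small
    factor.\<close>
  have "(\<lambda>k. ?\<rho> k ^ CARD('d) * U k / N k - ?r * \<kappa> * (EK k / N k)) \<longlonglongrightarrow> 0"
  proof (rule tendstoI)
    fix e :: real assume e: "e > 0"
    obtain Z where Z: "Z > 0" "\<And>z k. cov_norm p z \<ge> Z \<Longrightarrow> k > 0 \<Longrightarrow>
       \<bar>period_sum z k - ?r * gauss z k\<bar> \<le> e / 2 * (1 - exp (- real k / (cov_norm p z)\<^sup>2)) / cov_norm p z ^ CARD('d)"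
      using period_sum_error[of "e / 2"] e by auto
    have ev1: "\<forall>\<^sub>F k in sequentially. ?\<rho> k \<ge> Z"
      using assms(15) by (simp add: filterlim_at_top)
    \<comment> \<open>Any bound above the limit 1 would serve; 2 matches the choice of
      \<open>e / 2\<close> in the pointwise error.\<close>
    have ev2: "\<forall>\<^sub>F k in sequentially. expectation (\<lambda>s. 1 - w k s) / N k < 2"
      using lim2 by (rule order_tendstoD) simp
    have ev3: "\<forall>\<^sub>F k in sequentially. N k > 0"
      unfolding N_def by (rule eventually_scale_pos[OF ylim npos])
    show "\<forall>\<^sub>F k in sequentially. dist (?\<rho> k ^ CARD('d) * U k / N k - ?r * \<kappa> * (EK k / N k)) 0 < e"
      using ev1 ev2 ev3 npos
    proof eventually_elim
      case (elim k)
      let ?d = "?\<rho> k ^ CARD('d)"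
      have \<rho>: "?\<rho> k > 0" using elim(1) Z(1) by linarith
      hence d: "?d > 0" by simp
      have ge: "gauss (x k) (?\<tau> k s) = \<kappa> / ?d * ((1 - w k s) * mix_kernel CARD('d) (w k s))" for s
        unfolding gauss_eq_mix_kernel[OF \<rho>] \<kappa>_def w_def lw_def y_def ..
      have gint: "integrable M (\<lambda>s. gauss (x k) (?\<tau> k s))"
        unfolding ge by (intro integrable_mult_right mint)
      have Eg: "expectation (\<lambda>s. gauss (x k) (?\<tau> k s)) = \<kappa> / ?d * EK k"
        unfolding ge EK_def by simp
      have "\<bar>U k - ?r * (\<kappa> / ?d * EK k)\<bar> = \<bar>expectation (\<lambda>s. period_sum (x k) (?\<tau> k s) - ?r * gauss (x k) (?\<tau> k s))\<bar>"
        unfolding U_def Eg[symmetric] using psum_int gint by simp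
      also have "\<dots> \<le> expectation (\<lambda>s. \<bar>period_sum (x k) (?\<tau> k s) - ?r * gauss (x k) (?\<tau> k s)\<bar>)"
        by (rule integral_abs_bound)
      also have "\<dots> \<le> expectation (\<lambda>s. e / 2 / ?d * (1 - w k s))"
      proof (rule integral_mono_AE)
        show "integrable M (\<lambda>s. \<bar>period_sum (x k) (?\<tau> k s) - ?r * gauss (x k) (?\<tau> k s)\<bar>)"
          using psum_int gint by (intro integrable_abs Bochner_Integration.integrable_diff integrable_mult_right)
        show "integrable M (\<lambda>s. e / 2 / ?d * (1 - w k s))" by (intro integrable_mult_right wint)
        show "AE s in M. \<bar>period_sum (x k) (?\<tau> k s) - ?r * gauss (x k) (?\<tau> k s)\<bar> \<le> e / 2 / ?d * (1 - w k s)"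
          using AE_tau_pos[OF elim(4)]
        proof eventually_elim
          case (elim s)
          have "- real (?\<tau> k s) / (?\<rho> k)\<^sup>2 = - (y k * real (?\<tau> k s))" by (simp add: y_def divide_inverse)
          thus ?case using Z(2)[OF \<open>?\<rho> k \<ge> Z\<close> elim] by (simp add: w_def lw_def)
        qed
      qed
      also have "\<dots> = e / 2 / ?d * expectation (\<lambda>s. 1 - w k s)" by (rule integral_mult_right_zero)
      finally have bnd: "\<bar>U k - ?r * (\<kappa> / ?d * EK k)\<bar> \<le> e / 2 / ?d * expectation (\<lambda>s. 1 - w k s)" .
      have eq: "?d * U k / N k - ?r * \<kappa> * (EK k / N k) = ?d / N k * (U k - ?r * (\<kappa> / ?d * EK k))"
        using d \<rho> elim(3) by (simp add: field_simps)
      have "\<bar>?d * U k / N k - ?r * \<kappa> * (EK k / N k)\<bar> = ?d / N k * \<bar>U k - ?r * (\<kappa> / ?d * EK k)\<bar>"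
        unfolding eq abs_mult using d elim(3) by simp
      also have "\<dots> \<le> ?d / N k * (e / 2 / ?d * expectation (\<lambda>s. 1 - w k s))"
        using bnd d elim(3) by (intro mult_left_mono) auto
      also have "\<dots> = e / 2 * (expectation (\<lambda>s. 1 - w k s) / N k)" using \<rho> by simp
      also have "\<dots> < e / 2 * 2" using elim(2) e by (intro mult_strict_left_mono) auto
      finally show ?case by (simp add: dist_real_def)
    qed
  qed
  from tendsto_add[OF this tendsto_mult[OF tendsto_const[of "?r * \<kappa>"] lim1]]
  have "(\<lambda>k. ?\<rho> k ^ CARD('d) * U k / N k) \<longlonglongrightarrow> ?r * \<kappa> * K" by simp
  hence "(\<lambda>k. (?\<rho> k ^ CARD('d) * U k / N k) / (real r * C_const p \<alpha>)) \<longlonglongrightarrow> ?r * \<kappa> * K / (real r * C_const p \<alpha>)"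
    by (rule tendsto_divide[OF _ tendsto_const]) (use Cpos period_pos assms(9) in auto)
  also have "?r * \<kappa> * K / (real r * C_const p \<alpha>) = 1"
    using Cpos period_pos unfolding C assms(9) by (auto simp: zero_less_mult_iff)
  finally show ?thesis
    unfolding U y_powi \<rho>_powi N_def by (simp add: divide_inverse mult_ac)
qed

end
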